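(* Let $G$ be a (possibly infinite) graph with at least two vertices. Then $G$ is $3$-ac if and only if $G$ is a chain graph of $2$-connected links, or, equivalently, if and only if the block graph of $G$ is connected and contains no vertex of degree at least $3$.
   Context: A graph $G=(V,E)$ consists of a (possibly infinite) vertex set $V$ and a set $E\subseteq[V]^2$ of edges (vertex degrees may be infinite). $|G|$ denotes the $1$-complex of $G$: the quotient of $V\oplus\bigoplus_{e\in E}[0,1]_e$ ($V$ discrete) in which, for each edge $e=\{v,w\}$, $0\in[0,1]_e$ is identified with $v$ and $1\in[0,1]_e$ with $w$. An arc is a homeomorphic copy of $[0,1]$. $G$ is $n$-ac if for any choice of at most $n$ points of $|G|$ there is an arc in $|G|$ containing them. $G$ is $k$-connected if $G-W$ is connected for all $W\subseteq V$ with $|W|<k$ (so $K_2$ counts as $2$-connected). A connected graph is a chain graph if it is a linearly ordered union (possibly of just one) of subgraphs, called links, such that only consecutive links meet, and the intersection of two consecutive links consists of a single vertex. (The linear order may be finite, one-way infinite or two-way infinite.) A block of $G$ is an inclusion-maximal $2$-connected subgraph. With $C$ the set of cut-vertices of $G$ and $\mathcal B$ the set of blocks of $G$, the block graph $B(G)$ is the bipartite graph on the vertex set $C\,\dot\cup\,\mathcal B$ in which $c\in C$ and $B\in\mathcal B$ are adjacent if and only if $c\in B$. *)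

theory Defs
  imports "HOL-Analysis.Analysis" "HOL-Library.Extended_Nat"
begin

section \<open>Graphs\<close>

datatype 'a graph = Graph (verts: "'a set") (edges: "'a set set")

definition simple_graph :: "'a graph \<Rightarrow> bool" where
  "simple_graph G \<longleftrightarrow> (\<forall>e\<in>edges G. e \<subseteq> verts G \<and> card e = 2)"

definition subgraph :: "'a graph \<Rightarrow> 'a graph \<Rightarrow> bool" where
  "subgraph H G \<longleftrightarrow> simple_graph H \<and> verts H \<subseteq> verts G \<and> edges H \<subseteq> edges G"

definition remove_verts :: "'a graph \<Rightarrow> 'a set \<Rightarrow> 'a graph" where
  "remove_verts G W = Graph (verts G - W) {e \<in> edges G. e \<inter> W = {}}"

definition adj :: "'a graph \<Rightarrow> ('a \<times> 'a) set" where
  "adj G = {(u, v). {u, v} \<in> edges G}"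

text \<open>The graph without vertices counts as connected. Hence a single vertex is
  2-connected, so that isolated vertices are blocks.\<close>

definition graph_connected :: "'a graph \<Rightarrow> bool" where
  "graph_connected G \<longleftrightarrow> (\<forall>u\<in>verts G. \<forall>v\<in>verts G. (u, v) \<in> (adj G)\<^sup>*)"

definition k_connected :: "nat \<Rightarrow> 'a graph \<Rightarrow> bool" where
  "k_connected k G \<longleftrightarrow>
     (\<forall>W. W \<subseteq> verts G \<and> finite W \<and> card W < k \<longrightarrow> graph_connected (remove_verts G W))"

definition degree :: "'a graph \<Rightarrow> 'a \<Rightarrow> enat" where
  "degree G v =
     (if finite {e \<in> edges G. v \<in> e} then enat (card {e \<in> edges G. v \<in> e}) else \<infinity>)"

section \<open>Chain graphs\<close>

text \<open>The links are indexed by a nonempty interval \<open>I\<close> of the integers: these are, up to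
  isomorphism, the finite, one-way infinite (in either direction) and two-way infinite
  orders. A common edge of two links is excluded by their having at most one common vertex.\<close>

definition chain_of_links :: "'a graph \<Rightarrow> int set \<Rightarrow> (int \<Rightarrow> 'a graph) \<Rightarrow> bool" where
  "chain_of_links G I L \<longleftrightarrow>
     I \<noteq> {} \<and> (\<forall>i\<in>I. \<forall>k\<in>I. {i..k} \<subseteq> I) \<and>
     (\<forall>i\<in>I. subgraph (L i) G) \<and>
     verts G = (\<Union>i\<in>I. verts (L i)) \<and> edges G = (\<Union>i\<in>I. edges (L i)) \<and>
     (\<forall>i\<in>I. \<forall>j\<in>I. i + 1 < j \<longrightarrow> verts (L i) \<inter> verts (L j) = {}) \<and>
     (\<forall>i. i \<in> I \<and> i + 1 \<in> I \<longrightarrow> (\<exists>v. verts (L i) \<inter> verts (L (i + 1)) = {v}))"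

definition chain_graph_with_links :: "('a graph \<Rightarrow> bool) \<Rightarrow> 'a graph \<Rightarrow> bool" where
  "chain_graph_with_links P G \<longleftrightarrow>
     graph_connected G \<and> (\<exists>I L. chain_of_links G I L \<and> (\<forall>i\<in>I. P (L i)))"

section \<open>The block graph\<close>

definition cut_vertices :: "'a graph \<Rightarrow> 'a set" where
  "cut_vertices G = {c \<in> verts G. \<exists>u\<in>verts G - {c}. \<exists>v\<in>verts G - {c}.
     (u, v) \<in> (adj G)\<^sup>* \<and> (u, v) \<notin> (adj (remove_verts G {c}))\<^sup>*}"

definition blocks :: "'a graph \<Rightarrow> 'a graph set" where
  "blocks G = {B. subgraph B G \<and> k_connected 2 B \<and>
     (\<forall>H. subgraph H G \<and> k_connected 2 H \<and> subgraph B H \<longrightarrow> H = B)}"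

definition block_graph :: "'a graph \<Rightarrow> ('a + 'a graph) graph" where
  "block_graph G = Graph (cut_vertices G <+> blocks G)
     {{Inl c, Inr B} | c B. c \<in> cut_vertices G \<and> B \<in> blocks G \<and> c \<in> verts B}"

section \<open>The 1-complex of a graph\<close>

definition quotient_topology :: "'a topology \<Rightarrow> ('a \<times> 'a) set \<Rightarrow> 'a set topology" where
  "quotient_topology X R = topology (\<lambda>U. U \<subseteq> topspace X // R \<and> openin X (\<Union>U))"

lemma openin_quotient_topology:
  assumes "equiv (topspace X) R"
  shows "openin (quotient_topology X R) U \<longleftrightarrow> U \<subseteq> topspace X // R \<and> openin X (\<Union>U)"
proof -
  have "istopology (\<lambda>U. U \<subseteq> topspace X // R \<and> openin X (\<Union>U))"
    unfolding istopology_def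
  proof (intro conjI allI impI)
    fix S T
    assume S: "S \<subseteq> topspace X // R \<and> openin X (\<Union>S)" and T: "T \<subseteq> topspace X // R \<and> openin X (\<Union>T)"
    have "\<Union>(S \<inter> T) = \<Union>S \<inter> \<Union>T"
      using S T quotient_disj[OF assms] by blast
    then show "openin X (\<Union>(S \<inter> T))"
      using S T by (simp add: openin_Int)
    show "S \<inter> T \<subseteq> topspace X // R"
      using S by blast
  next
    fix \<K>
    assume *: "\<forall>K\<in>\<K>. K \<subseteq> topspace X // R \<and> openin X (\<Union>K)"
    then show "\<Union>\<K> \<subseteq> topspace X // R"
      by blast
    have "\<Union>(\<Union>\<K>) = (\<Union>K\<in>\<K>. \<Union>K)"
      by blast
    then show "openin X (\<Union>(\<Union>\<K>))"
      using * by auto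
  qed
  then show ?thesis
    by (simp add: quotient_topology_def)
qed

lemma topspace_quotient_topology:
  assumes "equiv (topspace X) R"
  shows "topspace (quotient_topology X R) = topspace X // R"
  using openin_quotient_topology[OF assms] Union_quotient[OF assms]
  by (metis openin_subset openin_topspace subset_antisym subset_refl)

text \<open>Each edge \<open>{v, w}\<close> is given a fixed orientation, which decides whether
  \<open>0\<close> is identified with \<open>v\<close> and \<open>1\<close> with \<open>w\<close> or vice versa.\<close>

definition end0 :: "'a set \<Rightarrow> 'a" where
  "end0 e = (SOME v. v \<in> e)"

definition end1 :: "'a set \<Rightarrow> 'a" where
  "end1 e = (SOME w. w \<in> e \<and> w \<noteq> end0 e)"

lemma end0_end1:
  assumes "card e = 2"
  shows "e = {end0 e, end1 e}" "end0 e \<noteq> end1 e"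
proof -
  obtain x y where xy: "e = {x, y}" "x \<noteq> y"
    using assms by (auto simp: card_2_iff)
  have 0: "end0 e \<in> e"
    unfolding end0_def using xy by (metis insertI1 someI)
  then have "\<exists>w. w \<in> e \<and> w \<noteq> end0 e"
    using xy by auto
  then have "end1 e \<in> e \<and> end1 e \<noteq> end0 e"
    unfolding end1_def by (rule someI_ex)
  with 0 xy show "e = {end0 e, end1 e}" "end0 e \<noteq> end1 e"
    by auto
qed

text \<open>The disjoint sum of the discrete space of vertices, written as a sum of one-point
  spaces, and one unit interval for each edge: \<open>(Inl v, 0)\<close> is the vertex \<open>v\<close>, and
  \<open>(Inr e, t)\<close> is the point \<open>t\<close> of the copy of the unit interval for \<open>e\<close>.\<close>

definition presum :: "'a graph \<Rightarrow> (('a + 'a set) \<times> real) topology" where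
  "presum G = sum_topology
     (\<lambda>i. case i of Inl v \<Rightarrow> top_of_set {0} | Inr e \<Rightarrow> top_of_set {0..1})
     (verts G <+> edges G)"

definition glue :: "'a graph \<Rightarrow> ('a + 'a set) \<times> real \<Rightarrow> ('a + 'a set) \<times> real \<Rightarrow> bool" where
  "glue G p q \<longleftrightarrow> (\<exists>e\<in>edges G.
     p = (Inr e, 0) \<and> q = (Inl (end0 e), 0) \<or> p = (Inr e, 1) \<and> q = (Inl (end1 e), 0))"

definition glue_rel :: "'a graph \<Rightarrow> ((('a + 'a set) \<times> real) \<times> (('a + 'a set) \<times> real)) set" where
  "glue_rel G = {(p, q). p \<in> topspace (presum G) \<and> q \<in> topspace (presum G) \<and> equivclp (glue G) p q}"

lemma equiv_glue_rel: "equiv (topspace (presum G)) (glue_rel G)"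
  by (rule equivI)
    (auto simp: glue_rel_def refl_on_def sym_def trans_def intro: equivclp_sym equivclp_trans)

definition one_complex :: "'a graph \<Rightarrow> (('a + 'a set) \<times> real) set topology" where
  "one_complex G = quotient_topology (presum G) (glue_rel G)"

definition is_arc_in :: "'a topology \<Rightarrow> 'a set \<Rightarrow> bool" where
  "is_arc_in X A \<longleftrightarrow>
     A \<subseteq> topspace X \<and> subtopology X A homeomorphic_space top_of_set {0..1::real}"

definition n_ac :: "nat \<Rightarrow> 'a graph \<Rightarrow> bool" where
  "n_ac n G \<longleftrightarrow>
     (\<forall>P. P \<subseteq> topspace (one_complex G) \<and> finite P \<and> card P \<le> n \<longrightarrow>
        (\<exists>A. is_arc_in (one_complex G) A \<and> P \<subseteq> A))"

end

theory Submission
  imports Defs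
begin

text \<open>
  Call \<open>y\<close> a middle of \<open>{x, y, z}\<close> if no vertex \<open>c \<noteq> y\<close> separates \<open>y\<close> from \<open>{x, z} - {c}\<close>.
  The middle point on an arc through three vertices has this property. Three vertices in
  different blocks at a common cut-vertex have no middle, and neither have three vertices cut
  off from a block by three different cut-vertices; so for a \<open>3\<close>-ac graph all degrees of the block
  graph are at most \<open>2\<close>, and following the blocks in both directions gives the chain.

  Conversely, the vertices of a chain of \<open>2\<close>-connected links can be ordered linearly such that
  \<open>y\<close> is a middle of \<open>{x, y, z}\<close> whenever \<open>x < y < z\<close>. Such an order extends to a subdivision of an
  edge \<open>{u, v}\<close> with \<open>u < v\<close>: the new vertex is put directly after \<open>u\<close>. Hence three given points
  of \<open>|G|\<close> may be assumed to be vertices. If \<open>y\<close> is a middle of \<open>{x, y, z}\<close>, some path of the graph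
  contains all three (Menger's theorem for two paths), and this path is an arc of \<open>|G|\<close>.
\<close>

section \<open>Paths and separation\<close>

text \<open>Vertex degrees may be infinite, so \<open>|G|\<close> need not be metrizable. Its
  topology is accessed through continuous real functions that are affine on the edges or supported
  by a single edge: they tell points apart, and they show that a connected set missing a vertex
  cannot pass it. Subdividing is done inside one fixed space: a drawn graph has points as vertices
  and arcs as edges, so a new vertex changes the drawing but not \<open>|G|\<close>. That each
  triple has some middle does not say how a subdividing vertex fits in; a linear order does. The
  delicate case is a new \<open>p\<close> between \<open>u\<close> and \<open>v\<close> when
  \<open>u\<close> is deleted: then \<open>p\<close> must escape through \<open>v\<close>, and this
  works because the order forces \<open>v\<close> and every later \<open>z\<close> to be joined in
  \<open>G - u\<close>. Blocks are treated as vertex sets whose elements cannot be separated in all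
  of \<open>G\<close>. This makes Zorn's lemma and unions easy, and maximality brings the connecting
  paths back into the set. The walk through the blocks never closes up, because the vertex shared by
  two consecutive links separates the first of them from all later ones.\<close>

definition reach :: "'a graph \<Rightarrow> 'a set \<Rightarrow> ('a \<times> 'a) set" where
  "reach G W = (adj (remove_verts G W))\<^sup>*"

text \<open>Membership in \<open>verts G\<close> is left out, so a one-element list always
  qualifies; \<open>spath_verts\<close> recovers it from the first vertex.\<close>

definition spath :: "'a graph \<Rightarrow> 'a list \<Rightarrow> bool" where
  "spath G xs \<longleftrightarrow> xs \<noteq> [] \<and> distinct xs \<and> successively (\<lambda>a b. {a, b} \<in> edges G) xs"

lemma adj_remove_verts:
  "(u, v) \<in> adj (remove_verts G W) \<longleftrightarrow> {u, v} \<in> edges G \<and> u \<notin> W \<and> v \<notin> W"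
  by (auto simp: adj_def remove_verts_def)

text \<open>Even a deleted vertex reaches itself. Hence the conjuncts such as
  \<open>c \<noteq> x\<close> that accompany \<open>(y, x) \<in> reach G {c}\<close> below.\<close>

lemma reach_refl [simp]: "(u, u) \<in> reach G W"
  by (simp add: reach_def)

lemma reach_trans: "(u, v) \<in> reach G W \<Longrightarrow> (v, w) \<in> reach G W \<Longrightarrow> (u, w) \<in> reach G W"
  by (auto simp: reach_def)

lemma reach_sym: "(u, v) \<in> reach G W \<Longrightarrow> (v, u) \<in> reach G W"
proof -
  have "sym (adj (remove_verts G W))"
    by (auto simp: sym_def adj_remove_verts insert_commute)
  then show "(u, v) \<in> reach G W \<Longrightarrow> (v, u) \<in> reach G W"
    unfolding reach_def by (meson sym_rtrancl symE)
qed

lemma reach_edge: "{u, v} \<in> edges G \<Longrightarrow> u \<notin> W \<Longrightarrow> v \<notin> W \<Longrightarrow> (u, v) \<in> reach G W"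
  by (auto simp: reach_def adj_remove_verts)

lemma reach_mono:
  assumes "(u, v) \<in> reach G W" "edges G \<subseteq> edges H" "W' \<subseteq> W"
  shows "(u, v) \<in> reach H W'"
proof -
  have "adj (remove_verts G W) \<subseteq> adj (remove_verts H W')"
    using assms(2,3) by (auto simp: adj_remove_verts)
  then show ?thesis
    using assms(1) rtrancl_mono unfolding reach_def by blast
qed

lemma reach_empty: "reach G {} = (adj G)\<^sup>*"
  by (simp add: reach_def remove_verts_def adj_def)

text \<open>Induction from the far end: a new first vertex either lies in \<open>Q\<close> (stop at
  once), or is already on the path (drop what precedes it), or can be prepended.\<close>

lemma simple_walk_to:
  assumes "(u, q) \<in> r\<^sup>*" "q \<in> Q"
  shows "\<exists>xs. xs \<noteq> [] \<and> distinct xs \<and> successively (\<lambda>a b. (a, b) \<in> r) xs \<and> hd xs = u \<and>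
    last xs \<in> Q \<and> set (butlast xs) \<inter> Q = {}"
  using assms
proof (induction rule: converse_rtrancl_induct)
  case base
  then show ?case
    by (intro exI[of _ "[q]"]) auto
next
  case (step u v)
  then obtain xs where xs: "xs \<noteq> []" "distinct xs" "successively (\<lambda>a b. (a, b) \<in> r) xs" "hd xs = v"
    "last xs \<in> Q" "set (butlast xs) \<inter> Q = {}"
    by auto
  consider "u \<in> Q" | "u \<notin> Q" "u \<in> set xs" | "u \<notin> Q" "u \<notin> set xs"
    by blast
  then show ?case
  proof cases
    case 1
    then show ?thesis
      by (intro exI[of _ "[u]"]) auto
  next
    case 2
    then obtain ys zs where "xs = ys @ u # zs"
      by (auto simp: in_set_conv_decomp)
    then show ?thesis
      using xs 2 by (intro exI[of _ "u # zs"])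
        (auto simp: successively_append_iff butlast_append split: if_splits)
  next
    case 3
    then show ?thesis
      using xs step by (intro exI[of _ "u # xs"]) (auto simp: successively_Cons)
  qed
qed

lemma reach_spath_to:
  assumes "(u, q) \<in> reach G W" "q \<in> Q"
  shows "\<exists>xs. spath G xs \<and> hd xs = u \<and> last xs \<in> Q \<and> set (butlast xs) \<inter> Q = {} \<and> (u \<notin> W \<longrightarrow> set xs \<inter> W = {})"
proof -
  obtain xs where xs: "xs \<noteq> []" "distinct xs" "successively (\<lambda>a b. (a, b) \<in> adj (remove_verts G W)) xs"
    "hd xs = u" "last xs \<in> Q" "set (butlast xs) \<inter> Q = {}"
    using simple_walk_to[OF assms(1)[unfolded reach_def] assms(2)] by blast
  have "successively (\<lambda>a b. {a, b} \<in> edges G) xs"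
    by (rule successively_mono[OF xs(3)]) (simp add: adj_remove_verts)
  moreover have "set ys \<inter> W = {}"
    if "hd ys \<notin> W" "successively (\<lambda>a b. (a, b) \<in> adj (remove_verts G W)) ys" for ys
    using that by (induction ys rule: induct_list012) (auto simp: adj_remove_verts)
  ultimately show ?thesis
    using xs unfolding spath_def by blast
qed

lemma reach_spath:
  assumes "(u, v) \<in> reach G W"
  obtains xs where "spath G xs" "hd xs = u" "last xs = v" "u \<notin> W \<Longrightarrow> set xs \<inter> W = {}"
  using reach_spath_to[OF assms, of "{v}"] by auto

lemma walk_reach:
  assumes "successively (\<lambda>a b. {a, b} \<in> edges G) xs" "xs \<noteq> []" "set xs \<inter> W = {}"
  shows "(hd xs, last xs) \<in> reach G W"
  using assms
proof (induction xs rule: induct_list012)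
  case (3 x y zs)
  then show ?case
    using reach_edge[of x y G W] reach_trans[of x y G W] by auto
qed auto

lemma simple_graph_edge_verts: "simple_graph G \<Longrightarrow> {u, v} \<in> edges G \<Longrightarrow> u \<in> verts G \<and> v \<in> verts G \<and> u \<noteq> v"
  by (fastforce simp: simple_graph_def)

lemma spath_verts:
  assumes "simple_graph G" "spath G P" "hd P \<in> verts G"
  shows "set P \<subseteq> verts G"
proof -
  have "successively (\<lambda>a b. {a, b} \<in> edges G) P \<Longrightarrow> hd P \<in> verts G \<Longrightarrow> P \<noteq> [] \<Longrightarrow> set P \<subseteq> verts G"
    by (induction P rule: induct_list012) (auto dest: simple_graph_edge_verts[OF assms(1)])
  then show ?thesis
    using assms by (auto simp: spath_def)
qed

lemma spath_rev: "spath G xs \<Longrightarrow> spath G (rev xs)"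
  by (auto simp: spath_def successively_rev insert_commute)

text \<open>The middle is the second argument. If \<open>c\<close> is one of the ends,
  \<open>y\<close> has to reach the other end without it.\<close>

definition nsep :: "'a graph \<Rightarrow> 'a \<Rightarrow> 'a \<Rightarrow> 'a \<Rightarrow> bool" where
  "nsep G x y z \<longleftrightarrow>
     (\<forall>c. c \<noteq> y \<longrightarrow> c \<noteq> x \<and> (y, x) \<in> reach G {c} \<or> c \<noteq> z \<and> (y, z) \<in> reach G {c})"

lemma nsepD: "nsep G x y z \<Longrightarrow> c \<noteq> y \<Longrightarrow> (y, x) \<in> reach G {c} \<or> (y, z) \<in> reach G {c}"
  by (auto simp: nsep_def)

lemma nsep_commute: "nsep G x y z \<longleftrightarrow> nsep G z y x"
  by (auto simp: nsep_def)

text \<open>The stretch of the path from \<open>a\<close> to the end of \<open>R\<close> is replaced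
  by the edge to \<open>w\<close> followed by \<open>R\<close>. Since \<open>R\<close> returns
  behind \<open>a\<close>, both ends of the path survive.\<close>

lemma spath_detour_right:
  assumes P: "spath G (P1 @ a # P2)" and w: "{a, w} \<in> edges G"
    and R: "spath G R" "hd R = w" "last R \<in> set P2" "set (butlast R) \<inter> set (P1 @ a # P2) = {}" "a \<notin> set R"
  shows "\<exists>P'. spath G P' \<and> hd P' = hd (P1 @ a # P2) \<and> last P' = last (P1 @ a # P2) \<and> w \<in> set P'"
proof -
  obtain P3 P4 where P2: "P2 = P3 @ last R # P4"
    using R(3) by (meson split_list)
  define R' where "R' = butlast R"
  have R': "R = R' @ [last R]"
    using R(1) by (simp add: R'_def spath_def)
  obtain q where q: "last R = q" by simp
  have "spath G (P1 @ a # R' @ q # P4)"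
  proof -
    have "hd (R' @ [q]) = w"
      using R(2) R' q by simp
    then have "hd (R' @ q # P4) = w"
      by (cases R') auto
    then show ?thesis
      using P R w R' q unfolding P2 spath_def R'_def[symmetric]
      by (auto simp: successively_append_iff successively_Cons)
  qed
  moreover have "w \<in> set R"
    using R(1,2) by (auto simp: spath_def)
  then have "w \<in> set (P1 @ a # R' @ q # P4)"
    using R' q by (metis Un_iff set_append set_ConsD list.set_intros(1) set_subset_Cons empty_iff empty_set in_set_conv_decomp append_Cons)
  ultimately show ?thesis
    unfolding P2 q by (intro exI[of _ "P1 @ a # R' @ q # P4"]) (auto simp: hd_append)
qed

text \<open>A path from \<open>w\<close> that avoids \<open>a\<close> first hits \<open>P\<close> on
  one side of \<open>a\<close>; reversing \<open>P\<close> makes this the right side.\<close>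

lemma spath_detour:
  assumes P: "spath G P" and a: "a \<in> set P" and w: "{a, w} \<in> edges G" "w \<noteq> a"
    and q: "(w, q) \<in> reach G {a}" "q \<in> set P"
  shows "\<exists>P'. spath G P' \<and> hd P' = hd P \<and> last P' = last P \<and> w \<in> set P'"
proof (cases "w \<in> set P")
  case False
  obtain R where R: "spath G R" "hd R = w" "last R \<in> set P" "set (butlast R) \<inter> set P = {}" "a \<notin> set R"
    using reach_spath_to[OF q] w by auto
  obtain P1 P2 where P12: "P = P1 @ a # P2"
    using a by (meson split_list)
  have "last R \<noteq> a"
    using R by (metis last_in_set spath_def)
  then consider "last R \<in> set P2" | "last R \<in> set P1"
    using R(3) P12 by auto
  then show ?thesis
  proof cases
    case 1
    then show ?thesis
      using spath_detour_right[of G P1 a P2 w R] P w R P12 by auto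
  next
    case 2
    have *: "rev P = rev P2 @ a # rev P1"
      using P12 by simp
    then have "\<exists>P'. spath G P' \<and> hd P' = hd (rev P) \<and> last P' = last (rev P) \<and> w \<in> set P'"
      using spath_detour_right[of G "rev P2" a "rev P1" w R] spath_rev[OF P] w R 2
      by (metis set_rev)
    then obtain P' where "spath G P'" "hd P' = last P" "last P' = hd P" "w \<in> set P'"
      using P by (auto simp: hd_rev last_rev spath_def)
    then show ?thesis
      by (intro exI[of _ "rev P'"]) (auto simp: hd_rev last_rev spath_rev)
  qed
qed (use P in blast)

text \<open>Walk along a path from \<open>y\<close> to some path between \<open>x\<close> and \<open>z\<close>, and pull the latter
  back to \<open>y\<close> one vertex at a time: a vertex \<open>w\<close> whose successor \<open>a\<close> has been reached can be
  included, because \<open>w\<close> is not separated from \<open>{x, z}\<close> by \<open>a\<close>.\<close>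

lemma nsep_imp_spath:
  assumes ns: "nsep G x y z" and "x \<noteq> y" "y \<noteq> z" "x \<noteq> z"
  shows "\<exists>P. spath G P \<and> {x, y, z} \<subseteq> set P"
proof -
  \<comment> \<open>Deleting one end leaves only the other end for \<open>y\<close> to
    reach.\<close>
  have 1: "(y, z) \<in> reach G {x}" "(y, x) \<in> reach G {z}"
    using ns assms(2-4) unfolding nsep_def by metis+
  have yz: "(x, z) \<in> reach G {}" "(y, z) \<in> reach G {}"
    using 1 reach_mono[of _ _ G "{x}" G "{}"] reach_mono[of _ _ G "{z}" G "{}"]
    by (meson reach_trans reach_sym order.refl empty_subsetI)+
  obtain P0 where P0: "spath G P0" "hd P0 = x" "last P0 = z"
    using reach_spath[OF yz(1)] by metis
  obtain Y where Y: "spath G Y" "hd Y = y" "last Y = z"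
    using reach_spath[OF yz(2)] by metis
  let ?good = "\<lambda>w. \<exists>P. spath G P \<and> hd P = x \<and> last P = z \<and> w \<in> set P"
  \<comment> \<open>Induction over the suffixes of \<open>Y\<close>, that is, from its end
    \<open>z\<close> back to \<open>y\<close>.\<close>
  have "?good (hd ws)" if "\<exists>us. Y = us @ ws" "ws \<noteq> []" for ws
    using that
  proof (induction ws)
    case (Cons w ws)
    then obtain us where us: "Y = us @ w # ws" by blast
    show ?case
    proof (cases ws)
      case Nil
      then show ?thesis
        using P0 Y us by (metis last_in_set last_snoc list.sel(1) spath_def)
    next
      case (Cons a ws')
      have "?good a"
        using Cons.IH us Cons by (metis append.assoc append_Cons append_Nil list.distinct(1) list.sel(1))
      then obtain P where P: "spath G P" "hd P = x" "last P = z" "a \<in> set P" by blast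
      have Yd: "distinct Y" "successively (\<lambda>a b. {a, b} \<in> edges G) Y"
        using Y by (auto simp: spath_def)
      have wa: "{w, a} \<in> edges G" "w \<noteq> a" "a \<notin> set (us @ [w])"
        using Yd unfolding us Cons by (auto simp: successively_append_iff)
      have "successively (\<lambda>a b. {a, b} \<in> edges G) (us @ [w])"
        using Yd unfolding us by (auto simp: successively_append_iff)
      then have "(hd (us @ [w]), w) \<in> reach G {a}"
        using walk_reach[of G "us @ [w]" "{a}"] wa by auto
      moreover have "hd (us @ [w]) = y"
        using Y(2) us by (cases us) auto
      \<comment> \<open>The part of \<open>Y\<close> up to \<open>w\<close> avoids \<open>a\<close>,
        so the end that \<open>y\<close> reaches without \<open>a\<close> is also reached by
        \<open>w\<close>.\<close>
      ultimately have "(w, y) \<in> reach G {a}"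
        using reach_sym by metis
      moreover have "a \<noteq> y"
        using wa \<open>hd (us @ [w]) = y\<close> by (metis hd_in_set snoc_eq_iff_butlast)
      ultimately obtain q where "q \<in> {x, z}" "(w, q) \<in> reach G {a}"
        using ns unfolding nsep_def by (metis insertI1 insertI2 reach_trans)
      moreover have "{x, z} \<subseteq> set P"
        using P by (auto simp: spath_def)
      ultimately show ?thesis
        using spath_detour[OF P(1,4), of w q] wa P by (auto simp: insert_commute)
    qed
  qed simp
  from this[of Y] Y obtain P where "spath G P" "hd P = x" "last P = z" "y \<in> set P"
    by (auto simp: spath_def)
  then show ?thesis
    by (intro exI[of _ P]) (auto simp: spath_def)
qed

section \<open>Inseparable sets and blocks\<close>

text \<open>Connections may run through all of \<open>G\<close>, not only through \<open>S\<close>.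
  The sets \<open>W\<close> in question are the empty set and the singletons.\<close>

definition insep :: "'a graph \<Rightarrow> 'a set \<Rightarrow> bool" where
  "insep G S \<longleftrightarrow> S \<subseteq> verts G \<and>
     (\<forall>W. finite W \<and> card W < 2 \<longrightarrow> (\<forall>u\<in>S - W. \<forall>v\<in>S - W. (u, v) \<in> reach G W))"

definition max_insep :: "'a graph \<Rightarrow> 'a set \<Rightarrow> bool" where
  "max_insep G S \<longleftrightarrow> insep G S \<and> (\<forall>T. insep G T \<and> S \<subseteq> T \<longrightarrow> T = S)"

definition induced :: "'a graph \<Rightarrow> 'a set \<Rightarrow> 'a graph" where
  "induced G S = Graph S {e \<in> edges G. e \<subseteq> S}"

lemma card_less_2_iff: "finite W \<and> card W < 2 \<longleftrightarrow> W = {} \<or> (\<exists>c. W = {c})"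
  by (auto simp: less_2_cases_iff card_1_singleton_iff)

lemma insepD: "insep G S \<Longrightarrow> u \<in> S \<Longrightarrow> v \<in> S \<Longrightarrow> u \<noteq> c \<Longrightarrow> v \<noteq> c \<Longrightarrow> (u, v) \<in> reach G {c}"
  unfolding insep_def by (auto simp: card_less_2_iff)

lemma insepD_empty: "insep G S \<Longrightarrow> u \<in> S \<Longrightarrow> v \<in> S \<Longrightarrow> (u, v) \<in> reach G {}"
  unfolding insep_def by (auto simp: card_less_2_iff)

lemma insepI:
  assumes "S \<subseteq> verts G"
    and "\<And>u v. u \<in> S \<Longrightarrow> v \<in> S \<Longrightarrow> (u, v) \<in> reach G {}"
    and "\<And>c u v. u \<in> S \<Longrightarrow> v \<in> S \<Longrightarrow> u \<noteq> c \<Longrightarrow> v \<noteq> c \<Longrightarrow> (u, v) \<in> reach G {c}"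
  shows "insep G S"
  using assms unfolding insep_def card_less_2_iff by blast

lemma insep_singleton: "v \<in> verts G \<Longrightarrow> insep G {v}"
  by (rule insepI) auto

lemma insep_edge:
  assumes "simple_graph G" "{u, v} \<in> edges G"
  shows "insep G {u, v}"
  using assms by (intro insepI) (auto simp: simple_graph_def insert_commute intro: reach_edge)

text \<open>After each deletion one surviving connection between the two sets suffices, because each
  set stays connected on its own.\<close>

lemma insep_Un:
  assumes S: "insep G S" and T: "insep G T"
    and 0: "\<exists>a\<in>S. \<exists>b\<in>T. (a, b) \<in> reach G {}"
    and 1: "\<And>c. \<exists>a\<in>S - {c}. \<exists>b\<in>T - {c}. (a, b) \<in> reach G {c}"
  shows "insep G (S \<union> T)"
proof (rule insepI)
  show "S \<union> T \<subseteq> verts G"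
    using S T by (auto simp: insep_def)
  show "(u, v) \<in> reach G {}" if uv: "u \<in> S \<union> T" "v \<in> S \<union> T" for u v
  proof -
    obtain a b where "a \<in> S" "b \<in> T" and ab: "(a, b) \<in> reach G {}"
      using 0 by blast
    then have *: "(w, a) \<in> reach G {}" if "w \<in> S \<union> T" for w
      using that insepD_empty[OF S, of w a] insepD_empty[OF T, of w b] reach_sym[OF ab]
      by (auto intro: reach_trans)
    from *[OF uv(1)] reach_sym[OF *[OF uv(2)]] show ?thesis
      by (rule reach_trans)
  qed
  show "(u, v) \<in> reach G {c}" if uv: "u \<in> S \<union> T" "v \<in> S \<union> T" "u \<noteq> c" "v \<noteq> c" for c u v
  proof -
    obtain a b where "a \<in> S" "b \<in> T" "a \<noteq> c" "b \<noteq> c" and ab: "(a, b) \<in> reach G {c}"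
      using 1 by blast
    then have *: "(w, a) \<in> reach G {c}" if "w \<in> S \<union> T" "w \<noteq> c" for w
      using that insepD[OF S, of w a c] insepD[OF T, of w b c] reach_sym[OF ab]
      by (auto intro: reach_trans)
    from *[OF uv(1,3)] reach_sym[OF *[OF uv(2,4)]] show ?thesis
      by (rule reach_trans)
  qed
qed

section \<open>Maximal inseparable sets\<close>

lemma max_insep_insep: "max_insep G S \<Longrightarrow> insep G S"
  by (simp add: max_insep_def)

lemma max_insep_not_subset:
  "max_insep G S \<Longrightarrow> max_insep G T \<Longrightarrow> S \<noteq> T \<Longrightarrow> \<not> S \<subseteq> T"
  unfolding max_insep_def by metis

lemma max_insep_Un:
  assumes "max_insep G S" "max_insep G T" "insep G (S \<union> T)"
  shows "S = T"
  using assms unfolding max_insep_def by (metis Un_upper1 Un_upper2)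

text \<open>A connection avoiding \<open>c\<close> would make \<open>S \<union> T\<close>
  inseparable: it survives the deletion of \<open>c\<close>, and \<open>c\<close> itself links the
  sets after any other deletion. This contradicts maximality.\<close>

lemma max_insep_separated:
  assumes S: "max_insep G S" and T: "max_insep G T" and ne: "S \<noteq> T"
    and c: "c \<in> S" "c \<in> T" and u: "u \<in> S - {c}" and v: "v \<in> T - {c}"
  shows "(u, v) \<notin> reach G {c}"
proof
  assume uv: "(u, v) \<in> reach G {c}"
  have "insep G (S \<union> T)"
  proof (rule insep_Un)
    show "\<exists>a\<in>S. \<exists>b\<in>T. (a, b) \<in> reach G {}"
      using c by (intro bexI[of _ c]) auto
    show "\<exists>a\<in>S - {d}. \<exists>b\<in>T - {d}. (a, b) \<in> reach G {d}" for d
    proof (cases "d = c")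
      case True
      then show ?thesis
        using u v uv by blast
    next
      case False
      then show ?thesis
        using c by (intro bexI[of _ c]) auto
    qed
  qed (use S T in \<open>auto dest: max_insep_insep\<close>)
  then show False
    using max_insep_Un[OF S T] ne by blast
qed

lemma max_insep_Int:
  assumes "max_insep G S" "max_insep G T" "S \<noteq> T" "c \<in> S" "c \<in> T" "d \<in> S" "d \<in> T"
  shows "c = d"
  using max_insep_separated[OF assms(1-5), of d d] assms(6,7) by auto

text \<open>Zorn's lemma applies because inseparability concerns two elements at a time, and two
  elements of the union of a chain lie in a common member.\<close>

lemma ex_max_insep:
  assumes "insep G S"
  shows "\<exists>T. max_insep G T \<and> S \<subseteq> T"
proof -
  let ?A = "{T. insep G T \<and> S \<subseteq> T}"
  have "\<exists>M\<in>?A. \<forall>X\<in>?A. M \<subseteq> X \<longrightarrow> X = M"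
  proof (rule subset_Zorn_nonempty)
    show "?A \<noteq> {}"
      using assms by blast
    fix C assume C: "C \<noteq> {}" "subset.chain ?A C"
    have *: "\<exists>T\<in>C. u \<in> T \<and> v \<in> T" if uv: "u \<in> \<Union>C" "v \<in> \<Union>C" for u v
    proof -
      obtain T U where TU: "T \<in> C" "u \<in> T" "U \<in> C" "v \<in> U"
        using uv by blast
      then have "T \<subseteq> U \<or> U \<subseteq> T"
        using C(2) by (auto simp: subset_chain_def)
      then show ?thesis
        using TU by blast
    qed
    have sub: "insep G T" "S \<subseteq> T" if "T \<in> C" for T
      using that C(2) by (auto simp: subset_chain_def)
    have "insep G (\<Union>C)"
    proof (rule insepI)
      show "\<Union>C \<subseteq> verts G"
        using sub(1) by (auto simp: insep_def)
    next
      fix u v assume "u \<in> \<Union>C" "v \<in> \<Union>C"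
      then show "(u, v) \<in> reach G {}"
        using *[of u v] sub(1) by (auto intro: insepD_empty)
    next
      fix c u v assume "u \<in> \<Union>C" "v \<in> \<Union>C" "u \<noteq> c" "v \<noteq> c"
      then show "(u, v) \<in> reach G {c}"
        using *[of u v] sub(1) by (auto intro: insepD)
    qed
    moreover have "S \<subseteq> \<Union>C"
      using C(1) sub(2) by blast
    ultimately show "\<Union>C \<in> ?A"
      by simp
  qed
  then obtain M where M: "insep G M" "S \<subseteq> M" "\<And>X. insep G X \<Longrightarrow> S \<subseteq> X \<Longrightarrow> M \<subseteq> X \<Longrightarrow> X = M"
    by auto
  then have "max_insep G M"
    unfolding max_insep_def by (meson order_trans)
  then show ?thesis
    using M(2) by blast
qed

text \<open>A path visits a deleted vertex \<open>c\<close> at most once, so from a vertex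
  \<open>w\<close> of the path one of the two directions still leads to an end in \<open>S\<close>
  without meeting \<open>c\<close>. Thus \<open>insert w S\<close> is inseparable, and
  \<open>w\<close> lies in \<open>S\<close> by maximality.\<close>

lemma max_insep_spath:
  assumes S: "max_insep G S" and P: "spath G P" "hd P \<in> S" "last P \<in> S" "set P \<subseteq> verts G"
  shows "set P \<subseteq> S"
proof
  fix w assume "w \<in> set P"
  then obtain P1 P2 where P12: "P = P1 @ w # P2"
    by (meson split_list)
  have P': "distinct P" "successively (\<lambda>a b. {a, b} \<in> edges G) P"
    using P by (auto simp: spath_def)
  have l: "(w, hd P) \<in> reach G W" if "set (P1 @ [w]) \<inter> W = {}" for W
  proof -
    have "successively (\<lambda>a b. {a, b} \<in> edges G) (P1 @ [w])"
      using P'(2) P12 by (auto simp: successively_append_iff)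
    from walk_reach[OF this _ that] have "(hd (P1 @ [w]), w) \<in> reach G W"
      by simp
    moreover have "hd (P1 @ [w]) = hd P"
      using P12 by (cases P1) auto
    ultimately show ?thesis
      by (simp add: reach_sym)
  qed
  have r: "(w, last P) \<in> reach G W" if "set (w # P2) \<inter> W = {}" for W
  proof -
    have "successively (\<lambda>a b. {a, b} \<in> edges G) (w # P2)"
      using P'(2) P12 by (auto simp: successively_append_iff)
    from walk_reach[OF this _ that] show ?thesis
      using P12 by simp
  qed
  have ins: "insep G S"
    using S by (rule max_insep_insep)
  have 0: "(w, u) \<in> reach G {}" if "u \<in> S" for u
    using l[of "{}"] insepD_empty[OF ins P(2) that] by (auto intro: reach_trans)
  have 1: "(w, u) \<in> reach G {c}" if "u \<in> S" "u \<noteq> c" "w \<noteq> c" for u c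
  proof (cases "c \<in> set P1")
    case False
    then have "(w, hd P) \<in> reach G {c}" "hd P \<noteq> c"
      using l[of "{c}"] that P12 by (auto simp: hd_append)
    then show ?thesis
      using insepD[OF ins P(2) that(1)] that by (auto intro: reach_trans)
  next
    case True
    then have "c \<notin> set (w # P2)"
      using that P12 P'(1) by auto
    moreover have "last P \<in> set (w # P2)"
      using P12 by simp
    ultimately have "(w, last P) \<in> reach G {c}" "last P \<noteq> c"
      using r[of "{c}"] by auto
    then show ?thesis
      using insepD[OF ins P(3) that(1)] that by (auto intro: reach_trans)
  qed
  have "insep G (insert w S)"
  proof (rule insepI)
    show "insert w S \<subseteq> verts G"
      using ins P(4) \<open>w \<in> set P\<close> by (auto simp: insep_def)
  next
    fix u v assume "u \<in> insert w S" "v \<in> insert w S"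
    then show "(u, v) \<in> reach G {}"
      using 0[of u] 0[of v] insepD_empty[OF ins, of u v] reach_sym[of w u G "{}"] by auto
  next
    fix c u v assume "u \<in> insert w S" "v \<in> insert w S" "u \<noteq> c" "v \<noteq> c"
    then show "(u, v) \<in> reach G {c}"
      using 1[of u c] 1[of v c] insepD[OF ins, of u v c] reach_sym[of w u G "{c}"] by auto
  qed
  then show "w \<in> S"
    using S unfolding max_insep_def by blast
qed

section \<open>Blocks as the graphs induced by maximal inseparable sets\<close>

lemma verts_remove_verts [simp]: "verts (remove_verts G W) = verts G - W"
  by (simp add: remove_verts_def)

lemma k_connected_2_imp_insep:
  assumes "subgraph B G" "k_connected 2 B"
  shows "insep G (verts B)"
proof -
  have "(u, v) \<in> reach G W" if "finite W" "card W < 2" "u \<in> verts B - W" "v \<in> verts B - W" for W u v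
  proof -
    \<comment> \<open>\<open>k_connected\<close> speaks of subsets of \<open>verts B\<close> only,
      so \<open>W\<close> is cut down to \<open>B\<close>; edges of \<open>B\<close> cannot meet the
      rest of \<open>W\<close>.\<close>
    have "card (W \<inter> verts B) < 2"
      using that by (meson Int_lower1 card_mono le_less_trans)
    then have "graph_connected (remove_verts B (W \<inter> verts B))"
      using assms(2) that unfolding k_connected_def by auto
    then have "(u, v) \<in> reach B (W \<inter> verts B)"
      using that by (auto simp: graph_connected_def reach_def)
    moreover have "adj (remove_verts B (W \<inter> verts B)) \<subseteq> adj (remove_verts G W)"
      using assms(1) by (fastforce simp: adj_remove_verts subgraph_def simple_graph_def)
    ultimately show ?thesis
      unfolding reach_def using rtrancl_mono by blast
  qed
  then show ?thesis
    using assms(1) by (auto simp: insep_def subgraph_def)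
qed

lemma verts_induced [simp]: "verts (induced G S) = S"
  by (simp add: induced_def)

lemma edges_induced: "e \<in> edges (induced G S) \<longleftrightarrow> e \<in> edges G \<and> e \<subseteq> S"
  by (simp add: induced_def)

lemma subgraph_induced: "simple_graph G \<Longrightarrow> S \<subseteq> verts G \<Longrightarrow> subgraph (induced G S) G"
  by (auto simp: subgraph_def simple_graph_def induced_def)

text \<open>A path of \<open>G - W\<close> between two vertices of a maximal inseparable set stays in the set.\<close>

lemma max_insep_k_connected:
  assumes G: "simple_graph G" and S: "max_insep G S"
  shows "k_connected 2 (induced G S)"
  unfolding k_connected_def graph_connected_def
proof (intro allI impI ballI)
  fix W u v
  assume W: "W \<subseteq> verts (induced G S) \<and> finite W \<and> card W < 2"
    and u: "u \<in> verts (remove_verts (induced G S) W)" and v: "v \<in> verts (remove_verts (induced G S) W)"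
  then have "(u, v) \<in> reach G W"
    using max_insep_insep[OF S] by (auto simp: insep_def)
  then obtain P where P: "spath G P" "hd P = u" "last P = v" "set P \<inter> W = {}"
    using u by (auto elim: reach_spath)
  have SV: "S \<subseteq> verts G"
    using max_insep_insep[OF S] by (simp add: insep_def)
  have sub: "set P \<subseteq> S"
    using u v P SV by (intro max_insep_spath[OF S P(1)] spath_verts[OF G P(1)]) auto
  have "successively (\<lambda>a b. {a, b} \<in> edges (induced G S)) P"
    using P(1) sub unfolding spath_def edges_induced
    by (induction P rule: induct_list012) auto
  then have "(hd P, last P) \<in> reach (induced G S) W"
    using P by (intro walk_reach) (auto simp: spath_def)
  then show "(u, v) \<in> (adj (remove_verts (induced G S) W))\<^sup>*"
    using P by (simp add: reach_def)
qed

text \<open>A block has an inseparable vertex set, hence lies in the 2-connected graph induced by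
  some maximal set, and equals it. Conversely, a 2-connected graph above \<open>induced G S\<close>
  has the same vertices by maximality of \<open>S\<close>, and an induced graph leaves no edge to
  add.\<close>

lemma blocks_eq:
  assumes G: "simple_graph G"
  shows "blocks G = induced G ` {S. max_insep G S}"
proof (intro equalityI subsetI)
  fix B assume B: "B \<in> blocks G"
  then have sB: "subgraph B G" and kB: "k_connected 2 B"
    and mB: "\<And>H. subgraph H G \<Longrightarrow> k_connected 2 H \<Longrightarrow> subgraph B H \<Longrightarrow> H = B"
    by (auto simp: blocks_def)
  obtain S where S: "max_insep G S" "verts B \<subseteq> S"
    using ex_max_insep k_connected_2_imp_insep[OF sB kB] by blast
  have "S \<subseteq> verts G"
    using max_insep_insep[OF S(1)] by (simp add: insep_def)
  moreover have "subgraph B (induced G S)"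
    using sB S(2) unfolding subgraph_def simple_graph_def verts_induced subset_iff[of "edges B"] edges_induced
    by blast
  ultimately have "induced G S = B"
    using mB[of "induced G S"] subgraph_induced[OF G] max_insep_k_connected[OF G S(1)] by blast
  then show "B \<in> induced G ` {S. max_insep G S}"
    using S(1) by blast
next
  fix B assume "B \<in> induced G ` {S. max_insep G S}"
  then obtain S where S: "max_insep G S" and B: "B = induced G S"
    by blast
  have SV: "S \<subseteq> verts G"
    using max_insep_insep[OF S(1)] by (simp add: insep_def)
  show "B \<in> blocks G"
    unfolding blocks_def
  proof (intro CollectI conjI allI impI)
    fix H assume H: "subgraph H G \<and> k_connected 2 H \<and> subgraph B H"
    then have "insep G (verts H)"
      using k_connected_2_imp_insep[of H G] by blast
    moreover have "S \<subseteq> verts H"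
      using H B by (simp add: subgraph_def)
    ultimately have "verts H = S"
      using S unfolding max_insep_def by blast
    have "edges H \<subseteq> edges B"
    proof
      fix e assume "e \<in> edges H"
      then have "e \<in> edges G" "e \<subseteq> S"
        using H \<open>verts H = S\<close> by (auto simp: subgraph_def simple_graph_def)
      then show "e \<in> edges B"
        by (simp add: B edges_induced)
    qed
    moreover have "edges B \<subseteq> edges H"
      using H by (simp add: subgraph_def)
    ultimately have "edges H = edges B"
      by blast
    with \<open>verts H = S\<close> show "H = B"
      by (cases H) (simp add: B induced_def)
  qed (simp_all add: B subgraph_induced[OF G SV] max_insep_k_connected[OF G S])
qed

lemma inj_induced: "induced G S = induced G T \<Longrightarrow> S = T"
  by (simp add: induced_def)

text \<open>Neither set contains the other, so each has a vertex besides \<open>c\<close>; these are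
  joined through \<open>c\<close> and separated by \<open>c\<close>.\<close>

lemma max_insep_shared_imp_cut_vertex:
  assumes S: "max_insep G S" and T: "max_insep G T" and ne: "S \<noteq> T" and c: "c \<in> S" "c \<in> T"
  shows "c \<in> cut_vertices G"
proof -
  obtain u v where u: "u \<in> S - {c}" and v: "v \<in> T - {c}"
    using max_insep_not_subset[OF S T ne] max_insep_not_subset[OF T S] ne c by blast
  have "(u, v) \<in> reach G {}"
    using u v c insepD_empty[OF max_insep_insep[OF S], of u c] insepD_empty[OF max_insep_insep[OF T], of c v]
    by (auto intro: reach_trans)
  then have "(u, v) \<in> (adj G)\<^sup>*"
    by (simp add: reach_empty)
  moreover have "(u, v) \<notin> (adj (remove_verts G {c}))\<^sup>*"
    using max_insep_separated[OF S T ne c u v] by (simp add: reach_def)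
  moreover have "S \<subseteq> verts G" "T \<subseteq> verts G"
    using S T by (auto simp: max_insep_def insep_def)
  ultimately show ?thesis
    using u v c unfolding cut_vertices_def mem_Collect_eq
    by (intro conjI bexI[of _ u] bexI[of _ v]) auto
qed

lemma ex_max_insep_vertex:
  assumes "v \<in> verts G"
  shows "\<exists>S. max_insep G S \<and> v \<in> S"
  using ex_max_insep[OF insep_singleton[OF assms]] by auto

lemma ex_max_insep_edge:
  assumes "simple_graph G" "{u, v} \<in> edges G"
  shows "\<exists>S. max_insep G S \<and> u \<in> S \<and> v \<in> S"
  using ex_max_insep[OF insep_edge[OF assms]] by auto

section \<open>Points and continuous functions of the 1-complex\<close>

definition pt :: "'a graph \<Rightarrow> ('a + 'a set) \<times> real \<Rightarrow> (('a + 'a set) \<times> real) set" where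
  "pt G p = glue_rel G `` {p}"

definition vpt :: "'a graph \<Rightarrow> 'a \<Rightarrow> (('a + 'a set) \<times> real) set" where
  "vpt G v = pt G (Inl v, 0)"

definition ept :: "'a graph \<Rightarrow> 'a set \<Rightarrow> real \<Rightarrow> (('a + 'a set) \<times> real) set" where
  "ept G e t = pt G (Inr e, t)"

lemma topspace_presum:
  "topspace (presum G) = (\<lambda>v. (Inl v, 0)) ` verts G \<union> (\<lambda>(e, t). (Inr e, t)) ` (edges G \<times> {0..1})"
  by (auto simp: presum_def image_iff)

lemma presum_points [simp]:
  "(Inl v, t) \<in> topspace (presum G) \<longleftrightarrow> v \<in> verts G \<and> t = 0"
  "(Inr e, t) \<in> topspace (presum G) \<longleftrightarrow> e \<in> edges G \<and> 0 \<le> t \<and> t \<le> 1"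
  by (auto simp: presum_def)

section \<open>The quotient map and the real functions that factor through it\<close>

lemma quotient_map_quotient_topology:
  assumes R: "equiv (topspace X) R"
  shows "quotient_map X (quotient_topology X R) (\<lambda>x. R `` {x})"
proof -
  have 1: "{x \<in> topspace X. R `` {x} \<in> U} = \<Union>U" if "U \<subseteq> topspace X // R" for U
  proof
    show "{x \<in> topspace X. R `` {x} \<in> U} \<subseteq> \<Union>U"
      using equiv_class_self[OF R] by blast
    show "\<Union>U \<subseteq> {x \<in> topspace X. R `` {x} \<in> U}"
    proof
      fix x assume "x \<in> \<Union>U"
      then obtain C where C: "C \<in> U" "x \<in> C" by blast
      then have "C \<in> topspace X // R"
        using that by blast
      then have "x \<in> topspace X" "C = R `` {x}"
        using C(2) R by (auto elim!: quotientE simp: equiv_class_eq_iff[OF R] dest: equiv_class_eq[OF R])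
      then show "x \<in> {x \<in> topspace X. R `` {x} \<in> U}"
        using C by auto
    qed
  qed
  show ?thesis
    unfolding quotient_map_def topspace_quotient_topology[OF R] openin_quotient_topology[OF R]
    using 1 by (auto simp: quotient_def)
qed

lemma quotient_map_pt: "quotient_map (presum G) (one_complex G) (pt G)"
  unfolding one_complex_def pt_def by (rule quotient_map_quotient_topology[OF equiv_glue_rel])

lemma continuous_map_from_sum_topology:
  assumes F: "\<And>i. i \<in> I \<Longrightarrow> continuous_map (X i) Y (\<lambda>t. F (i, t))"
  shows "continuous_map (sum_topology X I) Y F"
  unfolding continuous_map_def
proof (intro conjI allI impI)
  show "F \<in> topspace (sum_topology X I) \<rightarrow> topspace Y"
    using F by (fastforce simp: continuous_map_def)
  fix U assume U: "openin Y U"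
  have "{t. (i, t) \<in> {x \<in> topspace (sum_topology X I). F x \<in> U}} = {t \<in> topspace (X i). F (i, t) \<in> U}"
    if "i \<in> I" for i
    using that by auto
  moreover have "openin (X i) {t \<in> topspace (X i). F (i, t) \<in> U}" if "i \<in> I" for i
    using F[OF that] U by (auto simp: continuous_map_def)
  ultimately show "openin (sum_topology X I) {x \<in> topspace (sum_topology X I). F x \<in> U}"
    unfolding openin_sum_topology by auto
qed

lemma continuous_on_presum:
  fixes F :: "('a + 'a set) \<times> real \<Rightarrow> real"
  assumes "\<And>e. e \<in> edges G \<Longrightarrow> continuous_on {0..1} (\<lambda>t. F (Inr e, t))"
  shows "continuous_map (presum G) euclideanreal F"
  unfolding presum_def
  by (rule continuous_map_from_sum_topology) (use assms in auto)

text \<open>Meaningful if \<open>F\<close> is constant on \<open>C\<close>, where the image is a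
  singleton.\<close>

definition lift :: "('b \<Rightarrow> real) \<Rightarrow> 'b set \<Rightarrow> real" where
  "lift F C = the_elem (F ` C)"

text \<open>The universal property of the quotient: the pairs in \<open>glue\<close> generate the
  equivalence, so agreement at the two ends of each edge is enough. All real functions on
  \<open>|G|\<close> below arise in this way.\<close>

lemma lift_one_complex:
  fixes F :: "('a + 'a set) \<times> real \<Rightarrow> real"
  assumes c: "\<And>e. e \<in> edges G \<Longrightarrow> continuous_on {0..1} (\<lambda>t. F (Inr e, t))"
    and 0: "\<And>e. e \<in> edges G \<Longrightarrow> F (Inr e, 0) = F (Inl (end0 e), 0)"
    and 1: "\<And>e. e \<in> edges G \<Longrightarrow> F (Inr e, 1) = F (Inl (end1 e), 0)"
  shows "continuous_map (one_complex G) euclideanreal (lift F)"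
    and "v \<in> verts G \<Longrightarrow> lift F (vpt G v) = F (Inl v, 0)"
    and "e \<in> edges G \<Longrightarrow> 0 \<le> t \<Longrightarrow> t \<le> 1 \<Longrightarrow> lift F (ept G e t) = F (Inr e, t)"
proof -
  have F_eq: "F p = F q" if "equivclp (glue G) p q" for p q
    using that
  proof (induction rule: equivclp_induct)
    case (step y z)
    then show ?case
      using 0 1 by (auto simp: glue_def)
  qed simp
  have f: "lift F (pt G p) = F p" if "p \<in> topspace (presum G)" for p
  proof -
    have "p \<in> pt G p"
      using that by (simp add: pt_def glue_rel_def)
    moreover have "F q = F p" if "q \<in> pt G p" for q
      using F_eq[of p q] that by (simp add: pt_def glue_rel_def)
    ultimately have "F ` pt G p = {F p}"
      by blast
    then show ?thesis
      by (simp add: lift_def)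
  qed
  have "continuous_map (presum G) euclideanreal (lift F \<circ> pt G)"
    using continuous_map_eq[OF continuous_on_presum[OF c]] f by fastforce
  then show "continuous_map (one_complex G) euclideanreal (lift F)"
    using continuous_compose_quotient_map[OF quotient_map_pt] by blast
  show "lift F (vpt G v) = F (Inl v, 0)" if "v \<in> verts G"
    using f[of "(Inl v, 0)"] that by (simp add: vpt_def)
  show "lift F (ept G e t) = F (Inr e, t)" if "e \<in> edges G" "0 \<le> t" "t \<le> 1"
    using f[of "(Inr e, t)"] that by (simp add: ept_def)
qed

lemma topspace_one_complex:
  "topspace (one_complex G) = vpt G ` verts G \<union> (\<Union>e\<in>edges G. ept G e ` {0..1})"
proof -
  have "topspace (one_complex G) = pt G ` topspace (presum G)"
    using quotient_map_pt[of G] by (auto simp: quotient_map_def)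
  also have "\<dots> = vpt G ` verts G \<union> (\<Union>e\<in>edges G. ept G e ` {0..1})"
    unfolding topspace_presum vpt_def ept_def by force
  finally show ?thesis .
qed

lemma pt_eq:
  assumes "glue G p q" "p \<in> topspace (presum G)" "q \<in> topspace (presum G)"
  shows "pt G p = pt G q"
  unfolding pt_def
  by (rule equiv_class_eq[OF equiv_glue_rel]) (use assms in \<open>auto simp: glue_rel_def r_into_equivclp\<close>)

lemma end_verts:
  assumes "simple_graph G" "e \<in> edges G"
  shows "end0 e \<in> verts G" "end1 e \<in> verts G" "end0 e \<noteq> end1 e"
proof -
  have e: "e \<subseteq> verts G" "card e = 2"
    using assms by (auto simp: simple_graph_def)
  then show "end0 e \<in> verts G" "end1 e \<in> verts G" "end0 e \<noteq> end1 e"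
    using end0_end1[of e] by blast+
qed

lemma edge_eq_ends: "simple_graph G \<Longrightarrow> e \<in> edges G \<Longrightarrow> {end0 e, end1 e} = e"
  using end0_end1(1)[of e] by (simp add: simple_graph_def)

lemma ept_ends:
  assumes "simple_graph G" "e \<in> edges G"
  shows "ept G e 0 = vpt G (end0 e)" "ept G e 1 = vpt G (end1 e)"
  unfolding ept_def vpt_def using end_verts[OF assms] assms(2)
  by (intro pt_eq; auto simp: glue_def)+

lemma continuous_map_ept:
  fixes G :: "'a graph"
  assumes "e \<in> edges G"
  shows "continuous_map (top_of_set {0..1}) (one_complex G) (ept G e)"
proof -
  let ?X = "\<lambda>i :: 'a + 'a set. case i of Inl v \<Rightarrow> top_of_set {0} | Inr e \<Rightarrow> top_of_set {0..1::real}"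
  have "continuous_map (?X (Inr e)) (presum G) (\<lambda>t. (Inr e, t))"
    unfolding presum_def using assms
    by (intro continuous_map_component_injection[of "Inr e" "verts G <+> edges G" ?X]) auto
  then have "continuous_map (top_of_set {0..1}) (one_complex G) (pt G \<circ> (\<lambda>t. (Inr e, t)))"
    using quotient_imp_continuous_map[OF quotient_map_pt] by (auto intro: continuous_map_compose)
  then show ?thesis
    by (simp add: ept_def[abs_def] comp_def)
qed

text \<open>The extension of \<open>\<phi>\<close> from the vertices to \<open>|G|\<close> that is
  affine on every edge.\<close>

definition interp :: "('a \<Rightarrow> real) \<Rightarrow> (('a + 'a set) \<times> real) set \<Rightarrow> real" where
  "interp \<phi> = lift (\<lambda>(i, t). case i of Inl v \<Rightarrow> \<phi> v | Inr e \<Rightarrow> (1 - t) * \<phi> (end0 e) + t * \<phi> (end1 e))"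

lemma interp:
  shows continuous_interp: "continuous_map (one_complex G) euclideanreal (interp \<phi>)"
    and interp_vpt: "v \<in> verts G \<Longrightarrow> interp \<phi> (vpt G v) = \<phi> v"
    and interp_ept: "e \<in> edges G \<Longrightarrow> 0 \<le> t \<Longrightarrow> t \<le> 1 \<Longrightarrow>
      interp \<phi> (ept G e t) = (1 - t) * \<phi> (end0 e) + t * \<phi> (end1 e)"
  unfolding interp_def by (subst lift_one_complex; auto intro!: continuous_intros lift_one_complex(1))+

text \<open>Positive exactly inside the edge \<open>e\<close>: \<open>t * (1 - t)\<close> vanishes
  at both ends and so matches the value 0 at the vertices. It identifies the edge but confuses
  \<open>t\<close> with \<open>1 - t\<close>; \<open>interp\<close> settles that.\<close>

definition bump :: "'a set \<Rightarrow> (('a + 'a set) \<times> real) set \<Rightarrow> real" where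
  "bump e = lift (\<lambda>(i, t). case i of Inl v \<Rightarrow> 0 | Inr e' \<Rightarrow> of_bool (e' = e) * (t * (1 - t)))"

lemma bump:
  shows continuous_bump: "continuous_map (one_complex G) euclideanreal (bump e)"
    and bump_vpt: "v \<in> verts G \<Longrightarrow> bump e (vpt G v) = 0"
    and bump_ept: "e' \<in> edges G \<Longrightarrow> 0 \<le> t \<Longrightarrow> t \<le> 1 \<Longrightarrow>
      bump e (ept G e' t) = of_bool (e' = e) * (t * (1 - t))"
  unfolding bump_def by (subst lift_one_complex; auto intro!: continuous_intros lift_one_complex(1))+

section \<open>Telling points of the 1-complex apart\<close>

lemma vpt_inj:
  fixes G :: "'a graph"
  assumes "u \<in> verts G" "v \<in> verts G" "vpt G u = vpt G v"
  shows "u = v"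
proof -
  define \<phi> :: "'a \<Rightarrow> real" where "\<phi> = (\<lambda>w. of_bool (w = u))"
  have "\<phi> u = \<phi> v"
    using interp_vpt[OF assms(1), of \<phi>] interp_vpt[OF assms(2), of \<phi>] assms(3) by metis
  then show ?thesis
    by (simp add: \<phi>_def split: if_splits)
qed

lemma ept_not_vpt:
  assumes "e \<in> edges G" "v \<in> verts G" "0 < t" "t < 1"
  shows "ept G e t \<noteq> vpt G v"
  using bump_vpt[OF assms(2), of e] bump_ept[OF assms(1), of t e] assms(3,4) by auto

text \<open>\<open>bump e\<close> recovers the edge; the interpolated indicator of
  \<open>end1 e\<close> is the coordinate along \<open>e\<close> and recovers the parameter.\<close>

lemma ept_inj:
  assumes G: "simple_graph G" and e: "e \<in> edges G" and e': "e' \<in> edges G"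
    and t: "0 < t" "t < 1" and s: "0 \<le> s" "s \<le> 1" and eq: "ept G e t = ept G e' s"
  shows "e = e' \<and> t = s"
proof -
  have "t * (1 - t) = of_bool (e' = e) * (s * (1 - s))"
    using bump_ept[OF e, of t e] bump_ept[OF e', of s e] t s eq by simp
  moreover have "t * (1 - t) \<noteq> 0"
    using t by auto
  ultimately have "e' = e"
    by (metis mult_zero_left of_bool_eq(1))
  then show ?thesis
    using interp_ept[OF e, of t "\<lambda>v. of_bool (v = end1 e)"] interp_ept[OF e', of s "\<lambda>v. of_bool (v = end1 e)"]
      t s eq end_verts(3)[OF G e] by simp
qed

text \<open>Distinct points get different values under some continuous real function, and preimages
  of disjoint open sets of reals separate them.\<close>

lemma Hausdorff_one_complex:
  assumes G: "simple_graph G"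
  shows "Hausdorff_space (one_complex G)"
proof -
  have sep: "\<exists>f. continuous_map (one_complex G) euclideanreal f \<and> f x \<noteq> f y"
    if xy: "x \<in> topspace (one_complex G)" "y \<in> topspace (one_complex G)" "x \<noteq> y" for x y
  proof -
    \<comment> \<open>Normal form: the parameters 0 and 1 of an edge are absorbed by its end
      vertices.\<close>
    have form: "(\<exists>v\<in>verts G. x = vpt G v) \<or> (\<exists>e\<in>edges G. \<exists>t. 0 < t \<and> t < 1 \<and> x = ept G e t)"
      if x: "x \<in> topspace (one_complex G)" for x
    proof -
      consider v where "v \<in> verts G" "x = vpt G v" | e t where "e \<in> edges G" "0 \<le> t" "t \<le> 1" "x = ept G e t"
        using x unfolding topspace_one_complex by auto
      then show ?thesis
      proof cases
        case 2
        then consider "t = 0" | "t = 1" | "0 < t" "t < 1" by linarith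
        then show ?thesis
          using 2 ept_ends[OF G, of e] end_verts[OF G, of e] by cases auto
      qed auto
    qed
    have vertex: "\<exists>f. continuous_map (one_complex G) euclideanreal f \<and> f x \<noteq> f y"
      if v: "v \<in> verts G" "x = vpt G v" and y: "y \<in> topspace (one_complex G)" "x \<noteq> y" for v x y
    proof -
      let ?f = "interp (\<lambda>w. of_bool (w = v))"
      have "?f y \<noteq> 1"
        using form[OF y(1)]
      proof (elim disjE bexE exE conjE)
        fix e t assume "e \<in> edges G" "0 < t" "t < 1" "y = ept G e t"
        then show ?thesis
          using interp_ept[of e G t "\<lambda>w. of_bool (w = v)"] end_verts(3)[OF G, of e] by auto
      qed (use interp_vpt[of _ G "\<lambda>w. of_bool (w = v)"] y v in auto)
      then show ?thesis
        using interp_vpt[OF v(1), of "\<lambda>w. of_bool (w = v)"] v(2)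
        by (intro exI[of _ ?f]) (auto simp: continuous_interp)
    qed
    show ?thesis
      using form[OF xy(1)]
    proof (elim disjE bexE exE conjE)
      fix v assume "v \<in> verts G" "x = vpt G v"
      then show ?thesis
        using vertex xy by blast
    next
      fix e t assume e: "e \<in> edges G" "0 < t" "t < 1" "x = ept G e t"
      show ?thesis
        using form[OF xy(2)]
      proof (elim disjE bexE exE conjE)
        fix v assume "v \<in> verts G" "y = vpt G v"
        then show ?thesis
          using vertex[of v y x] xy by metis
      next
        fix e' s assume e': "e' \<in> edges G" "0 < s" "s < 1" "y = ept G e' s"
        show ?thesis
        proof (cases "e = e'")
          case False
          then have "bump e x \<noteq> bump e y"
            using bump_ept[OF e(1), of t e] bump_ept[OF e'(1), of s e] e e' by auto
          then show ?thesis
            using continuous_bump by blast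
        next
          case True
          then have "t \<noteq> s"
            using e e' xy by auto
          let ?f = "interp (\<lambda>v. of_bool (v = end1 e))"
          have "?f x = t" "?f y = s"
            using interp_ept[OF e(1), of t "\<lambda>v. of_bool (v = end1 e)"] True
              interp_ept[OF e(1), of s "\<lambda>v. of_bool (v = end1 e)"] e e' end_verts(3)[OF G e(1)] by auto
          then show ?thesis
            using \<open>t \<noteq> s\<close> continuous_interp by metis
        qed
      qed
    qed
  qed
  show ?thesis
    unfolding Hausdorff_space_def
  proof (intro allI impI, elim conjE)
    fix x y assume xy: "x \<in> topspace (one_complex G)" "y \<in> topspace (one_complex G)" "x \<noteq> y"
    then obtain f where f: "continuous_map (one_complex G) euclideanreal f" "f x \<noteq> f y"
      using sep by blast
    obtain U V where UV: "open U" "open V" "f x \<in> U" "f y \<in> V" "U \<inter> V = {}"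
      using hausdorff[OF f(2)] by blast
    let ?p = "\<lambda>U. {z \<in> topspace (one_complex G). f z \<in> U}"
    have "openin (one_complex G) (?p U)" "openin (one_complex G) (?p V)"
      using f(1) UV by (auto intro!: openin_continuous_map_preimage)
    moreover have "disjnt (?p U) (?p V)"
      using UV(5) by (auto simp: disjnt_iff)
    ultimately show "\<exists>U V. openin (one_complex G) U \<and> openin (one_complex G) V \<and> x \<in> U \<and> y \<in> V \<and> disjnt U V"
      using xy UV by (intro exI[of _ "?p U"] exI[of _ "?p V"]) auto
  qed
qed

text \<open>Interpolate between the values \<open>1\<close> on the vertices reachable from \<open>u\<close>, \<open>0\<close> on \<open>W\<close> and
  \<open>-1\<close> elsewhere: this function vanishes on \<open>W\<close> only.\<close>

lemma connectedin_imp_reach: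
  assumes G: "simple_graph G" and S: "connectedin (one_complex G) S"
    and u: "u \<in> verts G" "vpt G u \<in> S" and v: "v \<in> verts G" "vpt G v \<in> S"
    and W: "W \<subseteq> {c}" "S \<inter> vpt G ` (W \<inter> verts G) = {}"
  shows "(u, v) \<in> reach G W"
proof -
  define \<phi> :: "'a \<Rightarrow> real" where "\<phi> = (\<lambda>w. if w \<in> W then 0 else if (u, w) \<in> reach G W then 1 else -1)"
  define f where "f = interp \<phi>"
  note f = continuous_interp[of G \<phi>, folded f_def] interp_vpt[of _ G \<phi>, folded f_def] interp_ept[of _ G _ \<phi>, folded f_def]
  have uW: "u \<notin> W" "v \<notin> W"
    using u v W(2) by auto
  have nz: "f p \<noteq> 0" if p: "p \<in> S" for p
  proof
    assume 0: "f p = 0"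
    have "p \<in> topspace (one_complex G)"
      using S p connectedin_subset_topspace by blast
    moreover have False if "w \<in> verts G" "p = vpt G w" for w
      using f(2)[OF that(1)] that 0 W(2) p by (auto simp: \<phi>_def split: if_splits)
    moreover have False if e: "e \<in> edges G" "0 \<le> t" "t \<le> 1" "p = ept G e t" for e t
    proof -
      let ?a = "end0 e" and ?b = "end1 e"
      note ends = end_verts[OF G e(1)] ept_ends[OF G e(1)]
      have f0: "(1 - t) * \<phi> ?a + t * \<phi> ?b = 0"
        using f(3)[of e t] e 0 by simp
      \<comment> \<open>\<open>W\<close> has at most one element, so no edge has both ends in
        \<open>W\<close>; on such an edge the function would vanish identically.\<close>
      consider "?a \<in> W" "?b \<notin> W" | "?a \<notin> W" "?b \<in> W" | "?a \<notin> W" "?b \<notin> W"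
        using W(1) ends(3) by blast
      then show False
      proof cases
        case 1
        then have "t = 0"
          using f0 by (auto simp: \<phi>_def split: if_splits)
        then show False
          using W(2) p e ends 1 by auto
      next
        case 2
        then have "t = 1"
          using f0 by (auto simp: \<phi>_def split: if_splits)
        then show False
          using W(2) p e ends 2 by auto
      next
        case 3
        have "(?a, ?b) \<in> reach G W"
          using 3 edge_eq_ends[OF G e(1)] e(1) by (intro reach_edge) auto
        then have "(u, ?a) \<in> reach G W \<longleftrightarrow> (u, ?b) \<in> reach G W"
          using reach_trans reach_sym by metis
        then show False
          using f0 3 by (auto simp: \<phi>_def algebra_simps split: if_splits)
      qed
    qed
    ultimately show False
      unfolding topspace_one_complex by (elim UnE UN_E imageE) (metis atLeastAtMost_iff)+
  qed
  have "connected (f ` S)"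
    using connectedin_continuous_map_image[OF f(1) S] by simp
  moreover have "f (vpt G u) = 1" "f (vpt G v) = \<phi> v"
    using f(2) u v uW by (auto simp: \<phi>_def)
  ultimately have "0 \<in> f ` S" if "\<phi> v = -1"
    using connectedD_interval[of "f ` S" "-1" 1 0] that u(2) v(2) image_eqI[of _ f _ S] by force
  then have "\<phi> v \<noteq> -1"
    using nz by force
  then show ?thesis
    using uW by (auto simp: \<phi>_def split: if_splits)
qed

section \<open>Arcs\<close>

text \<open>Recording the ends makes arcs easy to join and split. Only an injective continuous
  parametrization is asked for; in a Hausdorff space compactness of the interval makes it an
  embedding.\<close>

definition arc_betw :: "'x topology \<Rightarrow> 'x set \<Rightarrow> 'x \<Rightarrow> 'x \<Rightarrow> bool" where
  "arc_betw X A u v \<longleftrightarrow> (\<exists>g. continuous_map (top_of_set {0..1::real}) X g \<and> inj_on g {0..1} \<and>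
     g ` {0..1} = A \<and> g 0 = u \<and> g 1 = v)"

lemma arc_betw_interval:
  fixes a b :: real
  assumes ab: "a < b" and g: "continuous_map (top_of_set {a..b}) X g" "inj_on g {a..b}"
  shows "arc_betw X (g ` {a..b}) (g a) (g b)"
proof -
  define h where "h = (\<lambda>t. a + (b - a) * t)"
  have h_img: "h ` {0..1} = {a..b}"
  proof
    show "h ` {0..1} \<subseteq> {a..b}"
    proof
      fix y assume "y \<in> h ` {0..1}"
      then obtain t where t: "0 \<le> t" "t \<le> 1" "y = h t"
        by auto
      have "0 \<le> (b - a) * t" "0 \<le> (b - a) * (1 - t)"
        using ab t by auto
      then have "a \<le> y" "y \<le> b"
        unfolding t(3) h_def by (simp_all only: algebra_simps)
      then show "y \<in> {a..b}"
        by simp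
    qed
    show "{a..b} \<subseteq> h ` {0..1}"
    proof
      fix t assume "t \<in> {a..b}"
      then show "t \<in> h ` {0..1}"
        using ab by (intro image_eqI[of _ _ "(t - a) / (b - a)"]) (auto simp: h_def)
    qed
  qed
  have "continuous_map (top_of_set {0..1}) (top_of_set {a..b}) h"
    using h_img by (auto simp: h_def intro!: continuous_intros)
  then have "continuous_map (top_of_set {0..1}) X (g \<circ> h)"
    using g(1) by (rule continuous_map_compose)
  moreover have "inj_on (g \<circ> h) {0..1}"
    using g(2) ab h_img by (intro comp_inj_on) (auto simp: inj_on_def h_def)
  moreover have "(g \<circ> h) ` {0..1} = g ` {a..b}"
    by (simp only: image_comp[symmetric] h_img)
  moreover have "(g \<circ> h) 0 = g a" "(g \<circ> h) 1 = g b"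
    by (simp_all add: h_def)
  ultimately show ?thesis
    unfolding arc_betw_def by blast
qed

lemma arc_betw_ends: "arc_betw X A u v \<Longrightarrow> u \<in> A \<and> v \<in> A \<and> u \<noteq> v"
  unfolding arc_betw_def by (force dest: inj_onD[of _ _ 0 1])

lemma arc_betw_subset: "arc_betw X A u v \<Longrightarrow> A \<subseteq> topspace X"
  unfolding arc_betw_def by (auto simp: continuous_map_def)

lemma arc_betw_rev:
  assumes "arc_betw X A u v"
  shows "arc_betw X A v u"
proof -
  obtain g where g: "continuous_map (top_of_set {0..1::real}) X g" "inj_on g {0..1}"
     "g ` {0..1} = A" "g 0 = u" "g 1 = v"
    using assms unfolding arc_betw_def by blast
  define h where "h = (\<lambda>t. 1 - t :: real)"
  have h_img: "h ` {0..1} = {0..1}"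
    by (auto simp: h_def image_iff intro!: bexI[of _ "1 - _"])
  have "continuous_map (top_of_set {0..1}) (top_of_set {0..1}) h"
    using h_img by (auto simp: h_def intro!: continuous_intros)
  then have "continuous_map (top_of_set {0..1}) X (g \<circ> h)"
    using g(1) by (rule continuous_map_compose)
  moreover have "inj_on (g \<circ> h) {0..1}"
    using g(2) h_img by (intro comp_inj_on) (auto simp: inj_on_def h_def)
  moreover have "(g \<circ> h) ` {0..1} = A"
    by (simp only: image_comp[symmetric] h_img g(3))
  moreover have "(g \<circ> h) 0 = v" "(g \<circ> h) 1 = u"
    using g by (simp_all add: h_def)
  ultimately show ?thesis
    unfolding arc_betw_def by blast
qed

lemma arc_betw_join:
  assumes "arc_betw X A u v" "arc_betw X B v w" "A \<inter> B \<subseteq> {v}"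
  shows "arc_betw X (A \<union> B) u w"
proof -
  obtain g where g: "continuous_map (top_of_set {0..1::real}) X g" "inj_on g {0..1}"
     "g ` {0..1} = A" "g 0 = u" "g 1 = v"
    using assms(1) unfolding arc_betw_def by blast
  obtain h where h: "continuous_map (top_of_set {0..1::real}) X h" "inj_on h {0..1}"
     "h ` {0..1} = B" "h 0 = v" "h 1 = w"
    using assms(2) unfolding arc_betw_def by blast
  define k where "k = (\<lambda>t. if t \<le> 1 then g t else h (t - 1))"
  have h': "continuous_map (top_of_set {1..2}) X (\<lambda>t. h (t - 1))"
  proof -
    have "continuous_map (top_of_set {1..2}) (top_of_set {0..1}) (\<lambda>t. t - 1 :: real)"
      by (auto intro!: continuous_intros)
    from continuous_map_compose[OF this h(1)] show ?thesis
      by (simp add: comp_def)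
  qed
  have "continuous_map (top_of_set {0..2}) X k"
    unfolding k_def
  proof (rule continuous_map_cases_le)
    have "{x \<in> topspace (top_of_set {0..2}). x \<le> (1::real)} = {0..1}"
      "{x \<in> topspace (top_of_set {0..2}). (1::real) \<le> x} = {1..2}"
      by auto
    then show "continuous_map (subtopology (top_of_set {0..2}) {x \<in> topspace (top_of_set {0..2}). x \<le> 1}) X g"
      "continuous_map (subtopology (top_of_set {0..2}) {x \<in> topspace (top_of_set {0..2}). 1 \<le> x}) X (\<lambda>t. h (t - 1))"
      using g(1) h' by (auto simp: subtopology_subtopology Int_absorb1 min_def)
  qed (use g h in auto)
  moreover have "inj_on k {0..2}"
  proof -
    \<comment> \<open>A value common to both halves must be \<open>v = h 0\<close>, but here
      \<open>t - 1 > 0\<close>.\<close>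
    have *: False if st: "0 \<le> s" "s \<le> 1" "1 < t" "t \<le> 2" "g s = h (t - 1)" for s t
    proof -
      have "g s \<in> A"
        using st(1,2) g(3) by auto
      moreover have "h (t - 1) \<in> B"
        using st(3,4) h(3) by auto
      ultimately have "h (t - 1) = h 0"
        using assms(3) st(5) h(4) by auto
      then have "t - 1 = 0"
        using st by (intro inj_onD[OF h(2)]) auto
      then show False
        using st by simp
    qed
    show ?thesis
    proof (rule inj_onI)
      fix s t assume st: "s \<in> {0..2}" "t \<in> {0..2}" "k s = k t"
      consider "s \<le> 1" "t \<le> 1" | "s > 1" "t > 1" | "s \<le> 1" "t > 1" | "s > 1" "t \<le> 1"
        by linarith
      then show "s = t"
      proof cases
        case 1
        then show ?thesis
          using st inj_onD[OF g(2), of s t] by (auto simp: k_def)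
      next
        case 2
        then show ?thesis
          using st inj_onD[OF h(2), of "s - 1" "t - 1"] by (auto simp: k_def)
      next
        case 3
        then show ?thesis
          using *[of s t] st by (auto simp: k_def)
      next
        case 4
        then show ?thesis
          using *[of t s] st by (auto simp: k_def)
      qed
    qed
  qed
  ultimately have "arc_betw X (k ` {0..2}) (k 0) (k 2)"
    by (intro arc_betw_interval) auto
  moreover have "k ` {0..2} = A \<union> B"
  proof -
    have "k ` {0..1} = A"
      using g(3) by (auto simp: k_def)
    moreover have "k ` {1..2} = (\<lambda>t. h (t - 1)) ` {1..2}"
      using g(5) h(4) by (intro image_cong) (auto simp: k_def)
    moreover have "(\<lambda>t. h (t - 1)) ` {1..2} = h ` ((\<lambda>t. t - 1) ` {1..2})"
      by (simp only: image_image)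
    moreover have "(\<lambda>t. t - 1) ` {1..2} = {0..1::real}"
      using image_add_atLeastAtMost[of "-1" 1 "2::real"] by (simp add: add.commute)
    moreover have "{0..2} = {0..1} \<union> {1..2::real}"
      by auto
    ultimately show ?thesis
      using h(3) by (metis image_Un)
  qed
  ultimately show ?thesis
    using g(4) h(5) by (simp add: k_def)
qed

lemma arc_betw_split:
  assumes "arc_betw X A u v" "p \<in> A" "p \<noteq> u" "p \<noteq> v"
  obtains A1 A2 where "arc_betw X A1 u p" "arc_betw X A2 p v" "A1 \<union> A2 = A" "A1 \<inter> A2 = {p}"
proof -
  obtain g where g: "continuous_map (top_of_set {0..1::real}) X g" "inj_on g {0..1}"
     "g ` {0..1} = A" "g 0 = u" "g 1 = v"
    using assms unfolding arc_betw_def by blast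
  obtain s where s: "s \<in> {0..1}" "g s = p"
    using assms(2) g(3) by blast
  then have s01: "0 < s" "s < 1"
    using g(4,5) assms(3,4) by (metis atLeastAtMost_iff less_eq_real_def)+
  have sub: "continuous_map (top_of_set S) X g" "inj_on g S" if "S \<subseteq> {0..1}" for S
    using g(1,2) that continuous_map_from_subtopology_mono inj_on_subset by blast+
  have 1: "arc_betw X (g ` {0..s}) u p" "arc_betw X (g ` {s..1}) p v"
    using arc_betw_interval[OF s01(1) sub[of "{0..s}"]] arc_betw_interval[OF s01(2) sub[of "{s..1}"]]
      s s01 g(4,5) by auto
  have "g ` {0..s} \<union> g ` {s..1} = A"
    using s g(3) by (metis atLeastAtMost_iff image_Un ivl_disj_un_two_touch(4))
  moreover have "g ` {0..s} \<inter> g ` {s..1} = g ` ({0..s} \<inter> {s..1})"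
    using s by (intro inj_on_image_Int[OF g(2), symmetric]) auto
  moreover have "{0..s} \<inter> {s..1} = {s}"
    using s by auto
  ultimately show thesis
    using that[OF 1] s by simp
qed

lemma arc_betw_imp_is_arc_in:
  assumes "Hausdorff_space X" "arc_betw X A u v"
  shows "is_arc_in X A"
proof -
  obtain g where g: "continuous_map (top_of_set {0..1::real}) X g" "inj_on g {0..1}" "g ` {0..1} = A"
    using assms unfolding arc_betw_def by blast
  have "embedding_map (top_of_set {0..1}) X g"
    using g assms(1) by (intro continuous_imp_embedding_map) (auto simp: compact_space_subtopology)
  then have "top_of_set {0..1::real} homeomorphic_space subtopology X A"
    using embedding_map_imp_homeomorphic_space g(3) by fastforce
  then show ?thesis
    using arc_betw_subset[OF assms(2)] homeomorphic_space_sym unfolding is_arc_in_def by blast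
qed

lemma is_arc_in_param:
  assumes "is_arc_in X A"
  obtains g where "continuous_map (top_of_set {0..1::real}) X g" "inj_on g {0..1}" "g ` {0..1} = A"
proof -
  have "top_of_set {0..1::real} homeomorphic_space subtopology X A" and A: "A \<subseteq> topspace X"
    using assms homeomorphic_space_sym unfolding is_arc_in_def by blast+
  then obtain g where g: "homeomorphic_map (top_of_set {0..1::real}) (subtopology X A) g"
    unfolding homeomorphic_space by blast
  have "continuous_map (top_of_set {0..1}) X g"
    using homeomorphic_imp_continuous_map[OF g] by (simp add: continuous_map_in_subtopology)
  moreover have "inj_on g {0..1}"
    using homeomorphic_imp_injective_map[OF g] by simp
  moreover have "g ` {0..1} = A"
    using homeomorphic_imp_surjective_map[OF g] A by auto
  ultimately show thesis
    using that by blast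
qed

section \<open>Orders that place no separated vertex in the middle\<close>

text \<open>Constrains \<open>lt\<close> on vertices only. The order selects the middles of all
  triples coherently.\<close>

definition linear_nsep :: "('a \<Rightarrow> 'a \<Rightarrow> bool) \<Rightarrow> 'a graph \<Rightarrow> bool" where
  "linear_nsep lt G \<longleftrightarrow>
     (\<forall>x\<in>verts G. \<not> lt x x) \<and>
     (\<forall>x\<in>verts G. \<forall>y\<in>verts G. x \<noteq> y \<longrightarrow> lt x y \<or> lt y x) \<and>
     (\<forall>x\<in>verts G. \<forall>y\<in>verts G. \<forall>z\<in>verts G. lt x y \<longrightarrow> lt y z \<longrightarrow> lt x z \<and> nsep G x y z)"

definition subdivide :: "'a graph \<Rightarrow> 'a \<Rightarrow> 'a \<Rightarrow> 'a \<Rightarrow> 'a graph" where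
  "subdivide G u p v = Graph (insert p (verts G)) ({{u, p}, {p, v}} \<union> (edges G - {{u, v}}))"

text \<open>As \<open>lt\<close> is arbitrary outside the vertices, \<open>lt u p\<close> may happen
  to hold; the test \<open>y \<noteq> p\<close> keeps the new order irreflexive at
  \<open>p\<close>.\<close>

definition insert_after :: "('a \<Rightarrow> 'a \<Rightarrow> bool) \<Rightarrow> 'a \<Rightarrow> 'a \<Rightarrow> 'a \<Rightarrow> 'a \<Rightarrow> bool" where
  "insert_after lt u p x y =
     (if x = p then y \<noteq> p \<and> lt u y else if y = p then x = u \<or> lt x u else lt x y)"

text \<open>Deleting an old vertex affects connections as before (\<open>R1\<close>). Deleting
  \<open>p\<close> amounts to deleting the edge \<open>{u, v}\<close>, which is weaker than deleting
  \<open>u\<close> or \<open>v\<close> (\<open>R2\<close>), so middles of \<open>G\<close> can be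
  used with one of these deleted instead. The cases \<open>nA\<close> to \<open>nD\<close> differ in
  the place of \<open>p\<close> in the triple.\<close>

lemma linear_nsep_subdivide:
  assumes G: "simple_graph G" and L: "linear_nsep lt G" and uv: "{u, v} \<in> edges G" "lt u v"
    and p: "p \<notin> verts G"
  shows "linear_nsep (insert_after lt u p) (subdivide G u p v)"
proof -
  let ?H = "subdivide G u p v" and ?lt = "insert_after lt u p"
  have E: "edges ?H = {{u, p}, {p, v}} \<union> (edges G - {{u, v}})" and V: "verts ?H = insert p (verts G)"
    by (auto simp: subdivide_def)
  have uvV: "u \<in> verts G" "v \<in> verts G" "u \<noteq> v" "u \<noteq> p" "v \<noteq> p"
    using simple_graph_edge_verts[OF G uv(1)] p by auto
  have irr: "\<not> lt x x" if "x \<in> verts G" for x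
    using L that by (auto simp: linear_nsep_def)
  have tot: "lt x y \<or> lt y x" if "x \<in> verts G" "y \<in> verts G" "x \<noteq> y" for x y
    using L that by (auto simp: linear_nsep_def)
  have tr: "lt x z" if "x \<in> verts G" "y \<in> verts G" "z \<in> verts G" "lt x y" "lt y z" for x y z
    using L that unfolding linear_nsep_def by blast
  have N: "c \<noteq> x \<and> (y, x) \<in> reach G {c} \<or> c \<noteq> z \<and> (y, z) \<in> reach G {c}"
    if "x \<in> verts G" "y \<in> verts G" "z \<in> verts G" "lt x y" "lt y z" "c \<noteq> y" for x y z c
    using L that unfolding linear_nsep_def nsep_def by blast
  have up: "(p, u) \<in> reach ?H {c}" if "c \<noteq> p" "c \<noteq> u" for c
    using that by (intro reach_edge) (auto simp: E insert_commute)
  have pv: "(p, v) \<in> reach ?H {c}" if "c \<noteq> p" "c \<noteq> v" for c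
    using that by (intro reach_edge) (auto simp: E)
  \<comment> \<open>The lost edge from \<open>u\<close> to \<open>v\<close> is replaced by the way
    over \<open>p\<close>.\<close>
  have R1: "(a, b) \<in> reach ?H {c}" if "(a, b) \<in> reach G {c}" "c \<noteq> p" for a b c
    using that(1) unfolding reach_def[of G]
  proof (induction rule: rtrancl_induct)
    case (step a' b')
    then have ab: "{a', b'} \<in> edges G" "a' \<noteq> c" "b' \<noteq> c"
      by (auto simp: adj_remove_verts)
    have "(a', b') \<in> reach ?H {c}"
    proof (cases "{a', b'} = {u, v}")
      case True
      then show ?thesis
        using up[OF that(2)] pv[OF that(2)] ab by (auto simp: doubleton_eq_iff intro: reach_trans reach_sym)
    next
      case False
      then show ?thesis
        using ab by (intro reach_edge) (auto simp: E)
    qed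
    then show ?case
      using step reach_trans by metis
  qed simp
  \<comment> \<open>A walk that avoids one end of \<open>{u, v}\<close> does not use this edge, and
    no other edge is lost.\<close>
  have R2: "(a, b) \<in> reach ?H {p}" if "(a, b) \<in> reach G {c}" "c = u \<or> c = v" for a b c
    using that(1) unfolding reach_def
  proof (rule rtrancl_mono[THEN subsetD, rotated], intro subrelI)
    fix a b assume "(a, b) \<in> adj (remove_verts G {c})"
    then have "{a, b} \<in> edges G" "a \<noteq> c" "b \<noteq> c"
      by (auto simp: adj_remove_verts)
    moreover have "a \<noteq> p" "b \<noteq> p"
      using simple_graph_edge_verts[OF G \<open>{a, b} \<in> edges G\<close>] p by auto
    ultimately show "(a, b) \<in> adj (remove_verts ?H {p})"
      using that(2) by (auto simp: adj_remove_verts E doubleton_eq_iff)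
  qed
  have R1p: "(a, p) \<in> reach ?H {c}" if "(a, u) \<in> reach G {c}" "c \<noteq> p" "c \<noteq> u" for a c
    using reach_trans[OF R1[OF that(1,2)] reach_sym[OF up[OF that(2,3)]]] .
  have nA: "nsep ?H x y z" if x: "x \<in> verts G" "y \<in> verts G" "z \<in> verts G" "lt x y" "lt y z" for x y z
    unfolding nsep_def
  proof (intro allI impI)
    fix c assume c: "c \<noteq> y"
    have ne: "p \<noteq> x" "p \<noteq> z"
      using x p by auto
    show "c \<noteq> x \<and> (y, x) \<in> reach ?H {c} \<or> c \<noteq> z \<and> (y, z) \<in> reach ?H {c}"
    proof (cases "c = p")
      case False
      then show ?thesis
        using N[OF x c] R1[of y x c] R1[of y z c] by auto
    next
      case True
      \<comment> \<open>The middle property in \<open>G\<close> needs a deleted vertex other than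
        \<open>y\<close>; one of the two ends qualifies.\<close>
      obtain d where "d = u \<or> d = v" "d \<noteq> y"
        using uvV by auto
      then show ?thesis
        using N[OF x, of d] R2[of y x d] R2[of y z d] ne True by auto
    qed
  qed
  have nB: "nsep ?H p y z" if x: "y \<in> verts G" "z \<in> verts G" "lt u y" "lt y z" for y z
    unfolding nsep_def
  proof (intro allI impI)
    fix c assume c: "c \<noteq> y"
    note N' = N[OF uvV(1) x]
    show "c \<noteq> p \<and> (y, p) \<in> reach ?H {c} \<or> c \<noteq> z \<and> (y, z) \<in> reach ?H {c}"
    proof (cases "c = p")
      case True
      \<comment> \<open>With \<open>u\<close> deleted, the triple \<open>u < y < z\<close> leaves
        only \<open>z\<close> for \<open>y\<close> to reach.\<close>
      have "(y, z) \<in> reach G {u}"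
        using N'[of u] x irr uvV by auto
      then show ?thesis
        using R2[of y z u] True p x by auto
    next
      case False
      then show ?thesis
        using N'[OF c] R1[of y z c] R1p[of y c] by auto
    qed
  qed
  have nC: "nsep ?H x y p" if x: "x \<in> verts G" "y \<in> verts G" "lt x y" "y = u \<or> lt y u" for x y
    unfolding nsep_def
  proof (intro allI impI)
    fix c assume c: "c \<noteq> y"
    have px: "p \<noteq> x"
      using x p by auto
    show "c \<noteq> x \<and> (y, x) \<in> reach ?H {c} \<or> c \<noteq> p \<and> (y, p) \<in> reach ?H {c}"
    proof (cases "y = u")
      case True
      then have "lt x u"
        using x(3) by simp
      \<comment> \<open>With \<open>v\<close> deleted, the triple \<open>x < u < v\<close> leaves
        only \<open>x\<close> for \<open>u\<close> to reach.\<close>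
      from N[OF x(1) uvV(1,2) this uv(2), of v] have "(u, x) \<in> reach ?H {p}"
        using R2[of u x v] uvV(3) by simp
      moreover have "(u, p) \<in> reach ?H {c}" if "c \<noteq> p"
        using reach_sym[OF up[OF that]] c True by simp
      ultimately show ?thesis
        using px True by (cases "c = p") auto
    next
      case False
      then have "lt y u"
        using x(4) by simp
      note N' = N[OF x(1,2) uvV(1) x(3) this]
      show ?thesis
      proof (cases "c = p")
        case True
        then show ?thesis
          using N'[of u] \<open>y \<noteq> u\<close> R2[of y x u] px by auto
      next
        case False
        then show ?thesis
          using N'[OF c] R1[of y x c] R1p[of y c] by auto
      qed
    qed
  qed
  have nD: "nsep ?H x p z" if x: "x \<in> verts G" "z \<in> verts G" "x = u \<or> lt x u" "lt u z" for x z
    unfolding nsep_def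
  proof (intro allI impI)
    fix c assume c: "c \<noteq> p"
    \<comment> \<open>Both \<open>v\<close> and \<open>z\<close> come after \<open>u\<close>.
      Whichever of them lies between \<open>u\<close> and the other must reach the other once
      \<open>u\<close> is deleted. Here \<open>u < v\<close> is essential.\<close>
    have "(v, z) \<in> reach G {u}"
    proof (cases "z = v")
      case False
      then have "lt v z \<or> lt z v"
        using tot[OF uvV(2) x(2)] by simp
      then show ?thesis
      proof
        assume "lt v z"
        from N[OF uvV(1,2) x(2) uv(2) this, of u] show ?thesis
          using uvV(3) by simp
      next
        assume "lt z v"
        moreover have "u \<noteq> z"
          using x irr by auto
        ultimately show ?thesis
          using N[OF uvV(1) x(2) uvV(2) x(4), of u] reach_sym[of z v G "{u}"] by simp
      qed
    qed simp
    then have *: "(p, z) \<in> reach ?H {u}" "z \<noteq> u"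
      using pv[of u] R1[of v z u] uvV reach_trans[of p v ?H "{u}" z] x irr by auto
    show "c \<noteq> x \<and> (p, x) \<in> reach ?H {c} \<or> c \<noteq> z \<and> (p, z) \<in> reach ?H {c}"
    proof (cases "c = u")
      case True
      then show ?thesis
        using * by auto
    next
      case False
      show ?thesis
      proof (cases "x = u")
        case True
        then show ?thesis
          using up[OF c] False by simp
      next
        case False
        then have "lt x u"
          using x(3) by simp
        from N[OF x(1) uvV(1) x(2) this x(4) \<open>c \<noteq> u\<close>] show ?thesis
          using up[OF c \<open>c \<noteq> u\<close>] R1[of u x c] R1[of u z c] c reach_trans[of p u ?H "{c}"] by auto
      qed
    qed
  qed
  have ne: "x \<noteq> p" if "x \<in> verts G" for x
    using that p by blast
  show ?thesis
    unfolding linear_nsep_def V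
  proof (intro conjI ballI impI)
    fix x y assume "x \<in> insert p (verts G)" "y \<in> insert p (verts G)" "x \<noteq> y"
    then show "?lt x y \<or> ?lt y x"
      using tot uvV ne by (auto simp: insert_after_def)
  next
    fix x assume "x \<in> insert p (verts G)"
    then show "\<not> ?lt x x"
      using irr by (auto simp: insert_after_def)
  next
    fix x y z assume V: "x \<in> insert p (verts G)" "y \<in> insert p (verts G)" "z \<in> insert p (verts G)"
      and l: "?lt x y" "?lt y z"
    consider "x = p" "y \<in> verts G" "z = p" | "x = p" "y \<in> verts G" "z \<in> verts G"
      | "x \<in> verts G" "y = p" "z \<in> verts G" | "x \<in> verts G" "y \<in> verts G" "z = p"
      | "x \<in> verts G" "y \<in> verts G" "z \<in> verts G"
      using V l by (auto simp: insert_after_def split: if_splits)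
    then have "?lt x z \<and> nsep ?H x y z"
    proof cases
      case 1
      then show ?thesis
        using l ne uvV tr[of u y u] irr[of u] by (auto simp: insert_after_def)
    next
      case 2
      then show ?thesis
        using l ne[of y] ne[of z] nB[of y z] tr[of u y z] uvV by (auto simp: insert_after_def)
    next
      case 3
      then show ?thesis
        using l ne[of x] ne[of z] nD[of x z] tr[of x u z] uvV by (auto simp: insert_after_def)
    next
      case 4
      then show ?thesis
        using l ne[of x] ne[of y] nC[of x y] tr[of x y u] uvV by (auto simp: insert_after_def)
    next
      case 5
      then show ?thesis
        using l ne[of x] ne[of y] ne[of z] nA[of x y z] tr[of x y z] by (auto simp: insert_after_def)
    qed
    then show "?lt x z" "nsep ?H x y z"
      by blast+
  qed
qed

section \<open>Graphs drawn in a topological space\<close>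

text \<open>The vertices are points of \<open>X\<close> and \<open>A e\<close> is the arc drawn for
  the edge \<open>e\<close>. With \<open>X\<close> fixed, subdividing an edge only redraws the
  graph, and no two 1-complexes have to be compared.\<close>

definition realizes :: "'x topology \<Rightarrow> 'x graph \<Rightarrow> ('x set \<Rightarrow> 'x set) \<Rightarrow> bool" where
  "realizes X H A \<longleftrightarrow> simple_graph H \<and> topspace X = verts H \<union> (\<Union>e\<in>edges H. A e) \<and>
     (\<forall>u v. {u, v} \<in> edges H \<longrightarrow> arc_betw X (A {u, v}) u v) \<and>
     (\<forall>e\<in>edges H. A e \<inter> verts H \<subseteq> e) \<and>
     (\<forall>e\<in>edges H. \<forall>f\<in>edges H. e \<noteq> f \<longrightarrow> A e \<inter> A f \<subseteq> verts H)"

lemma realizesD: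
  assumes "realizes X H A"
  shows "simple_graph H" "topspace X = verts H \<union> (\<Union>e\<in>edges H. A e)"
    "\<And>u v. {u, v} \<in> edges H \<Longrightarrow> arc_betw X (A {u, v}) u v"
    "\<And>e q. e \<in> edges H \<Longrightarrow> q \<in> A e \<Longrightarrow> q \<in> verts H \<Longrightarrow> q \<in> e"
    "\<And>e f q. e \<in> edges H \<Longrightarrow> f \<in> edges H \<Longrightarrow> e \<noteq> f \<Longrightarrow> q \<in> A e \<Longrightarrow> q \<in> A f \<Longrightarrow> q \<in> verts H"
proof -
  show "simple_graph H"
    using assms unfolding realizes_def by (elim conjE)
  show "topspace X = verts H \<union> (\<Union>e\<in>edges H. A e)"
    using assms unfolding realizes_def by (elim conjE)
  have "\<forall>u v. {u, v} \<in> edges H \<longrightarrow> arc_betw X (A {u, v}) u v"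
    using assms unfolding realizes_def by (elim conjE)
  then show "\<And>u v. {u, v} \<in> edges H \<Longrightarrow> arc_betw X (A {u, v}) u v"
    by simp
  have "\<forall>e\<in>edges H. A e \<inter> verts H \<subseteq> e"
    using assms unfolding realizes_def by (elim conjE)
  then show "\<And>e q. e \<in> edges H \<Longrightarrow> q \<in> A e \<Longrightarrow> q \<in> verts H \<Longrightarrow> q \<in> e"
    by blast
  have "\<forall>e\<in>edges H. \<forall>f\<in>edges H. e \<noteq> f \<longrightarrow> A e \<inter> A f \<subseteq> verts H"
    using assms unfolding realizes_def by (elim conjE)
  then show "\<And>e f q. e \<in> edges H \<Longrightarrow> f \<in> edges H \<Longrightarrow> e \<noteq> f \<Longrightarrow> q \<in> A e \<Longrightarrow> q \<in> A f \<Longrightarrow> q \<in> verts H"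
    by blast
qed

text \<open>The arcs of the edges are joined one by one. Confining \<open>B\<close> to edges inside
  \<open>set P\<close> is what makes the induction work: the arc of the new first edge can then meet
  \<open>B\<close> only in \<open>y\<close>. A one-vertex path gives no arc, whence the bound on the
  length.\<close>

lemma realizes_spath:
  assumes R: "realizes X H A" and P: "spath H P" "length P \<ge> 2"
  shows "\<exists>B. arc_betw X B (hd P) (last P) \<and> set P \<subseteq> B \<and> B \<subseteq> (\<Union>e\<in>{e \<in> edges H. e \<subseteq> set P}. A e)"
  using P
proof (induction P rule: induct_list012)
  case (3 x y zs)
  have xy: "{x, y} \<in> edges H" and d: "x \<notin> set (y # zs)" and P': "spath H (y # zs)"
    using 3 by (auto simp: spath_def)
  have arc: "arc_betw X (A {x, y}) x y"
    using realizesD(3)[OF R xy] .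
  show ?case
  proof (cases zs)
    case Nil
    then show ?thesis
      using arc arc_betw_ends[OF arc] xy by (intro exI[of _ "A {x, y}"]) auto
  next
    case (Cons z zs')
    then obtain B where B: "arc_betw X B y (last (y # zs))" "set (y # zs) \<subseteq> B"
      "B \<subseteq> (\<Union>e\<in>{e \<in> edges H. e \<subseteq> set (y # zs)}. A e)"
      using "3.IH"(2) P' by auto
    have "A {x, y} \<inter> B \<subseteq> {y}"
    proof
      fix q assume q: "q \<in> A {x, y} \<inter> B"
      then obtain e where e: "e \<in> edges H" "e \<subseteq> set (y # zs)" "q \<in> A e"
        using B(3) by blast
      then have "e \<noteq> {x, y}"
        using d by auto
      then have "q \<in> verts H"
        using realizesD(5)[OF R xy e(1), of q] q e by auto
      then have "q \<in> {x, y} \<inter> e"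
        using realizesD(4)[OF R xy, of q] realizesD(4)[OF R e(1), of q] q e by auto
      then show "q \<in> {y}"
        using e d by auto
    qed
    then have "arc_betw X (A {x, y} \<union> B) x (last (y # zs))"
      using arc B(1) by (intro arc_betw_join)
    moreover have "set (x # y # zs) \<subseteq> A {x, y} \<union> B"
      using B(2) arc_betw_ends[OF arc] by auto
    moreover have "A {x, y} \<union> B \<subseteq> (\<Union>e\<in>{e \<in> edges H. e \<subseteq> set (x # y # zs)}. A e)"
      using B(3) xy by fastforce
    ultimately show ?thesis
      by (intro exI[of _ "A {x, y} \<union> B"]) auto
  qed
qed auto

text \<open>A point that is no vertex lies on the arc of an edge; cutting this arc at
  \<open>p\<close> draws the two new edges and leaves the union of all arcs unchanged.\<close>

lemma realizes_insert_point:
  assumes R: "realizes X H A" and L: "linear_nsep lt H" and p: "p \<in> topspace X"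
  shows "\<exists>H' A' lt'. realizes X H' A' \<and> linear_nsep lt' H' \<and> verts H' = insert p (verts H)"
proof (cases "p \<in> verts H")
  case True
  then show ?thesis
    using R L by (metis insert_absorb)
next
  case False
  have G: "simple_graph H"
    using realizesD(1)[OF R] .
  obtain e where e: "e \<in> edges H" "p \<in> A e"
    using realizesD(2)[OF R] p False by auto
  obtain a b where ab: "e = {a, b}" "a \<noteq> b"
    using G e by (metis card_2_iff simple_graph_def)
  then have "a \<in> verts H" "b \<in> verts H"
    using simple_graph_edge_verts[OF G] e by auto
  then have "lt a b \<or> lt b a"
    using L ab by (auto simp: linear_nsep_def)
  \<comment> \<open>The ends are named in increasing order, as \<open>linear_nsep_subdivide\<close>
    requires.\<close>
  then obtain u v where uv: "e = {u, v}" "lt u v"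
    using ab by (metis insert_commute)
  have uvE: "{u, v} \<in> edges H"
    using e uv by simp
  have uvV: "u \<in> verts H" "v \<in> verts H" "u \<noteq> v" "p \<noteq> u" "p \<noteq> v"
    using simple_graph_edge_verts[OF G uvE] False by auto
  have "arc_betw X (A {u, v}) u v"
    using realizesD(3)[OF R uvE] .
  then obtain A1 A2 where A12: "arc_betw X A1 u p" "arc_betw X A2 p v" "A1 \<union> A2 = A {u, v}" "A1 \<inter> A2 = {p}"
    using arc_betw_split[of X "A {u, v}" u v p] e uv uvV by metis
  have notin: "p \<notin> f" if "f \<in> edges H" for f
    using G that False by (auto simp: simple_graph_def)
  \<comment> \<open>The update touches no old edge, because old edges do not contain
    \<open>p\<close>.\<close>
  define A' where "A' = A({u, p} := A1, {p, v} := A2)"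
  have A': "A' {u, p} = A1" "A' {p, v} = A2" "\<And>f. f \<in> edges H \<Longrightarrow> A' f = A f"
    using notin uvV by (auto simp: A'_def doubleton_eq_iff)
  let ?H = "subdivide H u p v"
  have E: "edges ?H = {{u, p}, {p, v}} \<union> (edges H - {{u, v}})" and V: "verts ?H = insert p (verts H)"
    by (auto simp: subdivide_def)
  have Auv: "A {u, v} \<inter> verts H \<subseteq> {u, v}"
    using realizesD(4)[OF R uvE] by auto
  have ends: "u \<in> A1" "v \<in> A2" "p \<in> A1" "p \<in> A2"
    using arc_betw_ends[OF A12(1)] arc_betw_ends[OF A12(2)] by auto
  have v1: "v \<notin> A1" and u2: "u \<notin> A2"
    using A12(4) ends uvV by auto
  have pA: "p \<notin> A f" if "f \<in> edges H" "f \<noteq> {u, v}" for f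
  proof
    assume "p \<in> A f"
    then have "p \<in> verts H"
      using realizesD(5)[OF R uvE that(1), of p] that(2) e uv by auto
    then show False
      using False by blast
  qed
  have "realizes X ?H A'"
    unfolding realizes_def
  proof (intro conjI)
    show "simple_graph ?H"
      using G uvV unfolding simple_graph_def E V by (auto simp: card_2_iff)
    have "(\<Union>e\<in>edges ?H. A' e) = (\<Union>e\<in>edges H. A e)"
    proof -
      have "(\<Union>e\<in>edges ?H. A' e) = A1 \<union> A2 \<union> (\<Union>e\<in>edges H - {{u, v}}. A e)"
        using A' unfolding E by auto
      also have "\<dots> = (\<Union>e\<in>edges H. A e)"
        using A12(3) uvE by auto
      finally show ?thesis .
    qed
    then show "topspace X = verts ?H \<union> (\<Union>e\<in>edges ?H. A' e)"
      using realizesD(2)[OF R] e unfolding V by auto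
    show "\<forall>a b. {a, b} \<in> edges ?H \<longrightarrow> arc_betw X (A' {a, b}) a b"
    proof (intro allI impI)
      fix a b assume "{a, b} \<in> edges ?H"
      then consider "a = u" "b = p" | "a = p" "b = u" | "a = p" "b = v" | "a = v" "b = p" | "{a, b} \<in> edges H"
        unfolding E by (auto simp: doubleton_eq_iff)
      then show "arc_betw X (A' {a, b}) a b"
      proof cases
        case 5
        then show ?thesis
          using realizesD(3)[OF R 5] A'(3)[OF 5] by simp
      next
        case 1
        then show ?thesis
          using A12(1) A'(1) by simp
      next
        case 2
        then show ?thesis
          using arc_betw_rev[OF A12(1)] A'(1) by (simp add: insert_commute)
      next
        case 3
        then show ?thesis
          using A12(2) A'(2) by simp
      next
        case 4
        then show ?thesis
          using arc_betw_rev[OF A12(2)] A'(2) by (simp add: insert_commute)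
      qed
    qed
    show "\<forall>e\<in>edges ?H. A' e \<inter> verts ?H \<subseteq> e"
    proof
      fix f assume "f \<in> edges ?H"
      then consider "f = {u, p}" | "f = {p, v}" | "f \<in> edges H" "f \<noteq> {u, v}"
        unfolding E by auto
      then show "A' f \<inter> verts ?H \<subseteq> f"
      proof cases
        case 1
        then show ?thesis
          using A'(1) Auv A12(3) v1 unfolding V by auto
      next
        case 2
        then show ?thesis
          using A'(2) Auv A12(3) u2 unfolding V by auto
      next
        case 3
        then have "A f \<inter> verts H \<subseteq> f"
          using realizesD(4)[OF R 3(1)] by auto
        then show ?thesis
          using A'(3)[OF 3(1)] pA[OF 3] unfolding V by auto
      qed
    qed
    show "\<forall>e\<in>edges ?H. \<forall>f\<in>edges ?H. e \<noteq> f \<longrightarrow> A' e \<inter> A' f \<subseteq> verts ?H"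
    proof (intro ballI impI)
      fix f g assume fg: "f \<in> edges ?H" "g \<in> edges ?H" "f \<noteq> g"
      have old: "A f \<inter> A g \<subseteq> verts H" if "f \<in> edges H" "g \<in> edges H" "f \<noteq> g" for f g
        using realizesD(5)[OF R that] by auto
      have *: "A' {u, p} \<subseteq> A {u, v}" "A' {p, v} \<subseteq> A {u, v}" "A' {u, p} \<inter> A' {p, v} \<subseteq> {p}"
        unfolding A'(1,2) using A12(3,4) by auto
      have mem: "h \<in> {{u, p}, {p, v}} \<or> h \<in> edges H \<and> h \<noteq> {u, v}" if "h \<in> edges ?H" for h
        using that unfolding E by simp
      consider "f \<in> {{u, p}, {p, v}}" "g \<in> {{u, p}, {p, v}}"
        | "f \<in> {{u, p}, {p, v}}" "g \<in> edges H" "g \<noteq> {u, v}"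
        | "f \<in> edges H" "f \<noteq> {u, v}" "g \<in> {{u, p}, {p, v}}"
        | "f \<in> edges H" "g \<in> edges H"
        using mem[OF fg(1)] mem[OF fg(2)] by argo
      then show "A' f \<inter> A' g \<subseteq> verts ?H"
      proof cases
        case 1
        then show ?thesis
          using *(3) fg(3) unfolding V by auto
      next
        case 2
        then show ?thesis
          using *(1,2) old[OF uvE 2(2)] 2 unfolding V A'(3)[OF 2(2)] by auto
      next
        case 3
        then show ?thesis
          using *(1,2) old[OF uvE 3(1)] 3 unfolding V A'(3)[OF 3(1)] by auto
      next
        case 4
        then show ?thesis
          using old[OF 4 fg(3)] unfolding V A'(3)[OF 4(1)] A'(3)[OF 4(2)] by auto
      qed
    qed
  qed
  moreover have "linear_nsep (insert_after lt u p) ?H"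
    using linear_nsep_subdivide[OF G L uvE uv(2) False] .
  ultimately show ?thesis
    using V by blast
qed

lemma realizes_insert_points:
  assumes "realizes X H A" "linear_nsep lt H" "finite P" "P \<subseteq> topspace X"
  shows "\<exists>H' A' lt'. realizes X H' A' \<and> linear_nsep lt' H' \<and> P \<subseteq> verts H'"
  using assms(3,4)
proof (induction P rule: finite_induct)
  case empty
  then show ?case
    using assms by blast
next
  case (insert p P)
  then obtain H' A' lt' where "realizes X H' A'" "linear_nsep lt' H'" "P \<subseteq> verts H'"
    by auto
  then show ?case
    using realizes_insert_point[of X H' A' lt' p] insert.prems by (metis insert_mono insert_subset)
qed

lemma linear_nsep_three:
  assumes L: "linear_nsep lt H" and P: "card P = 3" "P \<subseteq> verts H"
  obtains x y z where "P = {x, y, z}" "x \<noteq> y" "y \<noteq> z" "x \<noteq> z" "nsep H x y z"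
proof -
  obtain a b c where abc: "P = {a, b, c}" "a \<noteq> b" "b \<noteq> c" "a \<noteq> c"
    using P(1) by (auto simp: card_3_iff)
  have V: "a \<in> verts H" "b \<in> verts H" "c \<in> verts H"
    using P(2) abc by auto
  have tot: "lt x y \<or> lt y x" if "x \<in> verts H" "y \<in> verts H" "x \<noteq> y" for x y
    using L that by (auto simp: linear_nsep_def)
  have N: "nsep H x y z" if "x \<in> verts H" "y \<in> verts H" "z \<in> verts H" "lt x y" "lt y z" for x y z
    using L that unfolding linear_nsep_def by blast
  have "nsep H a b c \<or> nsep H b a c \<or> nsep H a c b"
    using tot[OF V(1,2) abc(2)] tot[OF V(2,3) abc(3)] tot[OF V(1,3) abc(4)] N V nsep_commute by metis
  then show thesis
  proof (elim disjE)
    assume "nsep H a b c"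
    then show thesis using that[of a b c] abc by auto
  next
    assume "nsep H b a c"
    then show thesis using that[of b a c] abc by auto
  next
    assume "nsep H a c b"
    then show thesis using that[of a c b] abc by auto
  qed
qed

lemma realizes_linear_nsep_imp_arc:
  assumes R: "realizes X H A" and L: "linear_nsep lt H" and X: "Hausdorff_space X"
    and P: "P \<subseteq> topspace X" "card P = 3"
  shows "\<exists>B. is_arc_in X B \<and> P \<subseteq> B"
proof -
  have "finite P"
    using P(2) by (metis card.infinite zero_neq_numeral)
  from realizes_insert_points[OF R L this P(1)]
  obtain H' A' lt' where H': "realizes X H' A'" "linear_nsep lt' H'" "P \<subseteq> verts H'"
    by (elim exE conjE)
  obtain x y z where xyz: "P = {x, y, z}" "x \<noteq> y" "y \<noteq> z" "x \<noteq> z" "nsep H' x y z"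
    by (rule linear_nsep_three[OF H'(2) P(2) H'(3)])
  obtain Q where Q: "spath H' Q" "P \<subseteq> set Q"
    using nsep_imp_spath[OF xyz(5,2,3,4)] xyz(1) by auto
  have "card P \<le> length Q"
    using Q(2) card_mono[of "set Q" P] card_length[of Q] by simp
  then obtain B where "arc_betw X B (hd Q) (last Q)" "set Q \<subseteq> B"
    using realizes_spath[OF H'(1) Q(1)] P(2) by auto
  then show ?thesis
    using arc_betw_imp_is_arc_in[OF X] Q(2) by (meson order_trans)
qed

section \<open>The 1-complex as a realization\<close>

definition map_graph :: "('a \<Rightarrow> 'b) \<Rightarrow> 'a graph \<Rightarrow> 'b graph" where
  "map_graph f G = Graph (f ` verts G) ((`) f ` edges G)"

lemma linear_nsep_map_graph:
  assumes G: "simple_graph G" and L: "linear_nsep lt G" and f: "inj_on f (verts G)"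
  shows "linear_nsep (\<lambda>p q. lt (inv_into (verts G) f p) (inv_into (verts G) f q)) (map_graph f G)"
proof -
  have inv: "inv_into (verts G) f (f x) = x" if "x \<in> verts G" for x
    using f that by simp
  have irr: "\<not> lt x x" if "x \<in> verts G" for x
    using L that by (auto simp: linear_nsep_def)
  have tot: "lt x y \<or> lt y x" if "x \<in> verts G" "y \<in> verts G" "x \<noteq> y" for x y
    using L that by (auto simp: linear_nsep_def)
  have tr: "lt x z" and N: "nsep G x y z"
    if "x \<in> verts G" "y \<in> verts G" "z \<in> verts G" "lt x y" "lt y z" for x y z
    using L that unfolding linear_nsep_def by blast+
  have R: "(f a, f b) \<in> reach (map_graph f G) {d}"
    if "(a, b) \<in> reach G {c}" and d: "\<And>w. w \<in> verts G \<Longrightarrow> w \<noteq> c \<Longrightarrow> f w \<noteq> d" for a b c d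
    using that(1) unfolding reach_def[of G]
  proof (induction rule: rtrancl_induct)
    case (step a' b')
    then have ab: "{a', b'} \<in> edges G" "a' \<noteq> c" "b' \<noteq> c"
      by (auto simp: adj_remove_verts)
    then have "(f a', f b') \<in> reach (map_graph f G) {d}"
      using simple_graph_edge_verts[OF G ab(1)] d
      by (intro reach_edge) (auto simp: map_graph_def intro!: image_eqI[of _ _ "{a', b'}"])
    then show ?case
      using step reach_trans by metis
  qed simp
  have N': "nsep (map_graph f G) (f x) (f y) (f z)"
    if x: "x \<in> verts G" "y \<in> verts G" "z \<in> verts G" "lt x y" "lt y z" for x y z
    unfolding nsep_def
  proof (intro allI impI)
    fix d assume d: "d \<noteq> f y"
    have ne: "x \<noteq> y" "y \<noteq> z" "x \<noteq> z"
      using x irr tr by blast+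
    \<comment> \<open>If \<open>d\<close> is the image of a vertex, \<open>c\<close> is that vertex.
      Otherwise deleting \<open>d\<close> removes nothing, and any \<open>c \<noteq> y\<close>, such
      as \<open>x\<close>, gives a stronger statement.\<close>
    have "\<exists>c. c \<noteq> y \<and> (\<forall>w\<in>verts G. w \<noteq> c \<longrightarrow> f w \<noteq> d)"
    proof (cases "d \<in> f ` verts G")
      case True
      then show ?thesis
        using d f by (metis imageE inj_onD)
    next
      case False
      then show ?thesis
        using ne by blast
    qed
    then obtain c where c: "c \<noteq> y" "\<And>w. w \<in> verts G \<Longrightarrow> w \<noteq> c \<Longrightarrow> f w \<noteq> d"
      by blast
    have "c \<noteq> x \<and> (y, x) \<in> reach G {c} \<or> c \<noteq> z \<and> (y, z) \<in> reach G {c}"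
      using N[OF x] c(1) by (simp add: nsep_def)
    then show "d \<noteq> f x \<and> (f y, f x) \<in> reach (map_graph f G) {d} \<or> d \<noteq> f z \<and> (f y, f z) \<in> reach (map_graph f G) {d}"
      using R[OF _ c(2), of y x] R[OF _ c(2), of y z] c(2)[OF x(1)] c(2)[OF x(3)] by auto
  qed
  have V: "verts (map_graph f G) = f ` verts G"
    by (simp add: map_graph_def)
  show ?thesis
    unfolding linear_nsep_def V
  proof (intro conjI ballI impI; elim imageE)
    fix p x assume "p = f x" "x \<in> verts G"
    then show "\<not> lt (inv_into (verts G) f p) (inv_into (verts G) f p)"
      using inv irr by simp
  next
    fix p q x y assume "p \<noteq> q" "p = f x" "x \<in> verts G" "q = f y" "y \<in> verts G"
    then show "lt (inv_into (verts G) f p) (inv_into (verts G) f q) \<or>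
        lt (inv_into (verts G) f q) (inv_into (verts G) f p)"
      using inv tot[of x y] by auto
  next
    fix p q r x y z
    assume *: "lt (inv_into (verts G) f p) (inv_into (verts G) f q)"
        "lt (inv_into (verts G) f q) (inv_into (verts G) f r)"
        "p = f x" "x \<in> verts G" "q = f y" "y \<in> verts G" "r = f z" "z \<in> verts G"
    then have "lt x y" "lt y z"
      using inv by auto
    then show "lt (inv_into (verts G) f p) (inv_into (verts G) f r)" "nsep (map_graph f G) p q r"
      using * inv tr[of x y z] N'[of x y z] by auto
  qed
qed

text \<open>Edges of the renamed graph are pairs of points of \<open>|G|\<close>; as
  \<open>vpt G\<close> is injective, \<open>inv_into\<close> recovers the edge of \<open>G\<close>
  whose interval is meant.\<close>

lemma realizes_one_complex:
  assumes G: "simple_graph G"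
  shows "realizes (one_complex G) (map_graph (vpt G) G)
    (\<lambda>e. ept G (inv_into (edges G) ((`) (vpt G)) e) ` {0..1})"
proof -
  let ?H = "map_graph (vpt G) G" and ?inv = "inv_into (edges G) ((`) (vpt G))"
  have inj: "inj_on (vpt G) (verts G)"
    using vpt_inj by (auto simp: inj_on_def)
  have sub: "e \<subseteq> verts G" if "e \<in> edges G" for e
    using G that by (auto simp: simple_graph_def)
  have injE: "inj_on ((`) (vpt G)) (edges G)"
    using inj sub by (meson inj_onI inj_on_image_eq_iff)
  have inv: "?inv (vpt G ` e) = e" if "e \<in> edges G" for e
    using injE that by simp
  have E: "edges ?H = (`) (vpt G) ` edges G" and V: "verts ?H = vpt G ` verts G"
    by (auto simp: map_graph_def)
  \<comment> \<open>Splits the interval of an edge into its end vertices and its interior, which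
    meets no vertex and no other edge.\<close>
  have mem: "p \<in> ept G e ` {0..1} \<longleftrightarrow> p \<in> vpt G ` e \<or> (\<exists>t. 0 < t \<and> t < 1 \<and> p = ept G e t)"
    if e: "e \<in> edges G" for e p
  proof -
    have "{0..1::real} = insert 0 (insert 1 {0<..<1})"
      by auto
    then have "ept G e ` {0..1} = {vpt G (end0 e), vpt G (end1 e)} \<union> ept G e ` {0<..<1}"
      using ept_ends[OF G e] by simp
    moreover have "vpt G ` e = {vpt G (end0 e), vpt G (end1 e)}"
      using arg_cong[OF edge_eq_ends[OF G e], of "image (vpt G)"] by simp
    ultimately have "ept G e ` {0..1} = vpt G ` e \<union> ept G e ` {0<..<1}"
      by simp
    then show ?thesis
      by (simp only: Un_iff image_iff[of _ _ "{0<..<1}"] greaterThanLessThan_iff Bex_def conj_assoc)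
  qed
  have arc: "arc_betw (one_complex G) (ept G e ` {0..1}) (vpt G (end0 e)) (vpt G (end1 e))" if e: "e \<in> edges G" for e
  proof -
    have "s = t" if st: "s \<in> {0..1}" "t \<in> {0..1}" "ept G e s = ept G e t" for s t
    proof -
      consider "0 < s" "s < 1" | "0 < t" "t < 1" | "s \<in> {0, 1}" "t \<in> {0, 1}"
        using st by fastforce
      then show ?thesis
      proof cases
        case 1
        then show ?thesis
          using ept_inj[OF G e e 1, of t] st by auto
      next
        case 2
        then show ?thesis
          using ept_inj[OF G e e 2, of s] st by auto
      next
        case 3
        then show ?thesis
          using ept_ends[OF G e] st end_verts[OF G e] vpt_inj[of "end0 e" G "end1 e"] by auto
      qed
    qed
    then have "inj_on (ept G e) {0..1}"
      by (auto simp: inj_on_def)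
    then show ?thesis
      using continuous_map_ept[OF e] ept_ends[OF G e] unfolding arc_betw_def by blast
  qed
  show ?thesis
    unfolding realizes_def
  proof (intro conjI)
    show "simple_graph ?H"
      unfolding simple_graph_def E V
    proof
      fix e assume "e \<in> (`) (vpt G) ` edges G"
      then obtain f where f: "f \<in> edges G" "e = vpt G ` f"
        by blast
      then show "e \<subseteq> vpt G ` verts G \<and> card e = 2"
        using G sub[OF f(1)] card_image[OF inj_on_subset[OF inj sub[OF f(1)]]]
        by (auto simp: simple_graph_def)
    qed
    show "topspace (one_complex G) = verts ?H \<union> (\<Union>e\<in>edges ?H. ept G (?inv e) ` {0..1})"
      unfolding topspace_one_complex E V using inv by auto
    show "\<forall>u v. {u, v} \<in> edges ?H \<longrightarrow> arc_betw (one_complex G) (ept G (?inv {u, v}) ` {0..1}) u v"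
    proof (intro allI impI)
      fix u v assume "{u, v} \<in> edges ?H"
      then obtain e where e: "e \<in> edges G" "{u, v} = vpt G ` e"
        unfolding E by blast
      then have "{u, v} = {vpt G (end0 e), vpt G (end1 e)}"
        using arg_cong[OF edge_eq_ends[OF G e(1)], of "image (vpt G)"] by simp
      then have "u = vpt G (end0 e) \<and> v = vpt G (end1 e) \<or> u = vpt G (end1 e) \<and> v = vpt G (end0 e)"
        by (simp add: doubleton_eq_iff)
      then have "arc_betw (one_complex G) (ept G e ` {0..1}) u v"
        using arc[OF e(1)] arc_betw_rev[OF arc[OF e(1)]] by auto
      then show "arc_betw (one_complex G) (ept G (?inv {u, v}) ` {0..1}) u v"
        unfolding e(2) inv[OF e(1)] .
    qed
    show "\<forall>e\<in>edges ?H. ept G (?inv e) ` {0..1} \<inter> verts ?H \<subseteq> e"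
    proof
      fix e' assume "e' \<in> edges ?H"
      then obtain e where e: "e \<in> edges G" "e' = vpt G ` e"
        unfolding E by blast
      have "ept G e ` {0..1} \<inter> verts ?H \<subseteq> e'"
      proof
        fix q assume q: "q \<in> ept G e ` {0..1} \<inter> verts ?H"
        then obtain v where "v \<in> verts G" "q = vpt G v"
          unfolding V by auto
        then have "\<not> (\<exists>t. 0 < t \<and> t < 1 \<and> q = ept G e t)"
          using ept_not_vpt[OF e(1)] by auto
        then show "q \<in> e'"
          using mem[OF e(1), of q] q e(2) by auto
      qed
      then show "ept G (?inv e') ` {0..1} \<inter> verts ?H \<subseteq> e'"
        using inv e by simp
    qed
    show "\<forall>e\<in>edges ?H. \<forall>f\<in>edges ?H. e \<noteq> f \<longrightarrow>
        ept G (?inv e) ` {0..1} \<inter> ept G (?inv f) ` {0..1} \<subseteq> verts ?H"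
    proof (intro ballI impI)
      fix e' f' assume "e' \<in> edges ?H" "f' \<in> edges ?H" "e' \<noteq> f'"
      then obtain e f where e: "e \<in> edges G" "e' = vpt G ` e" and f: "f \<in> edges G" "f' = vpt G ` f" and ne: "e \<noteq> f"
        unfolding E by blast
      have "ept G e ` {0..1} \<inter> ept G f ` {0..1} \<subseteq> verts ?H"
      proof
        fix p assume p: "p \<in> ept G e ` {0..1} \<inter> ept G f ` {0..1}"
        show "p \<in> verts ?H"
        proof (rule ccontr)
          assume "p \<notin> verts ?H"
          then have "p \<notin> vpt G ` e"
            using sub[OF e(1)] unfolding V by auto
          then obtain t where t: "0 < t" "t < 1" "p = ept G e t"
            using mem[OF e(1), of p] p by auto
          obtain s where "s \<in> {0..1}" "p = ept G f s"
            using p by auto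
          then show False
            using ept_inj[OF G e(1) f(1) t(1,2), of s] t ne by auto
        qed
      qed
      then show "ept G (?inv e') ` {0..1} \<inter> ept G (?inv f') ` {0..1} \<subseteq> verts ?H"
        using inv e f by simp
    qed
  qed
qed

text \<open>Fewer than three points are filled up to exactly three; an edge supplies infinitely many
  candidates.\<close>

lemma linear_nsep_imp_n_ac_3:
  assumes G: "simple_graph G" and e: "edges G \<noteq> {}" and L: "linear_nsep lt G"
  shows "n_ac 3 G"
  unfolding n_ac_def
proof (intro allI impI, elim conjE)
  let ?X = "one_complex G"
  fix P assume P: "P \<subseteq> topspace ?X" "finite P" "card P \<le> 3"
  obtain e where e: "e \<in> edges G"
    using e by blast
  have "inj_on (ept G e) {0<..<1}"
    using ept_inj[OF G e e] by (auto simp: inj_on_def)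
  then have "infinite (ept G e ` {0<..<1})"
    by (simp add: finite_image_iff infinite_Ioo)
  moreover have "ept G e ` {0<..<1} \<subseteq> topspace ?X"
    using e unfolding topspace_one_complex by force
  ultimately have "infinite (topspace ?X - P)"
    using P(2) by (meson Diff_infinite_finite infinite_super)
  then obtain Q where Q: "finite Q" "card Q = 3 - card P" "Q \<subseteq> topspace ?X - P"
    using infinite_arbitrarily_large[of "topspace ?X - P" "3 - card P"] by auto
  then have card: "card (P \<union> Q) = 3"
    using P by (subst card_Un_disjoint) auto
  have inj: "inj_on (vpt G) (verts G)"
    using vpt_inj by (auto simp: inj_on_def)
  have "P \<union> Q \<subseteq> topspace ?X"
    using P Q by auto
  from realizes_linear_nsep_imp_arc[OF realizes_one_complex[OF G] linear_nsep_map_graph[OF G L inj]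
      Hausdorff_one_complex[OF G] this card]
  show "\<exists>A. is_arc_in ?X A \<and> P \<subseteq> A"
    by auto
qed

section \<open>Arcs through three vertices\<close>

text \<open>The pieces of the arc before and after \<open>y\<close> meet only in \<open>y\<close>,
  so a vertex \<open>c \<noteq> y\<close> misses one of them. That piece is connected and therefore
  joins \<open>y\<close> to its other end in \<open>G - c\<close>.\<close>

lemma arc_imp_nsep:
  assumes G: "simple_graph G" and g: "continuous_map (top_of_set {0..1::real}) (one_complex G) g" "inj_on g {0..1}"
    and rst: "0 \<le> r" "r < s" "s < t" "t \<le> 1"
    and x: "x \<in> verts G" "g r = vpt G x" and y: "y \<in> verts G" "g s = vpt G y" and z: "z \<in> verts G" "g t = vpt G z"
  shows "nsep G x y z"
  unfolding nsep_def
proof (intro allI impI)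
  fix c assume c: "c \<noteq> y"
  have con: "connectedin (one_complex G) (g ` {a..b})" if "0 \<le> a" "b \<le> 1" for a b
    using that by (intro connectedin_continuous_map_image[OF g(1)]) (auto simp: connectedin_subtopology)
  have "\<not> (c \<in> verts G \<and> vpt G c \<in> g ` {r..s} \<and> vpt G c \<in> g ` {s..t})"
  proof
    assume *: "c \<in> verts G \<and> vpt G c \<in> g ` {r..s} \<and> vpt G c \<in> g ` {s..t}"
    then obtain a b where ab: "a \<in> {r..s}" "b \<in> {s..t}" "vpt G c = g a" "vpt G c = g b"
      by auto
    then have "a = b"
      using rst by (intro inj_onD[OF g(2)]) auto
    then have "a = s"
      using ab by auto
    then have "vpt G c = vpt G y"
      using ab(3) y(2) by simp
    then show False
      using vpt_inj[of c G y] * y(1) c by simp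
  qed
  then consider "g ` {r..s} \<inter> vpt G ` ({c} \<inter> verts G) = {}" | "g ` {s..t} \<inter> vpt G ` ({c} \<inter> verts G) = {}"
    by (cases "c \<in> verts G") auto
  then show "c \<noteq> x \<and> (y, x) \<in> reach G {c} \<or> c \<noteq> z \<and> (y, z) \<in> reach G {c}"
  proof cases
    case 1
    have in1: "vpt G y \<in> g ` {r..s}" "vpt G x \<in> g ` {r..s}"
      using rst x(2) y(2) by (auto intro: image_eqI[of _ g s] image_eqI[of _ g r])
    then have "(y, x) \<in> reach G {c}"
      using rst 1 by (intro connectedin_imp_reach[OF G con[of r s] y(1) _ x(1)]) auto
    moreover have "c \<noteq> x"
      using in1(2) 1 x(1) by auto
    ultimately show ?thesis
      by simp
  next
    case 2
    have in1: "vpt G y \<in> g ` {s..t}" "vpt G z \<in> g ` {s..t}"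
      using rst z(2) y(2) by (auto intro: image_eqI[of _ g s] image_eqI[of _ g t])
    then have "(y, z) \<in> reach G {c}"
      using rst 2 by (intro connectedin_imp_reach[OF G con[of s t] y(1) _ z(1)]) auto
    moreover have "c \<noteq> z"
      using in1(2) 2 z(1) by auto
    ultimately show ?thesis
      by simp
  qed
qed

lemma vpt_in_topspace: "v \<in> verts G \<Longrightarrow> vpt G v \<in> topspace (one_complex G)"
  by (simp add: topspace_one_complex)

lemma n_ac_imp_reach:
  assumes G: "simple_graph G" and n: "n_ac k G" "2 \<le> k" and uv: "u \<in> verts G" "v \<in> verts G"
  shows "(u, v) \<in> reach G {}"
proof -
  have "card {vpt G u, vpt G v} \<le> k"
    using n(2) card_insert_le_m1[of 2 "{vpt G v}" "vpt G u"] by simp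
  then obtain A where A: "is_arc_in (one_complex G) A" "{vpt G u, vpt G v} \<subseteq> A"
    using n(1) vpt_in_topspace[OF uv(1)] vpt_in_topspace[OF uv(2)] unfolding n_ac_def
    by (metis empty_subsetI finite.emptyI finite.insertI insert_subset)
  obtain g where g: "continuous_map (top_of_set {0..1::real}) (one_complex G) g" "g ` {0..1} = A"
    by (rule is_arc_in_param[OF A(1)])
  have "connectedin (one_complex G) (g ` {0..1})"
    by (intro connectedin_continuous_map_image[OF g(1)]) (auto simp: connectedin_subtopology)
  then show ?thesis
    using A(2) g(2) by (intro connectedin_imp_reach[OF G _ uv(1) _ uv(2)]) auto
qed

text \<open>The vertex whose parameter on the arc is the middle one is a middle; reversing the arc
  pairs up the six orders.\<close>

lemma n_ac_3_imp_nsep: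
  assumes G: "simple_graph G" and n: "n_ac 3 G"
    and V: "x \<in> verts G" "y \<in> verts G" "z \<in> verts G" and ne: "x \<noteq> y" "y \<noteq> z" "x \<noteq> z"
  shows "nsep G x y z \<or> nsep G y x z \<or> nsep G x z y"
proof -
  have "card {vpt G x, vpt G y, vpt G z} \<le> 3"
    by (simp add: card_insert_if)
  then obtain A where A: "is_arc_in (one_complex G) A" "{vpt G x, vpt G y, vpt G z} \<subseteq> A"
    using n[unfolded n_ac_def, rule_format, of "{vpt G x, vpt G y, vpt G z}"]
      vpt_in_topspace[OF V(1)] vpt_in_topspace[OF V(2)] vpt_in_topspace[OF V(3)] by auto
  obtain g where g: "continuous_map (top_of_set {0..1::real}) (one_complex G) g" "inj_on g {0..1}" "g ` {0..1} = A"
    by (rule is_arc_in_param[OF A(1)])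
  have "vpt G x \<in> g ` {0..1}" "vpt G y \<in> g ` {0..1}" "vpt G z \<in> g ` {0..1}"
    using A(2) g(3) by auto
  then obtain r s t where r: "0 \<le> r" "r \<le> 1" "g r = vpt G x" and s: "0 \<le> s" "s \<le> 1" "g s = vpt G y"
    and t: "0 \<le> t" "t \<le> 1" "g t = vpt G z"
    by auto
  have ne': "r \<noteq> s" "s \<noteq> t" "r \<noteq> t"
    using vpt_inj[OF V(1,2)] vpt_inj[OF V(2,3)] vpt_inj[OF V(1,3)] ne r s t by auto
  note N = arc_imp_nsep[OF G g(1,2)]
  consider "r < s" "s < t" | "t < s" "s < r" | "s < r" "r < t" | "t < r" "r < s" | "r < t" "t < s" | "s < t" "t < r"
    using ne' by linarith
  then show ?thesis
  proof cases
    case 1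
    then show ?thesis using N[of r s t x y z] V r s t by simp
  next
    case 2
    then show ?thesis using N[of t s r z y x] V r s t nsep_commute[of G z y x] by simp
  next
    case 3
    then show ?thesis using N[of s r t y x z] V r s t by simp
  next
    case 4
    then show ?thesis using N[of t r s z x y] V r s t nsep_commute[of G z x y] by simp
  next
    case 5
    then show ?thesis using N[of r t s x z y] V r s t by simp
  next
    case 6
    then show ?thesis using N[of s t r y z x] V r s t nsep_commute[of G y z x] by simp
  qed
qed

section \<open>Chains\<close>

text \<open>Vertices are ordered by the position \<open>2 * i\<close> for the vertex shared by the links \<open>i - 1\<close>
  and \<open>i\<close>, and \<open>2 * i + 1\<close> for the other vertices of link \<open>i\<close>; ties are broken by a well-order.\<close>

lemma chain_imp_linear_nsep:
  fixes G :: "'a graph"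
  assumes G: "simple_graph G" and C: "chain_of_links G I L" and K: "\<And>i. i \<in> I \<Longrightarrow> k_connected 2 (L i)"
  shows "\<exists>lt. linear_nsep lt G"
proof -
  define B where "B i = verts (L i)" for i
  have C1: "\<forall>i\<in>I. \<forall>k\<in>I. {i..k} \<subseteq> I" and C2: "\<forall>i\<in>I. subgraph (L i) G" and C3: "verts G = (\<Union>i\<in>I. verts (L i))"
    and C4: "\<forall>i\<in>I. \<forall>j\<in>I. i + 1 < j \<longrightarrow> verts (L i) \<inter> verts (L j) = {}"
    and C5: "\<forall>i. i \<in> I \<and> i + 1 \<in> I \<longrightarrow> (\<exists>v. verts (L i) \<inter> verts (L (i + 1)) = {v})"
    using C unfolding chain_of_links_def by - (elim conjE, assumption)+
  have I: "k \<in> I" if "i \<in> I" "j \<in> I" "i \<le> k" "k \<le> j" for i j k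
  proof -
    have "{i..j} \<subseteq> I"
      using C1 that(1,2) by simp
    then show ?thesis
      using that(3,4) by auto
  qed
  \<comment> \<open>Inseparability in \<open>G\<close> is all that is used of the 2-connectedness of
    the links.\<close>
  have ins: "insep G (B i)" if "i \<in> I" for i
    using C2 K[OF that] that unfolding B_def by (auto intro: k_connected_2_imp_insep)
  have V: "verts G = (\<Union>i\<in>I. B i)"
    using C3 unfolding B_def .
  have far: "i = j \<or> j = i + 1" if "i \<in> I" "j \<in> I" "w \<in> B i" "w \<in> B j" "i \<le> j" for i j w
  proof (rule ccontr)
    assume "\<not> ?thesis"
    then have "i + 1 < j"
      using that(5) by linarith
    then have "B i \<inter> B j = {}"
      using C4 that(1,2) unfolding B_def by simp
    then show False
      using that(3,4) by auto
  qed
  have "\<exists>v. i \<in> I \<longrightarrow> i + 1 \<in> I \<longrightarrow> B i \<inter> B (i + 1) = {v}" for i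
    using C5 unfolding B_def by auto
  then obtain c where c: "B i \<inter> B (i + 1) = {c i}" if "i \<in> I" "i + 1 \<in> I" for i
    by metis
  have cI: "c i \<in> B i" "c i \<in> B (i + 1)" if "i \<in> I" "i + 1 \<in> I" for i
    using c[OF that] by auto
  \<comment> \<open>Position of \<open>v\<close> as seen from link \<open>i\<close>. A vertex shared
    with link \<open>i + 1\<close> gets \<open>2 * i + 2\<close> here and \<open>2 * (i + 1)\<close>
    there, so the links agree (\<open>pos_eq\<close>); no vertex lies in both links
    \<open>i - 1\<close> and \<open>i + 1\<close>.\<close>
  define pos where "pos i v = (if i - 1 \<in> I \<and> v \<in> B (i - 1) then 2 * i else if i + 1 \<in> I \<and> v \<in> B (i + 1) then 2 * i + 2 else 2 * i + 1)"
    for i :: int and v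
  have pos_eq: "pos i v = pos j v" if "i \<in> I" "j \<in> I" "v \<in> B i" "v \<in> B j" for i j v
  proof -
    have *: "pos i v = pos j v" if "i \<in> I" "j \<in> I" "v \<in> B i" "v \<in> B j" "i \<le> j" for i j
      using far[OF that] that far[of "i - 1" j v] by (auto simp: pos_def)
    show ?thesis
      using *[of i j] *[of j i] that by linarith
  qed
  define f where "f v = pos (SOME i. i \<in> I \<and> v \<in> B i) v" for v
  have f: "f v = pos i v" if "i \<in> I" "v \<in> B i" for i v
    unfolding f_def using that by (intro pos_eq) (metis (mono_tags, lifting) someI_ex)+
  have f_range: "f v \<in> {2 * i, 2 * i + 1, 2 * i + 2}" if "i \<in> I" "v \<in> B i" for i v
    using f[OF that] by (auto simp: pos_def)
  \<comment> \<open>Each even position is held by one shared vertex only, so ties occur only at the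
    odd position of a single link.\<close>
  have f_low: "i - 1 \<in> I \<and> v = c (i - 1)" if "i \<in> I" "v \<in> B i" "f v = 2 * i" for i v
    using f[OF that(1,2)] that c[of "i - 1"] by (auto simp: pos_def split: if_splits)
  have f_high: "i + 1 \<in> I \<and> v = c i" if "i \<in> I" "v \<in> B i" "f v = 2 * i + 2" for i v
    using f[OF that(1,2)] that c[of i] by (auto simp: pos_def split: if_splits)
  have f_c: "f (c i) = 2 * i + 2" if "i \<in> I" "i + 1 \<in> I" for i
    using f[of "i + 1" "c i"] that cI[OF that] by (simp add: pos_def)
  \<comment> \<open>Walk through the shared vertices \<open>c k\<close>; each link on the way is
    inseparable and does not contain \<open>d\<close>.\<close>
  have seg: "(u, v) \<in> reach G {d}"
    if "i \<in> I" "j \<in> I" "i \<le> j" "u \<in> B i" "v \<in> B j" and d: "\<And>k. i \<le> k \<Longrightarrow> k \<le> j \<Longrightarrow> d \<notin> B k" for i j u v d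
    using that(3,2,5) d
  proof (induction j arbitrary: v rule: int_ge_induct)
    case base
    then show ?case
      using insepD[OF ins[OF that(1)] that(4), of v d] that(4) by auto
  next
    case (step j)
    have j: "j \<in> I"
      using I[OF that(1) step.prems(1)] step.hyps by simp
    have "(u, c j) \<in> reach G {d}"
      using step.IH[OF j cI(1)[OF j step.prems(1)]] step.prems(3) by simp
    moreover have "(c j, v) \<in> reach G {d}"
      using insepD[OF ins[OF step.prems(1)] cI(2)[OF j step.prems(1)] step.prems(2), of d]
        cI(2)[OF j step.prems(1)] step.prems(2) step.prems(3)[of "j + 1"] step.hyps by auto
    ultimately show ?case
      by (rule reach_trans)
  qed
  \<comment> \<open>Leave the link of \<open>y\<close> through \<open>a\<close> towards
    \<open>x\<close> or through \<open>b\<close> towards \<open>z\<close>. If \<open>d\<close> is in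
    this link, it differs from \<open>a\<close> or from \<open>b\<close>; otherwise it cannot lie on
    both sides. Weak inequalities suffice, so the way ties are broken is irrelevant.\<close>
  have N: "nsep G x y z" if xyz: "x \<in> verts G" "y \<in> verts G" "z \<in> verts G" "f x \<le> f y" "f y \<le> f z"
    "x \<noteq> y" "y \<noteq> z" "x \<noteq> z" for x y z
    unfolding nsep_def
  proof (intro allI impI)
    fix d assume d: "d \<noteq> y"
    obtain i where i: "i \<in> I" "y \<in> B i"
      using xyz V by auto
    obtain jx where jx: "jx \<in> I" "x \<in> B jx"
      using xyz V by auto
    obtain jz where jz: "jz \<in> I" "z \<in> B jz"
      using xyz V by auto
    text \<open>\<open>a\<close> is the first vertex of link \<open>i\<close> on the way from \<open>y\<close> to \<open>x\<close>.\<close>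
    have left: "\<exists>a. a \<in> B i \<and> f x \<le> f a \<and> (f a \<le> f y) \<and> (a = x \<or> f a = 2 * i) \<and> (d \<notin> B i \<longrightarrow> (\<forall>k. k < i \<longrightarrow> k \<in> I \<longrightarrow> d \<notin> B k) \<longrightarrow> d \<noteq> x \<and> (a, x) \<in> reach G {d})
      \<and> (d \<in> B i \<longrightarrow> d \<noteq> a \<longrightarrow> d \<noteq> x \<and> (a, x) \<in> reach G {d})"
    proof (cases "x \<in> B i")
      case True
      then show ?thesis
        using xyz by (intro exI[of _ x]) auto
    next
      case False
      \<comment> \<open>If the link of \<open>x\<close> came later, \<open>x\<close> and
        \<open>y\<close> would both hold the even position \<open>2 * i + 2\<close> and so
        coincide.\<close>
      have "jx < i"
      proof (rule ccontr)
        assume "\<not> jx < i"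
        then have "jx \<ge> i + 1"
          using False jx by (cases "jx = i") auto
        then have "f x \<ge> 2 * i + 2"
          using f_range[OF jx] by auto
        then have "f x = 2 * i + 2" "f y = 2 * i + 2"
          using xyz(4) f_range[OF i] by auto
        then have "jx = i + 1"
          using f_range[OF jx] \<open>jx \<ge> i + 1\<close> by auto
        then show False
          using f_low[of jx x] f_high[OF i] jx \<open>f x = 2 * i + 2\<close> \<open>f y = 2 * i + 2\<close> xyz(6) by auto
      qed
      then have i1: "i - 1 \<in> I"
        using I[OF jx(1) i(1), of "i - 1"] by simp
      let ?a = "c (i - 1)"
      have a: "?a \<in> B i" "?a \<in> B (i - 1)" "f ?a = 2 * i"
        using cI[of "i - 1"] f_c[of "i - 1"] i1 i by auto
      have fx: "f x \<le> 2 * i"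
        using f_range[OF jx] \<open>jx < i\<close> by auto
      have path: "d \<noteq> x \<and> (?a, x) \<in> reach G {d}" if "\<forall>k. k < i \<longrightarrow> k \<in> I \<longrightarrow> d \<notin> B k"
      proof -
        have "(x, ?a) \<in> reach G {d}"
          using that \<open>jx < i\<close> I[OF jx(1) i1] by (intro seg[OF jx(1) i1 _ jx(2) a(2)]) auto
        then show ?thesis
          using that jx \<open>jx < i\<close> reach_sym by auto
      qed
      have "\<forall>k. k < i \<longrightarrow> k \<in> I \<longrightarrow> d \<notin> B k" if "d \<in> B i" "d \<noteq> ?a"
      proof (intro allI impI notI)
        fix k assume k: "k < i" "k \<in> I" "d \<in> B k"
        then have "i = k + 1"
          using far[OF k(2) i(1) k(3) that(1)] by auto
        then show False
          using c[of k] k i that by auto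
      qed
      then show ?thesis
        using a fx path f_range[OF i] by (intro exI[of _ ?a]) auto
    qed
    \<comment> \<open>The mirror image of \<open>left\<close>, with the gate \<open>c i\<close>
      instead of \<open>c (i - 1)\<close>.\<close>
    have right: "\<exists>a. a \<in> B i \<and> f y \<le> f a \<and> f a \<le> f z \<and> (a = z \<or> f a = 2 * i + 2) \<and> (d \<notin> B i \<longrightarrow> (\<forall>k. i < k \<longrightarrow> k \<in> I \<longrightarrow> d \<notin> B k) \<longrightarrow> d \<noteq> z \<and> (a, z) \<in> reach G {d})
      \<and> (d \<in> B i \<longrightarrow> d \<noteq> a \<longrightarrow> d \<noteq> z \<and> (a, z) \<in> reach G {d})"
    proof (cases "z \<in> B i")
      case True
      then show ?thesis
        using xyz by (intro exI[of _ z]) auto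
    next
      case False
      have "i < jz"
      proof (rule ccontr)
        assume "\<not> i < jz"
        then have "jz \<le> i - 1"
          using False jz by (cases "jz = i") auto
        then have "f z \<le> 2 * i"
          using f_range[OF jz] by auto
        then have "f z = 2 * i" "f y = 2 * i"
          using xyz(5) f_range[OF i] by auto
        then have "jz = i - 1"
          using f_range[OF jz] \<open>jz \<le> i - 1\<close> by auto
        then show False
          using f_high[of jz z] f_low[OF i] jz \<open>f z = 2 * i\<close> \<open>f y = 2 * i\<close> xyz(7) by auto
      qed
      then have i1: "i + 1 \<in> I"
        using I[OF i(1) jz(1), of "i + 1"] by simp
      let ?a = "c i"
      have a: "?a \<in> B i" "?a \<in> B (i + 1)" "f ?a = 2 * i + 2"
        using cI[of i] f_c[of i] i1 i by auto
      have fx: "f z \<ge> 2 * i + 2"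
        using f_range[OF jz] \<open>i < jz\<close> by auto
      have path: "d \<noteq> z \<and> (?a, z) \<in> reach G {d}" if "\<forall>k. i < k \<longrightarrow> k \<in> I \<longrightarrow> d \<notin> B k"
      proof -
        have "(?a, z) \<in> reach G {d}"
          using that \<open>i < jz\<close> I[OF i1 jz(1)] by (intro seg[OF i1 jz(1) _ a(2) jz(2)]) auto
        then show ?thesis
          using that jz \<open>i < jz\<close> by auto
      qed
      have "\<forall>k. i < k \<longrightarrow> k \<in> I \<longrightarrow> d \<notin> B k" if "d \<in> B i" "d \<noteq> ?a"
      proof (intro allI impI notI)
        fix k assume k: "i < k" "k \<in> I" "d \<in> B k"
        then have "k = i + 1"
          using far[OF i(1) k(2) that(1) k(3)] by auto
        then show False
          using c[of i] k i that by auto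
      qed
      then show ?thesis
        using a fx path f_range[OF i] by (intro exI[of _ ?a]) auto
    qed
    from left obtain a where a: "a \<in> B i" "f x \<le> f a" "f a \<le> f y" "a = x \<or> f a = 2 * i"
      "d \<notin> B i \<longrightarrow> (\<forall>k. k < i \<longrightarrow> k \<in> I \<longrightarrow> d \<notin> B k) \<longrightarrow> d \<noteq> x \<and> (a, x) \<in> reach G {d}"
      "d \<in> B i \<longrightarrow> d \<noteq> a \<longrightarrow> d \<noteq> x \<and> (a, x) \<in> reach G {d}"
      by (elim exE conjE)
    from right obtain b where b: "b \<in> B i" "f y \<le> f b" "f b \<le> f z" "b = z \<or> f b = 2 * i + 2"
      "d \<notin> B i \<longrightarrow> (\<forall>k. i < k \<longrightarrow> k \<in> I \<longrightarrow> d \<notin> B k) \<longrightarrow> d \<noteq> z \<and> (b, z) \<in> reach G {d}"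
      "d \<in> B i \<longrightarrow> d \<noteq> b \<longrightarrow> d \<noteq> z \<and> (b, z) \<in> reach G {d}"
      by (elim exE conjE)
    have ins_y: "(y, w) \<in> reach G {d}" if "w \<in> B i" "w \<noteq> d" for w
      using insepD[OF ins[OF i(1)] i(2) that(1)] d that(2) by auto
    show "d \<noteq> x \<and> (y, x) \<in> reach G {d} \<or> d \<noteq> z \<and> (y, z) \<in> reach G {d}"
    proof (cases "d \<in> B i")
      case True
      \<comment> \<open>If \<open>a = b\<close>, its position equals that of \<open>y\<close>.
        Either \<open>a = x\<close> and \<open>b = z\<close>, against \<open>x \<noteq> z\<close>,
        or the position is even; then \<open>y = a\<close>, which is also one of \<open>x\<close>
        and \<open>z\<close>.\<close>
      have "a \<noteq> b"
      proof
        assume "a = b"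
        then have eq: "f a = f y" "f b = f y"
          using a(2,3) b(2,3) by auto
        show False
        proof (cases "a = x \<and> b = z")
          case True
          then show False
            using \<open>a = b\<close> xyz(8) by auto
        next
          case False
          then consider "f y = 2 * i" | "f y = 2 * i + 2"
            using a(4) b(4) eq by auto
          then show False
          proof cases
            case 1
            then have "y = a"
              using f_low[OF i] f_low[OF i(1) a(1)] eq(1) by metis
            moreover have "b = z"
              using b(4) eq(2) 1 by linarith
            ultimately show False
              using \<open>a = b\<close> xyz(7) by metis
          next
            case 2
            then have "y = a"
              using f_high[OF i] f_high[OF i(1) a(1)] eq(1) by metis
            moreover have "a = x"
              using a(4) eq(1) 2 by linarith
            ultimately show False
              using xyz(6) by metis
          qed
        qed
      qed
      then consider "d \<noteq> a" | "d \<noteq> b"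
        by auto
      then show ?thesis
      proof cases
        case 1
        then show ?thesis
          using a(6)[rule_format, OF True 1] ins_y[OF a(1)] reach_trans[of y a G "{d}" x] by auto
      next
        case 2
        then show ?thesis
          using b(6)[rule_format, OF True 2] ins_y[OF b(1)] reach_trans[of y b G "{d}" z] by auto
      qed
    next
      case False
      \<comment> \<open>Links on different sides of link \<open>i\<close> are not consecutive and
        hence disjoint.\<close>
      have "(\<forall>k. k < i \<longrightarrow> k \<in> I \<longrightarrow> d \<notin> B k) \<or> (\<forall>k. i < k \<longrightarrow> k \<in> I \<longrightarrow> d \<notin> B k)"
      proof (rule ccontr)
        assume "\<not> ?thesis"
        then obtain k l where "k < i" "k \<in> I" "d \<in> B k" "i < l" "l \<in> I" "d \<in> B l"
          by auto
        then show False
          using far[of k l d] by auto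
      qed
      then show ?thesis
      proof
        assume *: "\<forall>k. k < i \<longrightarrow> k \<in> I \<longrightarrow> d \<notin> B k"
        have "a \<noteq> d"
          using a(1) False by auto
        then show ?thesis
          using a(5)[THEN mp, OF False, THEN mp, OF *] ins_y[OF a(1)] reach_trans[of y a G "{d}" x] by auto
      next
        assume *: "\<forall>k. i < k \<longrightarrow> k \<in> I \<longrightarrow> d \<notin> B k"
        have "b \<noteq> d"
          using b(1) False by auto
        then show ?thesis
          using b(5)[THEN mp, OF False, THEN mp, OF *] ins_y[OF b(1)] reach_trans[of y b G "{d}" z] by auto
      qed
    qed
  qed
  obtain r where r: "well_order_on (UNIV :: 'a set) r"
    using well_order_on by blast
  define lt where "lt x y \<longleftrightarrow> f x < f y \<or> f x = f y \<and> x \<noteq> y \<and> (x, y) \<in> r" for x y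
  have lin: "trans r" "antisym r" "total_on UNIV r"
    using r by (auto simp: well_order_on_def linear_order_on_def partial_order_on_def preorder_on_def)
  have "linear_nsep lt G"
    unfolding linear_nsep_def
  proof (intro conjI ballI impI)
    fix x show "\<not> lt x x"
      by (simp add: lt_def)
  next
    fix x y :: 'a assume "x \<noteq> y"
    then have "(x, y) \<in> r \<or> (y, x) \<in> r"
      using lin(3) by (auto simp: total_on_def)
    then show "lt x y \<or> lt y x"
      using \<open>x \<noteq> y\<close> by (auto simp: lt_def)
  next
    fix x y z assume *: "x \<in> verts G" "y \<in> verts G" "z \<in> verts G" "lt x y" "lt y z"
    have le: "f x \<le> f y" "f y \<le> f z" "x \<noteq> y" "y \<noteq> z"
      using * by (auto simp: lt_def)
    have "x \<noteq> z"
      using * lin(2) unfolding lt_def by (auto dest: antisymD)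
    then show "lt x z"
      using * lin(1) unfolding lt_def by (auto dest: transD)
    show "nsep G x y z"
      using N[OF *(1-3) le \<open>x \<noteq> z\<close>] .
  qed
  then show ?thesis
    by blast
qed

section \<open>The block graph\<close>

lemma infinite_or_card_ge_3_iff:
  "infinite S \<or> 3 \<le> card S \<longleftrightarrow> (\<exists>a\<in>S. \<exists>b\<in>S. \<exists>c\<in>S. a \<noteq> b \<and> b \<noteq> c \<and> a \<noteq> c)"
proof
  assume "infinite S \<or> 3 \<le> card S"
  then obtain T where T: "T \<subseteq> S" "card T = 3"
    using infinite_arbitrarily_large[of S 3] obtain_subset_with_card_n[of 3 S] by metis
  then obtain a b c where "T = {a, b, c}" "a \<noteq> b" "b \<noteq> c" "a \<noteq> c"
    by (auto simp: card_3_iff)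
  then show "\<exists>a\<in>S. \<exists>b\<in>S. \<exists>c\<in>S. a \<noteq> b \<and> b \<noteq> c \<and> a \<noteq> c"
    using T(1) by auto
next
  assume "\<exists>a\<in>S. \<exists>b\<in>S. \<exists>c\<in>S. a \<noteq> b \<and> b \<noteq> c \<and> a \<noteq> c"
  then obtain a b c where *: "{a, b, c} \<subseteq> S" "card {a, b, c} = 3"
    by (auto simp: card_insert_if)
  then show "infinite S \<or> 3 \<le> card S"
    using card_mono[OF _ *(1)] by auto
qed

lemma degree_ge_3_iff:
  "3 \<le> degree G x \<longleftrightarrow>
     (\<exists>e\<in>edges G. \<exists>f\<in>edges G. \<exists>g\<in>edges G. x \<in> e \<and> x \<in> f \<and> x \<in> g \<and> e \<noteq> f \<and> f \<noteq> g \<and> e \<noteq> g)"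
proof -
  have "3 \<le> degree G x \<longleftrightarrow> infinite {e \<in> edges G. x \<in> e} \<or> 3 \<le> card {e \<in> edges G. x \<in> e}"
    by (simp add: degree_def numeral_eq_enat)
  then show ?thesis
    unfolding infinite_or_card_ge_3_iff by auto
qed

text \<open>The degree condition at the cut-vertices; a vertex in two different maximal inseparable
  sets is automatically a cut-vertex, so \<open>c\<close> may range over everything.\<close>

definition at_most_two_blocks :: "'a graph \<Rightarrow> bool" where
  "at_most_two_blocks G \<longleftrightarrow> (\<forall>c R S T. max_insep G R \<longrightarrow> max_insep G S \<longrightarrow> max_insep G T \<longrightarrow>
     c \<in> R \<longrightarrow> c \<in> S \<longrightarrow> c \<in> T \<longrightarrow> R = S \<or> S = T \<or> R = T)"

text \<open>The degree condition at the blocks.\<close>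

definition at_most_two_cut_vertices :: "'a graph \<Rightarrow> bool" where
  "at_most_two_cut_vertices G \<longleftrightarrow> (\<forall>S a b c. max_insep G S \<longrightarrow>
     a \<in> S \<inter> cut_vertices G \<longrightarrow> b \<in> S \<inter> cut_vertices G \<longrightarrow> c \<in> S \<inter> cut_vertices G \<longrightarrow> a = b \<or> b = c \<or> a = c)"

lemma edges_block_graph:
  assumes "simple_graph G"
  shows "edges (block_graph G) =
    {{Inl c, Inr (induced G S)} | c S. c \<in> cut_vertices G \<and> max_insep G S \<and> c \<in> S}"
  unfolding block_graph_def blocks_eq[OF assms] by fastforce

lemma verts_block_graph:
  assumes "simple_graph G"
  shows "verts (block_graph G) = Inl ` cut_vertices G \<union> (\<lambda>S. Inr (induced G S)) ` {S. max_insep G S}"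
  unfolding block_graph_def blocks_eq[OF assms] by auto

text \<open>Three edges at a cut-vertex differ in their blocks, and three edges at a block differ in
  their cut-vertices.\<close>

lemma block_graph_degree_iff:
  assumes G: "simple_graph G"
  shows "(\<exists>x\<in>verts (block_graph G). 3 \<le> degree (block_graph G) x) \<longleftrightarrow>
    \<not> (at_most_two_blocks G \<and> at_most_two_cut_vertices G)"
proof
  assume "\<exists>x\<in>verts (block_graph G). 3 \<le> degree (block_graph G) x"
  then obtain x e f g where x: "x \<in> verts (block_graph G)" and
    efg: "e \<in> edges (block_graph G)" "f \<in> edges (block_graph G)" "g \<in> edges (block_graph G)"
    "x \<in> e" "x \<in> f" "x \<in> g" "e \<noteq> f" "f \<noteq> g" "e \<noteq> g"
    unfolding degree_ge_3_iff by blast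
  obtain a R where a: "e = {Inl a, Inr (induced G R)}" "a \<in> cut_vertices G" "max_insep G R" "a \<in> R"
    using efg(1) unfolding edges_block_graph[OF G] by auto
  obtain b S where b: "f = {Inl b, Inr (induced G S)}" "b \<in> cut_vertices G" "max_insep G S" "b \<in> S"
    using efg(2) unfolding edges_block_graph[OF G] by auto
  obtain c T where c: "g = {Inl c, Inr (induced G T)}" "c \<in> cut_vertices G" "max_insep G T" "c \<in> T"
    using efg(3) unfolding edges_block_graph[OF G] by auto
  show "\<not> (at_most_two_blocks G \<and> at_most_two_cut_vertices G)"
  proof (cases x)
    case (Inl d)
    then have "a = d" "b = d" "c = d"
      using efg(4-6) a(1) b(1) c(1) by auto
    moreover have "R \<noteq> S" "S \<noteq> T" "R \<noteq> T"
      using efg(7-9) a(1) b(1) c(1) calculation by auto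
    ultimately have "\<not> at_most_two_blocks G"
      using a b c unfolding at_most_two_blocks_def by metis
    then show ?thesis
      by simp
  next
    case (Inr B)
    then have *: "induced G R = B" "induced G S = B" "induced G T = B"
      using efg(4-6) a(1) b(1) c(1) by auto
    then have "S = R" "T = R"
      using inj_induced by metis+
    moreover have "a \<noteq> b" "b \<noteq> c" "a \<noteq> c"
      using efg(7-9) a(1) b(1) c(1) * by auto
    ultimately have "\<not> at_most_two_cut_vertices G"
      using a b c unfolding at_most_two_cut_vertices_def by (metis IntI)
    then show ?thesis
      by simp
  qed
next
  have edge: "{Inl c, Inr (induced G S)} \<in> edges (block_graph G)"
    if "c \<in> cut_vertices G" "max_insep G S" "c \<in> S" for c S
    using that unfolding edges_block_graph[OF G] by auto
  assume "\<not> (at_most_two_blocks G \<and> at_most_two_cut_vertices G)"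
  then consider "\<not> at_most_two_blocks G" | "\<not> at_most_two_cut_vertices G"
    by auto
  then show "\<exists>x\<in>verts (block_graph G). 3 \<le> degree (block_graph G) x"
  proof cases
    case 1
    then obtain c R S T where *: "max_insep G R" "max_insep G S" "max_insep G T" "c \<in> R" "c \<in> S" "c \<in> T"
      "R \<noteq> S" "S \<noteq> T" "R \<noteq> T"
      unfolding at_most_two_blocks_def by auto
    have c: "c \<in> cut_vertices G"
      by (rule max_insep_shared_imp_cut_vertex[OF *(1,2,7,4,5)])
    have "induced G R \<noteq> induced G S" "induced G S \<noteq> induced G T" "induced G R \<noteq> induced G T"
      using *(7-9) inj_induced by metis+
    then have "3 \<le> degree (block_graph G) (Inl c)"
      unfolding degree_ge_3_iff
      using edge[OF c *(1,4)] edge[OF c *(2,5)] edge[OF c *(3,6)]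
      by (intro bexI[of _ "{Inl c, Inr (induced G R)}"] bexI[of _ "{Inl c, Inr (induced G S)}"]
          bexI[of _ "{Inl c, Inr (induced G T)}"]) (auto simp: doubleton_eq_iff)
    then show ?thesis
      using c unfolding verts_block_graph[OF G] by auto
  next
    case 2
    then obtain S a b c where *: "max_insep G S" "a \<in> S" "a \<in> cut_vertices G" "b \<in> S" "b \<in> cut_vertices G"
      "c \<in> S" "c \<in> cut_vertices G" "a \<noteq> b" "b \<noteq> c" "a \<noteq> c"
      unfolding at_most_two_cut_vertices_def by auto
    then have "3 \<le> degree (block_graph G) (Inr (induced G S))"
      unfolding degree_ge_3_iff
      using edge[OF *(3,1,2)] edge[OF *(5,1,4)] edge[OF *(7,1,6)]
      by (intro bexI[of _ "{Inl a, Inr (induced G S)}"] bexI[of _ "{Inl b, Inr (induced G S)}"]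
          bexI[of _ "{Inl c, Inr (induced G S)}"]) (auto simp: doubleton_eq_iff)
    then show ?thesis
      using * unfolding verts_block_graph[OF G] by auto
  qed
qed

section \<open>Connectedness of the block graph\<close>

lemma max_insep_nonempty: "max_insep G S \<Longrightarrow> v \<in> verts G \<Longrightarrow> S \<noteq> {}"
  using insep_singleton[of v G] unfolding max_insep_def by auto

lemma adj_block_graph:
  assumes "simple_graph G" "c \<in> cut_vertices G" "max_insep G S" "c \<in> S"
  shows "(Inl c, Inr (induced G S)) \<in> adj (block_graph G)" "(Inr (induced G S), Inl c) \<in> adj (block_graph G)"
  using assms(2-4) unfolding adj_def edges_block_graph[OF assms(1)] by (auto simp: insert_commute)

text \<open>A walk of \<open>G\<close> is followed by blocks containing its edges, a walk of the
  block graph by the vertices of its blocks. As \<open>G\<close> is nonempty, so is every block,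
  which ties each vertex of the block graph to a vertex of \<open>G\<close>.\<close>

lemma block_graph_connected_iff:
  assumes G: "simple_graph G" and ne: "verts G \<noteq> {}"
  shows "graph_connected (block_graph G) \<longleftrightarrow> graph_connected G"
proof
  let ?r = "(adj (block_graph G))\<^sup>*"
  assume "graph_connected G"
  then have con: "(u, v) \<in> reach G {}" if "u \<in> verts G" "v \<in> verts G" for u v
    using that by (simp add: graph_connected_def reach_empty)
  \<comment> \<open>Two different blocks with a common vertex are joined in the block graph through
    it, as it is a cut-vertex.\<close>
  have share: "(Inr (induced G S), Inr (induced G T)) \<in> ?r"
    if S: "max_insep G S" "u \<in> S" and T: "max_insep G T" "u \<in> T" for S T u
  proof (cases "S = T")
    case False
    then have "u \<in> cut_vertices G"
      using max_insep_shared_imp_cut_vertex[OF S(1) T(1) _ S(2) T(2)] by simp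
    then show ?thesis
      using adj_block_graph(2)[OF G _ S] adj_block_graph(1)[OF G _ T]
      by (meson converse_rtrancl_into_rtrancl r_into_rtrancl)
  qed simp
  have blocks: "(Inr (induced G S), Inr (induced G T)) \<in> ?r"
    if S: "max_insep G S" "u \<in> S" and uv: "(u, v) \<in> reach G {}" and T: "max_insep G T" "v \<in> T" for S T u v
    using uv T unfolding reach_def
  proof (induction arbitrary: T rule: rtrancl_induct)
    case base
    then show ?case
      using share[OF S] by simp
  next
    case (step v w)
    have "{v, w} \<in> edges G"
      using step.hyps(2) by (simp add: adj_remove_verts)
    then obtain D where D: "max_insep G D" "v \<in> D" "w \<in> D"
      using ex_max_insep_edge[OF G] by auto
    show ?case
      using step.IH[OF D(1,2)] share[OF D(1,3) step.prems] by (rule rtrancl_trans)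
  qed
  have insep_V: "S \<subseteq> verts G" if "max_insep G S" for S
    using that by (auto simp: max_insep_def insep_def)
  have to_block: "\<exists>S u. max_insep G S \<and> u \<in> S \<and> (x, Inr (induced G S)) \<in> ?r \<and> (Inr (induced G S), x) \<in> ?r"
    if x: "x \<in> verts (block_graph G)" for x
  proof -
    consider c where "x = Inl c" "c \<in> cut_vertices G" | S where "x = Inr (induced G S)" "max_insep G S"
      using x unfolding verts_block_graph[OF G] by auto
    then show ?thesis
    proof cases
      case 1
      then have "c \<in> verts G"
        by (simp add: cut_vertices_def)
      then obtain S where S: "max_insep G S" "c \<in> S"
        using ex_max_insep_vertex by metis
      then show ?thesis
        using adj_block_graph[OF G 1(2) S] 1(1) by auto
    next
      case 2
      then show ?thesis
        using ne max_insep_nonempty[OF 2(2)] by auto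
    qed
  qed
  show "graph_connected (block_graph G)"
    unfolding graph_connected_def
  proof (intro ballI)
    fix x y assume xy: "x \<in> verts (block_graph G)" "y \<in> verts (block_graph G)"
    obtain S u where S: "max_insep G S" "u \<in> S" "(x, Inr (induced G S)) \<in> ?r"
      using to_block[OF xy(1)] by auto
    obtain T v where T: "max_insep G T" "v \<in> T" "(Inr (induced G T), y) \<in> ?r"
      using to_block[OF xy(2)] by auto
    have "(Inr (induced G S), Inr (induced G T)) \<in> ?r"
      using insep_V S T by (intro blocks[OF S(1,2) con T(1,2)]) auto
    then show "(x, y) \<in> ?r"
      using S(3) T(3) by (meson rtrancl_trans)
  qed
next
  assume con: "graph_connected (block_graph G)"
  show "graph_connected G"
    unfolding graph_connected_def reach_empty[symmetric]
  proof (intro ballI)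
    fix u v assume uv: "u \<in> verts G" "v \<in> verts G"
    obtain S where S: "max_insep G S" "u \<in> S"
      using ex_max_insep_vertex[OF uv(1)] by auto
    obtain T where T: "max_insep G T" "v \<in> T"
      using ex_max_insep_vertex[OF uv(2)] by auto
    have "(Inr (induced G S), Inr (induced G T)) \<in> (adj (block_graph G))\<^sup>*"
      using con S(1) T(1) unfolding graph_connected_def verts_block_graph[OF G] by auto
    \<comment> \<open>Invariant along the walk: \<open>u\<close> reaches the cut-vertex, or every
      vertex of the block, that the walk has arrived at.\<close>
    moreover have "case x of Inl c \<Rightarrow> (u, c) \<in> reach G {} | Inr B \<Rightarrow> \<forall>w\<in>verts B. (u, w) \<in> reach G {}"
      if "(Inr (induced G S), x) \<in> (adj (block_graph G))\<^sup>*" for x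
      using that
    proof (induction rule: rtrancl_induct)
      case base
      then show ?case
        using insepD_empty[OF max_insep_insep[OF S(1)] S(2)] by simp
    next
      case (step x y)
      then have "{x, y} \<in> edges (block_graph G)"
        by (simp add: adj_def)
      then obtain c D where D: "{x, y} = {Inl c, Inr (induced G D)}" "max_insep G D" "c \<in> D"
        unfolding edges_block_graph[OF G] by auto
      then consider "x = Inl c" "y = Inr (induced G D)" | "x = Inr (induced G D)" "y = Inl c"
        by (auto simp: doubleton_eq_iff)
      then show ?case
      proof cases
        case 1
        then have "(u, c) \<in> reach G {}"
          using step.IH by simp
        then show ?thesis
          using 1 insepD_empty[OF max_insep_insep[OF D(2)] D(3)] by (auto intro: reach_trans)
      next
        case 2
        then show ?thesis
          using step.IH D(3) by simp
      qed
    qed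
    ultimately show "(u, v) \<in> reach G {}"
      using T(2) by fastforce
  qed
qed

section \<open>Middles of all triples bound the degrees\<close>

lemma nsep_imp_at_most_two_blocks:
  assumes \<Phi>: "\<And>x y z. x \<in> verts G \<Longrightarrow> y \<in> verts G \<Longrightarrow> z \<in> verts G \<Longrightarrow> x \<noteq> y \<Longrightarrow> y \<noteq> z \<Longrightarrow> x \<noteq> z \<Longrightarrow>
    nsep G x y z \<or> nsep G y x z \<or> nsep G x z y"
  shows "at_most_two_blocks G"
  unfolding at_most_two_blocks_def
proof (intro allI impI, rule ccontr)
  fix c R S T
  assume R: "max_insep G R" "c \<in> R" and S: "max_insep G S" "c \<in> S" and T: "max_insep G T" "c \<in> T"
    and "\<not> (R = S \<or> S = T \<or> R = T)"
  then have ne: "R \<noteq> S" "S \<noteq> T" "R \<noteq> T"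
    by auto
  obtain x where x: "x \<in> R - {c}"
    using max_insep_not_subset[OF R(1) S(1) ne(1)] S(2) by auto
  obtain y where y: "y \<in> S - {c}"
    using max_insep_not_subset[OF S(1) T(1) ne(2)] T(2) by auto
  obtain z where z: "z \<in> T - {c}"
    using max_insep_not_subset[OF T(1) R(1)] ne(3) R(2) by auto
  have xy: "(x, y) \<notin> reach G {c}"
    by (rule max_insep_separated[OF R(1) S(1) ne(1) R(2) S(2) x y])
  have yz: "(y, z) \<notin> reach G {c}"
    by (rule max_insep_separated[OF S(1) T(1) ne(2) S(2) T(2) y z])
  have xz: "(x, z) \<notin> reach G {c}"
    by (rule max_insep_separated[OF R(1) T(1) ne(3) R(2) T(2) x z])
  have "x \<noteq> y" "y \<noteq> z" "x \<noteq> z"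
    using xy yz xz by auto
  moreover have "x \<in> verts G" "y \<in> verts G" "z \<in> verts G"
    using R(1) S(1) T(1) x y z by (auto simp: max_insep_def insep_def)
  ultimately have "nsep G x y z \<or> nsep G y x z \<or> nsep G x z y"
    by (intro \<Phi>)
  then show False
  proof (elim disjE)
    assume "nsep G x y z"
    then show False
      using nsepD[of G x y z c] y xy yz reach_sym[of y x G "{c}"] by auto
  next
    assume "nsep G y x z"
    then show False
      using nsepD[of G y x z c] x xy xz by auto
  next
    assume "nsep G x z y"
    then show False
      using nsepD[of G x z y c] z xz yz reach_sym[of z x G "{c}"] reach_sym[of z y G "{c}"] by auto
  qed
qed

text \<open>Of two vertices separated by \<open>a\<close>, at most one can reach
  \<open>S - {a}\<close> in \<open>G - a\<close>, because this set stays connected there.\<close>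

lemma cut_vertex_imp_separated_from_block:
  assumes S: "insep G S" and a: "a \<in> cut_vertices G"
  shows "\<exists>x\<in>verts G - {a}. \<forall>s\<in>S - {a}. (x, s) \<notin> reach G {a}"
proof (rule ccontr)
  assume *: "\<not> ?thesis"
  obtain u v where uv: "u \<in> verts G - {a}" "v \<in> verts G - {a}" "(u, v) \<notin> reach G {a}"
    using a unfolding cut_vertices_def reach_def by auto
  obtain s where s: "s \<in> S - {a}" "(u, s) \<in> reach G {a}"
    using * uv(1) by auto
  obtain t where t: "t \<in> S - {a}" "(v, t) \<in> reach G {a}"
    using * uv(2) by auto
  have "(s, t) \<in> reach G {a}"
    using insepD[OF S, of s t a] s t by auto
  then show False
    using uv(3) s(2) reach_sym[OF t(2)] reach_trans by metis
qed

text \<open>Behind each of the three cut-vertices of \<open>S\<close> lies a vertex that it cuts off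
  from \<open>S\<close>, and hence from the two vertices behind the others. So none of these three
  vertices can be a middle.\<close>

lemma nsep_imp_at_most_two_cut_vertices:
  assumes con: "\<And>u v. u \<in> verts G \<Longrightarrow> v \<in> verts G \<Longrightarrow> (u, v) \<in> reach G {}"
    and \<Phi>: "\<And>x y z. x \<in> verts G \<Longrightarrow> y \<in> verts G \<Longrightarrow> z \<in> verts G \<Longrightarrow> x \<noteq> y \<Longrightarrow> y \<noteq> z \<Longrightarrow> x \<noteq> z \<Longrightarrow>
      nsep G x y z \<or> nsep G y x z \<or> nsep G x z y"
  shows "at_most_two_cut_vertices G"
  unfolding at_most_two_cut_vertices_def
proof (intro allI impI, rule ccontr)
  fix S a b c
  assume S: "max_insep G S" and a: "a \<in> S \<inter> cut_vertices G" and b: "b \<in> S \<inter> cut_vertices G"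
    and c: "c \<in> S \<inter> cut_vertices G" and "\<not> (a = b \<or> b = c \<or> a = c)"
  then have ne: "a \<noteq> b" "b \<noteq> c" "a \<noteq> c"
    by auto
  note ins = max_insep_insep[OF S]
  have V: "S \<subseteq> verts G"
    using ins by (simp add: insep_def)
  \<comment> \<open>A path from \<open>y\<close> to \<open>b\<close> enters \<open>S\<close> only at
    \<open>b\<close>, so it avoids \<open>a\<close>; if \<open>x\<close> reached \<open>y\<close>
    without \<open>a\<close>, it would thus reach \<open>b \<in> S - {a}\<close>.\<close>
  have sep: "(x, y) \<notin> reach G {a}"
    if ab: "a \<in> S" "b \<in> S" "a \<noteq> b" and x: "\<forall>s\<in>S - {a}. (x, s) \<notin> reach G {a}"
      and y: "y \<in> verts G" "\<forall>s\<in>S - {b}. (y, s) \<notin> reach G {b}" for a b x y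
  proof
    assume xy: "(x, y) \<in> reach G {a}"
    have "(y, b) \<in> reach G {}"
      using con[OF y(1)] V ab(2) by auto
    then obtain P where P: "spath G P" "hd P = y" "last P = b"
      by (rule reach_spath)
    have P': "P \<noteq> []" "distinct P" "successively (\<lambda>a b. {a, b} \<in> edges G) P"
      using P(1) by (auto simp: spath_def)
    \<comment> \<open>Meeting \<open>a\<close> before its end \<open>b\<close>, the path would join
      \<open>y\<close> to \<open>S - {b}\<close> without \<open>b\<close>.\<close>
    have "a \<notin> set P"
    proof
      assume "a \<in> set P"
      then obtain P1 P2 where P12: "P = P1 @ a # P2"
        by (meson split_list)
      then have "P2 \<noteq> []"
        using P(3) ab(3) by auto
      then have "b \<in> set P2"
        using P(3) P12 by auto
      then have "b \<notin> set (P1 @ [a])"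
        using P'(2) P12 by auto
      moreover have "successively (\<lambda>a b. {a, b} \<in> edges G) (P1 @ [a])"
        using P'(3) P12 by (auto simp: successively_append_iff)
      ultimately have "(hd (P1 @ [a]), last (P1 @ [a])) \<in> reach G {b}"
        by (intro walk_reach) auto
      moreover have "hd (P1 @ [a]) = y"
        using P(2) P12 by (cases P1) auto
      ultimately show False
        using y(2) ab(1,3) by auto
    qed
    then have "(y, b) \<in> reach G {a}"
      using walk_reach[OF P'(3,1), of "{a}"] P(2,3) by simp
    then show False
      using x ab reach_trans[OF xy] by auto
  qed
  obtain x where x: "x \<in> verts G - {a}" "\<forall>s\<in>S - {a}. (x, s) \<notin> reach G {a}"
    using cut_vertex_imp_separated_from_block[OF ins, of a] a by auto
  obtain y where y: "y \<in> verts G - {b}" "\<forall>s\<in>S - {b}. (y, s) \<notin> reach G {b}"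
    using cut_vertex_imp_separated_from_block[OF ins, of b] b by auto
  obtain z where z: "z \<in> verts G - {c}" "\<forall>s\<in>S - {c}. (z, s) \<notin> reach G {c}"
    using cut_vertex_imp_separated_from_block[OF ins, of c] c by auto
  have 1: "(x, y) \<notin> reach G {a}" "(x, z) \<notin> reach G {a}"
    using sep[of a b x y] sep[of a c x z] a b c ne x y z by auto
  have 2: "(y, x) \<notin> reach G {b}" "(y, z) \<notin> reach G {b}"
    using sep[of b a y x] sep[of b c y z] a b c ne x y z by auto
  have 3: "(z, x) \<notin> reach G {c}" "(z, y) \<notin> reach G {c}"
    using sep[of c a z x] sep[of c b z y] a b c ne x y z by auto
  have "x \<noteq> y" "y \<noteq> z" "x \<noteq> z"
    using 1 2 by auto
  then have "nsep G x y z \<or> nsep G y x z \<or> nsep G x z y"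
    using x(1) y(1) z(1) by (intro \<Phi>) auto
  then show False
    using nsepD[of G x y z b] nsepD[of G y x z a] nsepD[of G x z y c] 1 2 3 x(1) y(1) z(1) by auto
qed

section \<open>From the block graph to a chain\<close>

text \<open>A greedy walk that never turns straight back. Where it gets stuck, the only possible
  neighbour is the one it came from.\<close>

lemma ex_forward_walk:
  fixes N :: "'s \<Rightarrow> 's \<Rightarrow> bool"
  shows "\<exists>(w :: nat \<Rightarrow> 's) D. w 0 = p \<and> w 1 = q \<and> 0 \<in> D \<and> 1 \<in> D \<and>
    (\<forall>n m. n \<in> D \<longrightarrow> m \<le> n \<longrightarrow> m \<in> D) \<and>
    (\<forall>n. n + 2 \<in> D \<longrightarrow> N (w (n + 1)) (w (n + 2)) \<and> w (n + 2) \<noteq> w n) \<and>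
    (\<forall>n z. n + 1 \<in> D \<longrightarrow> n + 2 \<notin> D \<longrightarrow> N (w (n + 1)) z \<longrightarrow> z = w n)"
proof -
  \<comment> \<open>The state holds two consecutive places, because the next choice has to avoid the
    previous place.\<close>
  define st where "st = rec_nat (p, q) (\<lambda>_ (x, y). (y, SOME z. N y z \<and> z \<noteq> x))"
  define w where "w n = fst (st n)" for n
  have st0: "st 0 = (p, q)" and stS: "st (Suc n) = (snd (st n), SOME z. N (snd (st n)) z \<and> z \<noteq> fst (st n))" for n
    by (simp_all add: st_def split_beta)
  have w2: "w (n + 2) = (SOME z. N (w (n + 1)) z \<and> z \<noteq> w n)" for n
    by (simp add: w_def stS)
  \<comment> \<open>Beyond a dead end \<open>SOME\<close> returns an arbitrary value;
    \<open>D\<close> holds the indices for which all choices so far were genuine.\<close>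
  define D where "D = {n. \<forall>m. m + 2 \<le> n \<longrightarrow> (\<exists>z. N (w (m + 1)) z \<and> z \<noteq> w m)}"
  show ?thesis
  proof (rule exI[of _ w], rule exI[of _ D], intro conjI; (intro allI impI)?)
    show "w 0 = p" "w 1 = q"
      by (simp_all add: w_def st0 stS)
    show "0 \<in> D" "1 \<in> D"
      by (simp_all add: D_def)
    show "m \<in> D" if "n \<in> D" "m \<le> n" for m n
      using that by (auto simp: D_def)
    show "N (w (n + 1)) (w (n + 2)) \<and> w (n + 2) \<noteq> w n" if "n + 2 \<in> D" for n
    proof -
      have "\<exists>z. N (w (n + 1)) z \<and> z \<noteq> w n"
        using that unfolding D_def by blast
      then show ?thesis
        unfolding w2 by (rule someI_ex)
    qed
    show "z = w n" if D: "n + 1 \<in> D" "n + 2 \<notin> D" and z: "N (w (n + 1)) z" for n z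
    proof (rule ccontr)
      assume "z \<noteq> w n"
      then have "n + 2 \<in> D"
        using D(1) z unfolding D_def by (auto simp: le_Suc_eq)
      then show False
        using D(2) by simp
    qed
  qed
qed

text \<open>Two greedy walks, started in opposite directions from the step between \<open>p\<close>
  and \<open>q\<close>, are glued. The result may still be periodic here; repetitions are excluded
  for blocks in \<open>walk_of_blocks_disjoint\<close>.\<close>

lemma ex_two_way_walk:
  fixes N :: "'s \<Rightarrow> 's \<Rightarrow> bool"
  assumes sym: "\<And>x y. N x y \<Longrightarrow> N y x"
    and two: "\<And>x a b c. N x a \<Longrightarrow> N x b \<Longrightarrow> N x c \<Longrightarrow> a = b \<or> b = c \<or> a = c"
    and pq: "N p q"
  shows "\<exists>(I :: int set) h. h 0 = p \<and> 0 \<in> I \<and>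
    (\<forall>i j k. i \<in> I \<longrightarrow> j \<in> I \<longrightarrow> i \<le> k \<longrightarrow> k \<le> j \<longrightarrow> k \<in> I) \<and>
    (\<forall>i. i \<in> I \<longrightarrow> i + 1 \<in> I \<longrightarrow> N (h i) (h (i + 1))) \<and>
    (\<forall>i. i \<in> I \<longrightarrow> i + 2 \<in> I \<longrightarrow> h i \<noteq> h (i + 2)) \<and>
    (\<forall>i z. i \<in> I \<longrightarrow> N (h i) z \<longrightarrow> (\<exists>j\<in>I. z = h j))"
proof -
  obtain w :: "nat \<Rightarrow> 's" and D where w: "w 0 = p" "w 1 = q" "0 \<in> D" "1 \<in> D"
    "\<forall>n m. n \<in> D \<longrightarrow> m \<le> n \<longrightarrow> m \<in> D"
    "\<forall>n. n + 2 \<in> D \<longrightarrow> N (w (n + 1)) (w (n + 2)) \<and> w (n + 2) \<noteq> w n"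
    "\<forall>n z. n + 1 \<in> D \<longrightarrow> n + 2 \<notin> D \<longrightarrow> N (w (n + 1)) z \<longrightarrow> z = w n"
    using ex_forward_walk[of p q N] by (elim exE conjE)
  obtain w' :: "nat \<Rightarrow> 's" and D' where w': "w' 0 = q" "w' 1 = p" "0 \<in> D'" "1 \<in> D'"
    "\<forall>n m. n \<in> D' \<longrightarrow> m \<le> n \<longrightarrow> m \<in> D'"
    "\<forall>n. n + 2 \<in> D' \<longrightarrow> N (w' (n + 1)) (w' (n + 2)) \<and> w' (n + 2) \<noteq> w' n"
    "\<forall>n z. n + 1 \<in> D' \<longrightarrow> n + 2 \<notin> D' \<longrightarrow> N (w' (n + 1)) z \<longrightarrow> z = w' n"
    using ex_forward_walk[of q p N] by (elim exE conjE)
  note w = w(1-4) w(5-7)[rule_format] and w' = w'(1-4) w'(5-7)[rule_format]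
  \<comment> \<open>\<open>w\<close> occupies 0, 1, 2, ... and \<open>w'\<close> occupies 1, 0, -1,
    ...; they agree at 0 and 1, where both pass \<open>p\<close> and \<open>q\<close>.\<close>
  define h where "h i = (if 0 \<le> i then w (nat i) else w' (nat (1 - i)))" for i :: int
  define I where "I = {i :: int. 0 \<le> i \<and> nat i \<in> D \<or> i \<le> 1 \<and> nat (1 - i) \<in> D'}"
  have h_nn: "h (int n) = w n" for n
    by (simp add: h_def)
  have h_np: "h (1 - int n) = w' n" for n
  proof -
    consider "n = 0" | "n = 1" | "n \<ge> 2"
      by linarith
    then show ?thesis
    proof cases
      case 3
      then have "nat (1 - (1 - int n)) = n" "1 - int n < 0"
        by auto
      then show ?thesis
        by (simp add: h_def)
    qed (use w(1,2) w'(1,2) in \<open>auto simp: h_def\<close>)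
  qed
  have I_nn: "int n \<in> I \<longleftrightarrow> n \<in> D" for n
  proof
    assume "int n \<in> I"
    then consider "n \<in> D" | "n \<le> 1"
      unfolding I_def by auto
    then show "n \<in> D"
      using w(4,5) by cases auto
  qed (simp add: I_def)
  have I_np: "1 - int n \<in> I \<longleftrightarrow> n \<in> D'" for n
  proof
    assume "1 - int n \<in> I"
    then consider "n \<in> D'" | "n \<le> 1"
      unfolding I_def by auto
    then show "n \<in> D'"
      using w'(4,5) by cases auto
  qed (simp add: I_def)
  \<comment> \<open>Every \<open>i\<close> is a place \<open>n + 1\<close> of \<open>w\<close> or of
    \<open>w'\<close>, hence has a predecessor there; this is where the no-return and dead-end
    clauses apply.\<close>
  have form: "(\<exists>n. i = int n + 1) \<or> (\<exists>n. i = - int n)" for i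
  proof (cases "i \<ge> 1")
    case True
    then have "i = int (nat (i - 1)) + 1"
      by simp
    then show ?thesis
      by blast
  next
    case False
    then have "i = - int (nat (- i))"
      by simp
    then show ?thesis
      by blast
  qed
  have fwd: "N (h i) (h (i + 1)) \<and> (i - 1 \<in> I \<longrightarrow> h (i - 1) \<noteq> h (i + 1))" if "i = int n + 1" "i + 1 \<in> I" for i n
  proof -
    have i: "i = int (n + 1)" "i + 1 = int (n + 2)" "i - 1 = int n"
      using that(1) by auto
    have eq: "h i = w (n + 1)" "h (i + 1) = w (n + 2)" "h (i - 1) = w n"
      using h_nn[of "n + 1", folded i(1)] h_nn[of "n + 2", folded i(2)] h_nn[of n, folded i(3)] .
    have "n + 2 \<in> D"
      using that(2) unfolding i(2) I_nn .
    from w(6)[OF this] show ?thesis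
      unfolding eq by metis
  qed
  have bwd: "N (h (i - 1)) (h i) \<and> (i + 1 \<in> I \<longrightarrow> h (i - 1) \<noteq> h (i + 1))" if "i = - int n" "i - 1 \<in> I" for i n
  proof -
    have i: "i = 1 - int (n + 1)" "i - 1 = 1 - int (n + 2)" "i + 1 = 1 - int n"
      using that(1) by auto
    have eq: "h i = w' (n + 1)" "h (i - 1) = w' (n + 2)" "h (i + 1) = w' n"
      using h_np[of "n + 1", folded i(1)] h_np[of "n + 2", folded i(2)] h_np[of n, folded i(3)] .
    have "n + 2 \<in> D'"
      using that(2) unfolding i(2) I_np .
    from w'(6)[OF this] show ?thesis
      unfolding eq using sym by metis
  qed
  have steps: "N (h i) (h (i + 1))" if "i \<in> I" "i + 1 \<in> I" for i
  proof -
    consider "i = 0" | n where "i = int n + 1" | n where "i + 1 = - int n"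
      using form[of i] form[of "i + 1"] by force
    then show ?thesis
    proof cases
      case 1
      then show ?thesis
        using h_nn[of 0] h_nn[of 1] w(1,2) pq by simp
    next
      case 2
      then show ?thesis
        using fwd[OF 2 that(2)] by metis
    next
      case 3
      then show ?thesis
        using bwd[OF 3] that(1) by (metis add_diff_cancel_right')
    qed
  qed
  have turn: "h (i - 1) \<noteq> h (i + 1)" if "i - 1 \<in> I" "i + 1 \<in> I" for i
    using form[of i]
  proof (elim disjE exE)
    fix n assume "i = int n + 1"
    from fwd[OF this that(2)] that(1) show ?thesis
      by simp
  next
    fix n assume "i = - int n"
    from bwd[OF this that(1)] that(2) show ?thesis
      by simp
  qed
  show ?thesis
  proof (rule exI[of _ I], rule exI[of _ h], intro conjI; (intro allI impI)?)
    show "h 0 = p"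
      using h_nn[of 0] w(1) by simp
    show "0 \<in> I"
      using I_nn[of 0] w(3) by simp
    show "N (h i) (h (i + 1))" if "i \<in> I" "i + 1 \<in> I" for i
      using steps that .
    show "h i \<noteq> h (i + 2)" if "i \<in> I" "i + 2 \<in> I" for i
      using turn[of "i + 1"] that by (simp add: add.commute)
    show "k \<in> I" if "i \<in> I" "j \<in> I" "i \<le> k" "k \<le> j" for i j k
    proof (cases "k \<ge> 0")
      case True
      then have "j = int (nat j)" "k = int (nat k)" "nat k \<le> nat j"
        using that by auto
      then show ?thesis
        using w(5)[of "nat j" "nat k"] that(2) I_nn[of "nat j"] I_nn[of "nat k"] by simp
    next
      case False
      then have "i = 1 - int (nat (1 - i))" "k = 1 - int (nat (1 - k))" "nat (1 - k) \<le> nat (1 - i)"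
        using that by auto
      then show ?thesis
        using w'(5)[of "nat (1 - i)" "nat (1 - k)"] that(1) I_np[of "nat (1 - i)"] I_np[of "nat (1 - k)"] by simp
    qed
    \<comment> \<open>With both adjacent places present, two different neighbours are known and
      there is no third; at an end of \<open>I\<close> the dead-end clause applies.\<close>
    show "\<exists>j\<in>I. z = h j" if i: "i \<in> I" and z: "N (h i) z" for i z
    proof (cases "i + 1 \<in> I \<and> i - 1 \<in> I")
      case True
      then have "N (h i) (h (i + 1))" "N (h i) (h (i - 1))"
        using steps[of i] steps[of "i - 1"] i sym by auto
      moreover have "h (i - 1) \<noteq> h (i + 1)"
        using turn[of i] True by simp
      ultimately have "z = h (i + 1) \<or> z = h (i - 1)"
        using two z by metis
      then show ?thesis
        using True by auto
    next
      case False
      from form[of i] show ?thesis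
      proof (elim disjE exE)
        fix n assume n: "i = int n + 1"
        then have *: "i = int (n + 1)" "i + 1 = int (n + 2)" "i - 1 = int n"
          by auto
        have eq: "h i = w (n + 1)" "h (i - 1) = w n"
          using h_nn[of "n + 1", folded *(1)] h_nn[of n, folded *(3)] .
        have D: "n + 1 \<in> D"
          using i unfolding *(1) I_nn .
        then have "n \<in> D"
          using w(5)[of "n + 1" n] by simp
        then have im: "i - 1 \<in> I"
          unfolding *(3) I_nn .
        then have "n + 2 \<notin> D"
          using False I_nn[of "n + 2"] unfolding *(2)[symmetric] by simp
        then have "z = w n"
          using w(7)[OF D _ z[unfolded eq]] by simp
        then show ?thesis
          using im eq(2) by metis
      next
        fix n assume n: "i = - int n"
        then have *: "i = 1 - int (n + 1)" "i - 1 = 1 - int (n + 2)" "i + 1 = 1 - int n"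
          by auto
        have eq: "h i = w' (n + 1)" "h (i + 1) = w' n"
          using h_np[of "n + 1", folded *(1)] h_np[of n, folded *(3)] .
        have D: "n + 1 \<in> D'"
          using i unfolding *(1) I_np .
        then have "n \<in> D'"
          using w'(5)[of "n + 1" n] by simp
        then have im: "i + 1 \<in> I"
          unfolding *(3) I_np .
        then have "n + 2 \<notin> D'"
          using False I_np[of "n + 2"] unfolding *(2)[symmetric] by simp
        then have "z = w' n"
          using w'(7)[OF D _ z[unfolded eq]] by simp
        then show ?thesis
          using im eq(2) by metis
      qed
    qed
  qed
qed

section \<open>Walks through blocks that meet\<close>

definition neighbours :: "'a graph \<Rightarrow> 'a set \<Rightarrow> 'a set \<Rightarrow> bool" where
  "neighbours G S T \<longleftrightarrow> max_insep G S \<and> max_insep G T \<and> S \<noteq> T \<and> S \<inter> T \<noteq> {}"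

text \<open>Neighbours of \<open>S\<close> are attached at cut-vertices in \<open>S\<close>, of
  which there are at most two, and each of these lies in at most one further block.\<close>

lemma neighbours_at_most_two:
  assumes B: "at_most_two_blocks G" and C: "at_most_two_cut_vertices G"
    and N: "neighbours G S P" "neighbours G S Q" "neighbours G S R"
  shows "P = Q \<or> Q = R \<or> P = R"
proof -
  obtain a where a: "a \<in> S" "a \<in> P"
    using N(1) by (auto simp: neighbours_def)
  obtain b where b: "b \<in> S" "b \<in> Q"
    using N(2) by (auto simp: neighbours_def)
  obtain c where c: "c \<in> S" "c \<in> R"
    using N(3) by (auto simp: neighbours_def)
  have S: "max_insep G S" and P: "max_insep G P" "S \<noteq> P" and Q: "max_insep G Q" "S \<noteq> Q"
    and R: "max_insep G R" "S \<noteq> R"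
    using N by (auto simp: neighbours_def)
  have cut: "a \<in> cut_vertices G" "b \<in> cut_vertices G" "c \<in> cut_vertices G"
    using max_insep_shared_imp_cut_vertex[OF S P a] max_insep_shared_imp_cut_vertex[OF S Q b]
      max_insep_shared_imp_cut_vertex[OF S R c] .
  have eq: "X = Y" if "max_insep G X" "S \<noteq> X" "max_insep G Y" "S \<noteq> Y" "d \<in> S" "d \<in> X" "d \<in> Y" for X Y d
    using B S that unfolding at_most_two_blocks_def by metis
  have "a = b \<or> b = c \<or> a = c"
    using C S a(1) b(1) c(1) cut unfolding at_most_two_cut_vertices_def by (metis IntI)
  then show ?thesis
    using eq[OF P Q, of a] eq[OF Q R, of b] eq[OF P R, of a] a b c by auto
qed

text \<open>Along a walk of \<open>G\<close>, blocks containing consecutive edges share a vertex, so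
  they are equal or neighbours.\<close>

lemma neighbour_closed_imp_all:
  assumes G: "simple_graph G" and con: "graph_connected G" and ne: "verts G \<noteq> {}"
    and S: "max_insep G S" "S \<in> \<B>" and closed: "\<And>P Q. P \<in> \<B> \<Longrightarrow> neighbours G P Q \<Longrightarrow> Q \<in> \<B>"
    and sub: "\<And>P. P \<in> \<B> \<Longrightarrow> max_insep G P" and T: "max_insep G T"
  shows "T \<in> \<B>"
proof -
  obtain v0 where v0: "v0 \<in> verts G"
    using ne by auto
  obtain u where u: "u \<in> S"
    using max_insep_nonempty[OF S(1) v0] by auto
  obtain v where v: "v \<in> T"
    using max_insep_nonempty[OF T v0] by auto
  have share: "Q \<in> \<B>" if "P \<in> \<B>" "max_insep G Q" "x \<in> P" "x \<in> Q" for P Q x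
    using closed[OF that(1), of Q] sub[OF that(1)] that by (cases "P = Q") (auto simp: neighbours_def)
  have "u \<in> verts G" "v \<in> verts G"
    using S(1) T u v by (auto simp: max_insep_def insep_def)
  then have "(u, v) \<in> reach G {}"
    using con by (simp add: graph_connected_def reach_empty)
  then show ?thesis
    using T v unfolding reach_def
  proof (induction arbitrary: T rule: rtrancl_induct)
    case base
    then show ?case
      using share[OF S(2) _ u] by simp
  next
    case (step x y)
    have "{x, y} \<in> edges G"
      using step.hyps(2) by (simp add: adj_remove_verts)
    then obtain D where D: "max_insep G D" "x \<in> D" "y \<in> D"
      using ex_max_insep_edge[OF G] by auto
    show ?case
      using share[OF step.IH[OF D(1,2)] step.prems(1) D(3) step.prems(2)] .
  qed
qed

text \<open>Induction on the distance \<open>n\<close>, for all starting places at once.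
  Disjointness alone would not carry over; the separation of \<open>h i\<close> from all later
  blocks by the vertex shared with \<open>h (i + 1)\<close> does.\<close>

lemma walk_of_blocks_disjoint:
  fixes h :: "int \<Rightarrow> 'a set"
  assumes B: "at_most_two_blocks G"
    and I: "\<And>i j k. i \<in> I \<Longrightarrow> j \<in> I \<Longrightarrow> i \<le> k \<Longrightarrow> k \<le> j \<Longrightarrow> k \<in> I"
    and N: "\<And>i. i \<in> I \<Longrightarrow> i + 1 \<in> I \<Longrightarrow> neighbours G (h i) (h (i + 1))"
    and nb: "\<And>i. i \<in> I \<Longrightarrow> i + 2 \<in> I \<Longrightarrow> h i \<noteq> h (i + 2)"
  shows "i \<in> I \<Longrightarrow> i + int n \<in> I \<Longrightarrow>
    (1 \<le> n \<longrightarrow> (\<forall>c\<in>h i \<inter> h (i + 1). \<forall>u\<in>h i - {c}. \<forall>w\<in>h (i + int n) - {c}. (u, w) \<notin> reach G {c})) \<and>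
    (2 \<le> n \<longrightarrow> h i \<inter> h (i + int n) = {})"
proof (induction n arbitrary: i)
  case (Suc n)
  define j where "j = i + int n"
  have j1: "i + int (Suc n) = j + 1"
    by (simp add: j_def)
  have jI: "j \<in> I" "j + 1 \<in> I" and iI: "i \<in> I" "i + 1 \<in> I"
    using Suc.prems I[OF Suc.prems, of j] I[OF Suc.prems, of "i + 1"] unfolding j1 by (auto simp: j_def)
  have nij: "neighbours G (h i) (h (i + 1))" "neighbours G (h j) (h (j + 1))"
    using N iI jI by auto
  then have mi: "max_insep G (h i)" "max_insep G (h (i + 1))" "h i \<noteq> h (i + 1)"
    and mj: "max_insep G (h j)" "max_insep G (h (j + 1))" "h j \<noteq> h (j + 1)"
    by (auto simp: neighbours_def)
  have two: "P = Q \<or> Q = R \<or> P = R"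
    if "max_insep G P" "max_insep G Q" "max_insep G R" "c \<in> P" "c \<in> Q" "c \<in> R" for P Q R c
    using B that unfolding at_most_two_blocks_def by metis
  have IHi: "1 \<le> n \<Longrightarrow> c \<in> h i \<Longrightarrow> c \<in> h (i + 1) \<Longrightarrow> u \<in> h i - {c} \<Longrightarrow> w \<in> h j - {c} \<Longrightarrow> (u, w) \<notin> reach G {c}"
    "2 \<le> n \<Longrightarrow> h i \<inter> h j = {}" for c u w
    using Suc.IH[of i] iI jI unfolding j_def by auto
  have IHi1: "2 \<le> n \<Longrightarrow> h (i + 1) \<inter> h (j + 1) = {}"
    using Suc.IH[of "i + 1"] iI jI unfolding j_def by (auto simp: algebra_simps)
  \<comment> \<open>For \<open>n > 0\<close>, the block \<open>h (j + 1)\<close> is entered from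
    \<open>h j\<close> at \<open>e\<close>. If \<open>e \<noteq> c\<close>, the induction hypothesis
    separates \<open>u\<close> from \<open>e\<close>. If \<open>e = c\<close>, either
    \<open>n = 1\<close> and three different blocks contain \<open>c\<close>, or \<open>c\<close>
    lies in the disjoint blocks \<open>h i\<close> and \<open>h j\<close>.\<close>
  have A: "(u, w) \<notin> reach G {c}"
    if c: "c \<in> h i" "c \<in> h (i + 1)" and u: "u \<in> h i - {c}" and w: "w \<in> h (j + 1) - {c}" for c u w
  proof
    assume uw: "(u, w) \<in> reach G {c}"
    show False
    proof (cases "n = 0")
      case True
      then show False
        using max_insep_separated[OF mi c u, of w] w uw by (simp add: j_def)
    next
      case n: False
      obtain e where e: "e \<in> h j" "e \<in> h (j + 1)"
        using nij(2) by (auto simp: neighbours_def)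
      show False
      proof (cases "e = c")
        case False
        then have "(u, e) \<in> reach G {c}"
          using insepD[OF max_insep_insep[OF mj(2)], of w e c] w e(2) reach_trans[OF uw] by auto
        then show False
          using IHi(1)[OF _ c u, of e] n e(1) False by auto
      next
        case True
        show False
        proof (cases "n = 1")
          case True
          then have "c \<in> h (i + 2)" "i + 2 \<in> I" "h (i + 1) \<noteq> h (i + 2)" "max_insep G (h (i + 2))"
            using \<open>e = c\<close> e(2) jI mj unfolding j_def by (auto simp: algebra_simps)
          then show False
            using two[OF mi(1,2), of "h (i + 2)" c] c mi(3) nb[OF iI(1)] by auto
        next
          case False
          then show False
            using IHi(2) n c(1) e(1) \<open>e = c\<close> by auto
        qed
      qed
    qed
  qed
  \<comment> \<open>By \<open>A\<close> with both vertices equal, a common vertex must be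
    \<open>c\<close>; then \<open>c\<close> lies in three blocks, and these are pairwise
    different.\<close>
  have D: "h i \<inter> h (j + 1) = {}" if n: "1 \<le> n"
  proof (rule ccontr)
    assume "h i \<inter> h (j + 1) \<noteq> {}"
    then obtain v where v: "v \<in> h i" "v \<in> h (j + 1)"
      by auto
    obtain c where c: "c \<in> h i" "c \<in> h (i + 1)"
      using nij(1) by (auto simp: neighbours_def)
    obtain u where u: "u \<in> h i - {c}"
      using max_insep_not_subset[OF mi] c(2) by auto
    have "v = c"
      using A[OF c, of v v] v by auto
    then have "h i = h (i + 1) \<or> h (i + 1) = h (j + 1) \<or> h i = h (j + 1)"
      using two[OF mi(1,2) mj(2), of c] c v by auto
    moreover have "h (i + 1) \<noteq> h (j + 1)"
    proof (cases "n = 1")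
      case True
      then show ?thesis
        using mj(3) by (simp add: j_def)
    next
      case False
      then show ?thesis
        using IHi1 n c(2) by auto
    qed
    moreover have "h i \<noteq> h (j + 1)"
      using A[OF c u, of u] u by auto
    ultimately show False
      using mi(3) by auto
  qed
  show ?case
    unfolding j1 using A D by auto
qed simp

lemma at_most_two_imp_chain:
  assumes G: "simple_graph G" and con: "graph_connected G" and ne: "verts G \<noteq> {}"
    and B: "at_most_two_blocks G" and C: "at_most_two_cut_vertices G"
  shows "chain_graph_with_links (k_connected 2) G"
proof -
  have "\<exists>I h. (I :: int set) \<noteq> {} \<and> (\<forall>i\<in>I. \<forall>j\<in>I. {i..j} \<subseteq> I) \<and> h ` I = {S. max_insep G S} \<and>
    (\<forall>i\<in>I. \<forall>j\<in>I. i + 1 < j \<longrightarrow> h i \<inter> h j = {}) \<and>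
    (\<forall>i. i \<in> I \<and> i + 1 \<in> I \<longrightarrow> neighbours G (h i) (h (i + 1)))"
  proof (cases "\<exists>P Q. neighbours G P Q")
    \<comment> \<open>If no two blocks meet, connectedness leaves a single block, and the chain has
      one link.\<close>
    case False
    obtain v where v: "v \<in> verts G"
      using ne by auto
    obtain S where S: "max_insep G S"
      using ex_max_insep_vertex[OF v] by auto
    have "T = S" if "max_insep G T" for T
    proof -
      have "T \<in> {S}"
        by (rule neighbour_closed_imp_all[OF G con ne S _ _ _ that]) (use S False in auto)
      then show ?thesis
        by simp
    qed
    then have eq: "{S. max_insep G S} = {S}"
      using S by blast
    show ?thesis
      unfolding eq by (intro exI[of _ "{0}"] exI[of _ "\<lambda>_. S"]) auto
  next
    case True
    then obtain P Q where PQ: "neighbours G P Q"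
      by auto
    have ex: "\<exists>(I :: int set) h. h 0 = P \<and> 0 \<in> I \<and>
      (\<forall>i j k. i \<in> I \<longrightarrow> j \<in> I \<longrightarrow> i \<le> k \<longrightarrow> k \<le> j \<longrightarrow> k \<in> I) \<and>
      (\<forall>i. i \<in> I \<longrightarrow> i + 1 \<in> I \<longrightarrow> neighbours G (h i) (h (i + 1))) \<and>
      (\<forall>i. i \<in> I \<longrightarrow> i + 2 \<in> I \<longrightarrow> h i \<noteq> h (i + 2)) \<and>
      (\<forall>i z. i \<in> I \<longrightarrow> neighbours G (h i) z \<longrightarrow> (\<exists>j\<in>I. z = h j))"
    proof (rule ex_two_way_walk[of "neighbours G", OF _ _ PQ])
      show "neighbours G T S" if "neighbours G S T" for S T
        using that by (auto simp: neighbours_def)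
    qed (rule neighbours_at_most_two[OF B C])
    obtain I and h :: "int \<Rightarrow> 'a set" where h: "h 0 = P" "0 \<in> I"
      "\<forall>i j k. i \<in> I \<longrightarrow> j \<in> I \<longrightarrow> i \<le> k \<longrightarrow> k \<le> j \<longrightarrow> k \<in> I"
      "\<forall>i. i \<in> I \<longrightarrow> i + 1 \<in> I \<longrightarrow> neighbours G (h i) (h (i + 1))"
      "\<forall>i. i \<in> I \<longrightarrow> i + 2 \<in> I \<longrightarrow> h i \<noteq> h (i + 2)"
      "\<forall>i z. i \<in> I \<longrightarrow> neighbours G (h i) z \<longrightarrow> (\<exists>j\<in>I. z = h j)"
      using ex by (elim exE conjE)
    note h = h(1,2) h(3-6)[rule_format]
    have P: "max_insep G P"
      using PQ by (simp add: neighbours_def)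
    \<comment> \<open>An index \<open>i \<noteq> 0\<close> has an adjacent index in \<open>I\<close>
      on the side of 0, so \<open>h i\<close> belongs to a pair of neighbours.\<close>
    have max: "max_insep G (h i)" if i: "i \<in> I" for i
    proof (cases "i = 0")
      case False
      then consider "i - 1 \<in> I" | "i + 1 \<in> I"
        using h(3)[OF h(2) i, of "i - 1"] h(3)[OF i h(2), of "i + 1"] by linarith
      then show ?thesis
        using h(4)[of "i - 1"] h(4)[of i] i by cases (auto simp: neighbours_def)
    qed (use h(1) P in simp)
    have "T \<in> h ` I" if "max_insep G T" for T
    proof (rule neighbour_closed_imp_all[OF G con ne P _ _ _ that])
      show "P \<in> h ` I"
        using h(1,2) by auto
      show "Q \<in> h ` I" if "P \<in> h ` I" "neighbours G P Q" for P Q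
        using that h(6) by auto
    qed (use max in auto)
    then have "h ` I = {S. max_insep G S}"
      using max by blast
    moreover have "h i \<inter> h j = {}" if ij: "i \<in> I" "j \<in> I" "i + 1 < j" for i j
    proof -
      have j: "j = i + int (nat (j - i))"
        using ij(3) by simp
      have "h i \<inter> h (i + int (nat (j - i))) = {}"
      proof (rule walk_of_blocks_disjoint[where I = I, THEN conjunct2, THEN mp, OF B])
        show "i + int (nat (j - i)) \<in> I"
          using ij(2) j by simp
        show "2 \<le> nat (j - i)"
          using ij(3) by simp
      qed (fact ij(1) h(3-5))+
      then show ?thesis
        using j by simp
    qed
    moreover have "{i..j} \<subseteq> I" if "i \<in> I" "j \<in> I" for i j
      using h(3)[OF that] by auto
    moreover have "I \<noteq> {}"
      using h(2) by auto
    ultimately show ?thesis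
      using h(4) by (intro exI[of _ I] exI[of _ h] conjI ballI allI impI) simp_all
  qed
  then obtain I :: "int set" and h where h: "I \<noteq> {}" "\<forall>i\<in>I. \<forall>j\<in>I. {i..j} \<subseteq> I" "h ` I = {S. max_insep G S}"
    "\<forall>i\<in>I. \<forall>j\<in>I. i + 1 < j \<longrightarrow> h i \<inter> h j = {}"
    "\<forall>i. i \<in> I \<and> i + 1 \<in> I \<longrightarrow> neighbours G (h i) (h (i + 1))"
    by (elim exE conjE)
  have max: "max_insep G (h i)" if "i \<in> I" for i
    using that h(3) by auto
  have V: "h i \<subseteq> verts G" if "i \<in> I" for i
    using max_insep_insep[OF max[OF that]] by (simp add: insep_def)
  have cover: "\<exists>i\<in>I. S = h i" if "max_insep G S" for S
    using that h(3) by auto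
  have "chain_of_links G I (\<lambda>i. induced G (h i))"
    unfolding chain_of_links_def verts_induced
  proof (intro conjI)
    show "\<forall>i\<in>I. subgraph (induced G (h i)) G"
      by (intro ballI subgraph_induced[OF G] V)
    show "verts G = (\<Union>i\<in>I. h i)"
    proof
      show "verts G \<subseteq> (\<Union>i\<in>I. h i)"
      proof
        fix v assume "v \<in> verts G"
        then obtain S where "max_insep G S" "v \<in> S"
          using ex_max_insep_vertex by metis
        then show "v \<in> (\<Union>i\<in>I. h i)"
          using cover[of S] by auto
      qed
      show "(\<Union>i\<in>I. h i) \<subseteq> verts G"
        using V by (rule UN_least)
    qed
    show "edges G = (\<Union>i\<in>I. edges (induced G (h i)))"
    proof
      show "edges G \<subseteq> (\<Union>i\<in>I. edges (induced G (h i)))"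
      proof
        fix e assume e: "e \<in> edges G"
        then obtain u v where uv: "e = {u, v}"
          using G by (metis card_2_iff simple_graph_def)
        then obtain S where "max_insep G S" "u \<in> S" "v \<in> S"
          using ex_max_insep_edge[OF G, of u v] e by auto
        then obtain i where "i \<in> I" "e \<subseteq> h i"
          using cover[of S] uv by auto
        then show "e \<in> (\<Union>i\<in>I. edges (induced G (h i)))"
          using e by (auto simp: edges_induced)
      qed
    qed (auto simp: edges_induced)
    show "\<forall>i. i \<in> I \<and> i + 1 \<in> I \<longrightarrow> (\<exists>v. h i \<inter> h (i + 1) = {v})"
    proof (intro allI impI)
      fix i assume "i \<in> I \<and> i + 1 \<in> I"
      then have N: "max_insep G (h i)" "max_insep G (h (i + 1))" "h i \<noteq> h (i + 1)" "h i \<inter> h (i + 1) \<noteq> {}"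
        using h(5)[rule_format, of i] by (auto simp: neighbours_def)
      then obtain v where v: "v \<in> h i" "v \<in> h (i + 1)"
        by auto
      have "x = v" if "x \<in> h i \<inter> h (i + 1)" for x
        using max_insep_Int[OF N(1-3) v, of x] that by simp
      then have "h i \<inter> h (i + 1) = {v}"
        using v by blast
      then show "\<exists>v. h i \<inter> h (i + 1) = {v}"
        by (rule exI)
    qed
  qed (fact h)+
  moreover have "k_connected 2 (induced G (h i))" if "i \<in> I" for i
    using max_insep_k_connected[OF G max[OF that]] .
  ultimately show ?thesis
    using con unfolding chain_graph_with_links_def by (intro conjI exI[of _ I] exI[of _ "\<lambda>i. induced G (h i)"]) simp_all
qed

text \<open>The conditions are linked through a further one, connectedness together with both
  \<open>at_most_two\<close> bounds: it follows from \<open>n_ac 3 G\<close>, yields the chain, and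
  is a reformulation of the block graph condition.\<close>

theorem theorem3p1p2:
  fixes G :: "'a graph"
  assumes "simple_graph G"
    and "\<exists>u\<in>verts G. \<exists>v\<in>verts G. u \<noteq> v"
  shows "(n_ac 3 G \<longleftrightarrow> chain_graph_with_links (k_connected 2) G) \<and>
    (n_ac 3 G \<longleftrightarrow>
       graph_connected (block_graph G) \<and>
       \<not> (\<exists>x\<in>verts (block_graph G). degree (block_graph G) x \<ge> 3))"
proof -
  have G: "simple_graph G" and ne: "verts G \<noteq> {}"
    using assms by auto
  have "graph_connected G \<and> at_most_two_blocks G \<and> at_most_two_cut_vertices G" if n: "n_ac 3 G"
  proof -
    have con: "(u, v) \<in> reach G {}" if "u \<in> verts G" "v \<in> verts G" for u v
      using n_ac_imp_reach[OF G n _ that] by simp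
    have "at_most_two_blocks G"
      by (rule nsep_imp_at_most_two_blocks) (rule n_ac_3_imp_nsep[OF G n])
    moreover have "at_most_two_cut_vertices G"
      by (rule nsep_imp_at_most_two_cut_vertices[OF con n_ac_3_imp_nsep[OF G n]])
    ultimately show ?thesis
      using con by (simp add: graph_connected_def reach_empty)
  qed
  moreover have "chain_graph_with_links (k_connected 2) G"
    if "graph_connected G \<and> at_most_two_blocks G \<and> at_most_two_cut_vertices G"
    using at_most_two_imp_chain[OF G _ ne] that by simp
  moreover have "n_ac 3 G" if chain: "chain_graph_with_links (k_connected 2) G"
  proof -
    obtain I L where "graph_connected G" and L: "chain_of_links G I L" "\<And>i. i \<in> I \<Longrightarrow> k_connected 2 (L i)"
      using chain unfolding chain_graph_with_links_def by auto
    obtain u v where uv: "u \<in> verts G" "v \<in> verts G" "u \<noteq> v"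
      using assms(2) by auto
    then have "(u, v) \<in> (adj G)\<^sup>*"
      using \<open>graph_connected G\<close> by (simp add: graph_connected_def)
    \<comment> \<open>Here the two distinct vertices enter: the 1-complex of a single vertex is one
      point and contains no arc.\<close>
    then have "edges G \<noteq> {}"
      using uv(3) by (auto simp: adj_def elim: converse_rtranclE)
    moreover obtain lt where "linear_nsep lt G"
      using chain_imp_linear_nsep[OF G L] by auto
    ultimately show ?thesis
      using linear_nsep_imp_n_ac_3[OF G] by simp
  qed
  ultimately show ?thesis
    unfolding block_graph_connected_iff[OF G ne] block_graph_degree_iff[OF G] by argo
qed

end
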